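(* For each quasi-periodic labelling $\rho$, the first $\ell^2$-Betti number of $G_\rho$ is equal to $0$, i.e. $\beta^{(2)}_1(G_\rho)=0$.
   Context: $\beta^{(2)}_1(G)\in[0,\infty]$ denotes the (standard) first $\ell^2$-Betti number of a countable discrete group $G$. Maps act on the right: $x\cdot f$ is the image of $x$ under $f$, and $fg$ means first $f$, then $g$. $\mathrm{Supp}(f)=\{x : x\cdot f\neq x\}$. Thompson's group $F$ is the group of piecewise linear orientation-preserving homeomorphisms of $[0,1]$ that are differentiable except at finitely many dyadic rationals and whose derivatives, where they exist, are integer powers of $2$; $F'=[F,F]$. For dyadic rationals $0\le r<s\le 1$, $F_{[r,s]}$ is the subgroup of elements of $F$ with support in $[r,s]$. Let $\iota_0$ be the map $t\mapsto 1-t$ of $[0,1]$. Fix $c_0\in F$ with $\mathrm{Supp}(c_0)=(0,\tfrac14)$, $x\cdot c_0>x$ for all $x\in(0,\tfrac14)$, and $t\cdot c_0=2t$ for $t\in(0,\tfrac1{16})$. Put $c_1=\iota_0 c_0\iota_0$ and $\nu_1=c_0c_1$. Fix homeomorphisms $\nu_2,\nu_3$ of $[0,1]$ with supports in $(\tfrac1{16},\tfrac{15}{16})$ that generate $F_{[1/16,15/16]}$. Let $H=\langle F',\nu_1\rangle=\langle \nu_1,\nu_2,\nu_3\rangle$. A labelling is a map $\rho:\tfrac12\mathbf{Z}\to\{a,b,a^{-1},b^{-1}\}$ with $\rho(k)\in\{a,a^{-1}\}$ for $k\in\mathbf{Z}$ and $\rho(k)\in\{b,b^{-1}\}$ for $k\in\tfrac12\mathbf{Z}\setminus\mathbf{Z}$.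 A block is a set $X=\{k,k+\tfrac12,\ldots,k+\tfrac12 n\}$ with $k\in\tfrac12\mathbf{Z}$, $n\in\mathbf{N}$; its word is $W_\rho(X)=\rho(k)\rho(k+\tfrac12)\cdots\rho(k+\tfrac12n)$, and $W_\rho^{-1}(X)$ is the formal inverse word (reverse the order and invert each letter). The labelling $\rho$ is quasi-periodic if (1) for each block $X$ there is $n\in\mathbf{N}$ such that for every block $Y$ of size at least $n$, $W_\rho(X)$ is a subword (string of consecutive letters) of $W_\rho(Y)$; and (2) for each block $X$ there is a block $Y$ with $W_\rho(Y)=W_\rho^{-1}(X)$. For a labelling $\rho$ and $i\in\{1,2,3\}$ define homeomorphisms $\zeta_i,\chi_i$ of $\mathbf{R}$ by: for $n\in\mathbf{Z}$, $t\in[0,1]$, $(n+t)\cdot\zeta_i=n+t\cdot\nu_i$ if $\rho(n+\tfrac12)=b$ and $(n+t)\cdot\zeta_i=n+t\cdot(\iota_0\nu_i\iota_0)$ if $\rho(n+\tfrac12)=b^{-1}$; $(n-\tfrac12+t)\cdot\chi_i=n-\tfrac12+t\cdot\nu_i$ if $\rho(n)=a$ and $(n-\tfrac12+t)\cdot\chi_i=n-\tfrac12+t\cdot(\iota_0\nu_i\iota_0)$ if $\rho(n)=a^{-1}$. Then $G_\rho=\langle\zeta_1,\zeta_2,\zeta_3,\chi_1,\chi_2,\chi_3\rangle<\mathrm{Homeo}^+(\mathbf{R})$. *)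

theory Defs
  imports
    "HOL-Analysis.Analysis"
    "HOL-Algebra.Algebra"
    "HOL-Library.Sublist"
begin

section \<open>Left modules over a ring that need not be commutative\<close>

text \<open>
  The record type \<open>('r, 'm) module\<close> and the predicate \<open>submodule\<close> of HOL-Algebra make no use of
  commutativity of the scalars, but the locale \<open>module\<close> does, so it is not used here. Of a module
  record only the carrier, the additive structure and the scalar multiplication matter.
\<close>

definition left_module_iso ::
  "('r, 'x) ring_scheme \<Rightarrow> ('r, 'm, 'y) module_scheme \<Rightarrow> ('r, 'n, 'z) module_scheme \<Rightarrow> bool" where
  "left_module_iso R M N \<longleftrightarrow>
     (\<exists>\<phi>. bij_betw \<phi> (carrier M) (carrier N) \<and>
          (\<forall>x\<in>carrier M. \<forall>y\<in>carrier M. \<phi> (x \<oplus>\<^bsub>M\<^esub> y) = \<phi> x \<oplus>\<^bsub>N\<^esub> \<phi> y) \<and>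
          (\<forall>r\<in>carrier R. \<forall>x\<in>carrier M. \<phi> (r \<odot>\<^bsub>M\<^esub> x) = r \<odot>\<^bsub>N\<^esub> \<phi> x))"

text \<open>The free left module on \<open>I\<close>: finitely supported families, extended by zero outside \<open>I\<close>.\<close>

definition free_left_module ::
  "('r, 'x) ring_scheme \<Rightarrow> 'i set \<Rightarrow> ('r, 'i \<Rightarrow> 'r) module" where
  "free_left_module R I =
     \<lparr>carrier = {c. (\<forall>i. c i \<in> carrier R) \<and> {i. c i \<noteq> \<zero>\<^bsub>R\<^esub>} \<subseteq> I \<and> finite {i. c i \<noteq> \<zero>\<^bsub>R\<^esub>}},
      mult = undefined, one = undefined,
      ring.zero = (\<lambda>i. \<zero>\<^bsub>R\<^esub>), ring.add = (\<lambda>c d i. c i \<oplus>\<^bsub>R\<^esub> d i),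
      smult = (\<lambda>r c i. r \<otimes>\<^bsub>R\<^esub> c i)\<rparr>"

definition single :: "('r, 'x) ring_scheme \<Rightarrow> 'i \<Rightarrow> 'r \<Rightarrow> 'i \<Rightarrow> 'r" where
  "single R i r = (\<lambda>j. if j = i then r else \<zero>\<^bsub>R\<^esub>)"

definition quotient_left_module ::
  "('r, 'm, 'y) module_scheme \<Rightarrow> 'm set \<Rightarrow> ('r, 'm set) module" where
  "quotient_left_module M N =
     \<lparr>carrier = a_rcosets\<^bsub>M\<^esub> N,
      mult = undefined, one = undefined,
      ring.zero = N, ring.add = set_add M,
      smult = (\<lambda>r A. \<Union>x\<in>A. N +>\<^bsub>M\<^esub> (r \<odot>\<^bsub>M\<^esub> x))\<rparr>"

definition idempotent_matrix :: "('r, 'x) ring_scheme \<Rightarrow> nat \<Rightarrow> (nat \<Rightarrow> nat \<Rightarrow> 'r) \<Rightarrow> bool" where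
  "idempotent_matrix R n A \<longleftrightarrow>
     (\<forall>i<n. \<forall>j<n. A i j \<in> carrier R) \<and>
     (\<forall>i<n. \<forall>j<n. (\<Oplus>\<^bsub>R\<^esub>k\<in>{..<n}. A i k \<otimes>\<^bsub>R\<^esub> A k j) = A i j)"

text \<open>The image of the map \<open>R\<^sup>n \<rightarrow> R\<^sup>n\<close>, \<open>x \<mapsto> xA\<close> of left modules (\<open>x\<close> a row vector).\<close>

definition row_image ::
  "('r, 'x) ring_scheme \<Rightarrow> nat \<Rightarrow> (nat \<Rightarrow> nat \<Rightarrow> 'r) \<Rightarrow> ('r, nat \<Rightarrow> 'r) module" where
  "row_image R n A =
     (free_left_module R {..<n})
       \<lparr>carrier := (\<lambda>x j. if j < n then \<Oplus>\<^bsub>R\<^esub>i\<in>{..<n}. x i \<otimes>\<^bsub>R\<^esub> A i j else \<zero>\<^bsub>R\<^esub>)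
                     ` carrier (free_left_module R {..<n})\<rparr>"


section \<open>The group von Neumann algebra\<close>

text \<open>Square-summable functions on \<open>G\<close>, extended by zero outside the carrier.\<close>

definition l2 :: "('g, 'x) monoid_scheme \<Rightarrow> ('g \<Rightarrow> complex) set" where
  "l2 G = {f. (\<forall>x. x \<notin> carrier G \<longrightarrow> f x = 0) \<and> (\<lambda>x. (cmod (f x))\<^sup>2) summable_on carrier G}"

definition l2_norm :: "('g, 'x) monoid_scheme \<Rightarrow> ('g \<Rightarrow> complex) \<Rightarrow> real" where
  "l2_norm G f = sqrt (\<Sum>\<^sub>\<infinity>x\<in>carrier G. (cmod (f x))\<^sup>2)"

definition left_translation ::
  "('g, 'x) monoid_scheme \<Rightarrow> 'g \<Rightarrow> ('g \<Rightarrow> complex) \<Rightarrow> 'g \<Rightarrow> complex" where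
  "left_translation G g f = (\<lambda>x. if x \<in> carrier G then f (inv\<^bsub>G\<^esub> g \<otimes>\<^bsub>G\<^esub> x) else 0)"

text \<open>
  \<open>N(G)\<close>, the algebra of bounded operators on \<open>\<ell>\<^sup>2(G)\<close> that commute with the left translations.
  Operators are functions on \<open>l2 G\<close>, undefined elsewhere.
\<close>

definition group_vN_algebra ::
  "('g, 'x) monoid_scheme \<Rightarrow> (('g \<Rightarrow> complex) \<Rightarrow> 'g \<Rightarrow> complex) ring" where
  "group_vN_algebra G =
     \<lparr>carrier = {T \<in> l2 G \<rightarrow>\<^sub>E l2 G.
        (\<forall>f\<in>l2 G. \<forall>h\<in>l2 G. T (\<lambda>x. f x + h x) = (\<lambda>x. T f x + T h x)) \<and>
        (\<forall>c. \<forall>f\<in>l2 G. T (\<lambda>x. c * f x) = (\<lambda>x. c * T f x)) \<and>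
        (\<exists>K. \<forall>f\<in>l2 G. l2_norm G (T f) \<le> K * l2_norm G f) \<and>
        (\<forall>g\<in>carrier G. \<forall>f\<in>l2 G.
           T (left_translation G g f) = left_translation G g (T f))},
      mult = compose (l2 G),
      one = (\<lambda>f\<in>l2 G. f),
      ring.zero = (\<lambda>f\<in>l2 G. \<lambda>x. 0),
      ring.add = (\<lambda>S T. \<lambda>f\<in>l2 G. \<lambda>x. S f x + T f x)\<rparr>"

text \<open>The embedding of \<open>G\<close> in \<open>N(G)\<close>; it is multiplicative and sends \<open>\<delta>\<^sub>y\<close> to \<open>\<delta>\<close> at \<open>y g\<^sup>-\<^sup>1\<close>.\<close>

definition right_translation ::
  "('g, 'x) monoid_scheme \<Rightarrow> 'g \<Rightarrow> ('g \<Rightarrow> complex) \<Rightarrow> 'g \<Rightarrow> complex" where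
  "right_translation G g = (\<lambda>f\<in>l2 G. \<lambda>x. if x \<in> carrier G then f (x \<otimes>\<^bsub>G\<^esub> g) else 0)"

text \<open>The von Neumann trace \<open>\<langle>T \<delta>\<^sub>1, \<delta>\<^sub>1\<rangle>\<close>.\<close>

definition vN_trace ::
  "('g, 'x) monoid_scheme \<Rightarrow> (('g \<Rightarrow> complex) \<Rightarrow> 'g \<Rightarrow> complex) \<Rightarrow> complex" where
  "vN_trace G T = T (\<lambda>x. if x = \<one>\<^bsub>G\<^esub> then 1 else 0) \<one>\<^bsub>G\<^esub>"


section \<open>Lueck's dimension and the first \<open>\<ell>\<^sup>2\<close>-Betti number\<close>

text \<open>
  \<open>P\<close> is a finitely generated projective left \<open>N(G)\<close>-module of von Neumann dimension \<open>d\<close>: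
  it is isomorphic to the image of an idempotent matrix, of trace \<open>d\<close>. The trace of an idempotent
  matrix over \<open>N(G)\<close> is a nonnegative real number depending only on its image up to isomorphism.
\<close>

definition fg_projective_of_dim ::
  "('g, 'x) monoid_scheme \<Rightarrow> (('g \<Rightarrow> complex) \<Rightarrow> 'g \<Rightarrow> complex, 'm, 'y) module_scheme \<Rightarrow> real \<Rightarrow> bool"
  where
  "fg_projective_of_dim G P d \<longleftrightarrow>
     (\<exists>n A. idempotent_matrix (group_vN_algebra G) n A \<and>
            left_module_iso (group_vN_algebra G) P (row_image (group_vN_algebra G) n A) \<and>
            d = Re (\<Sum>i<n. vN_trace G (A i i)))"

text \<open>The dimension of an arbitrary module: the supremum over its finitely generated projective
  submodules.\<close>

definition vN_dim ::
  "('g, 'x) monoid_scheme \<Rightarrow> (('g \<Rightarrow> complex) \<Rightarrow> 'g \<Rightarrow> complex, 'm, 'y) module_scheme \<Rightarrow> ennreal" where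
  "vN_dim G M =
     Sup {ennreal d | d P. submodule P (group_vN_algebra G) M \<and>
                           fg_projective_of_dim G (M\<lparr>carrier := P\<rparr>) d}"

text \<open>
  Degrees 2, 1, 0 of \<open>N(G) \<otimes>\<^bsub>\<int>G\<^esub> C\<^sub>*\<close>, where \<open>C\<^sub>*\<close> is the inhomogeneous bar resolution of \<open>\<int>\<close>
  (the cellular chain complex of the bar model of \<open>EG\<close>). Its boundary maps are
  \<open>x[g|h] \<mapsto> xg[h] - x[gh] + x[g]\<close> and \<open>x[g] \<mapsto> xg - x\<close>.
\<close>

definition bar_chains2 ::
  "('g, 'x) monoid_scheme \<Rightarrow>
   (('g \<Rightarrow> complex) \<Rightarrow> 'g \<Rightarrow> complex, 'g \<times> 'g \<Rightarrow> ('g \<Rightarrow> complex) \<Rightarrow> 'g \<Rightarrow> complex) module" where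
  "bar_chains2 G = free_left_module (group_vN_algebra G) (carrier G \<times> carrier G)"

definition bar_chains1 ::
  "('g, 'x) monoid_scheme \<Rightarrow>
   (('g \<Rightarrow> complex) \<Rightarrow> 'g \<Rightarrow> complex, 'g \<Rightarrow> ('g \<Rightarrow> complex) \<Rightarrow> 'g \<Rightarrow> complex) module" where
  "bar_chains1 G = free_left_module (group_vN_algebra G) (carrier G)"

definition bar_boundary2 ::
  "('g, 'x) monoid_scheme \<Rightarrow> ('g \<times> 'g \<Rightarrow> ('g \<Rightarrow> complex) \<Rightarrow> 'g \<Rightarrow> complex) \<Rightarrow>
   'g \<Rightarrow> ('g \<Rightarrow> complex) \<Rightarrow> 'g \<Rightarrow> complex" where
  "bar_boundary2 G c =
     (let N = group_vN_algebra G; C = bar_chains1 G in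
      \<Oplus>\<^bsub>C\<^esub>p\<in>{p. c p \<noteq> \<zero>\<^bsub>N\<^esub>}.
        (case p of (g, h) \<Rightarrow>
          single N h (c p \<otimes>\<^bsub>N\<^esub> right_translation G g)
            \<ominus>\<^bsub>C\<^esub> single N (g \<otimes>\<^bsub>G\<^esub> h) (c p)
            \<oplus>\<^bsub>C\<^esub> single N g (c p)))"

definition bar_boundary1 ::
  "('g, 'x) monoid_scheme \<Rightarrow> ('g \<Rightarrow> ('g \<Rightarrow> complex) \<Rightarrow> 'g \<Rightarrow> complex) \<Rightarrow>
   ('g \<Rightarrow> complex) \<Rightarrow> 'g \<Rightarrow> complex" where
  "bar_boundary1 G c =
     (let N = group_vN_algebra G in
      \<Oplus>\<^bsub>N\<^esub>g\<in>{g. c g \<noteq> \<zero>\<^bsub>N\<^esub>}. c g \<otimes>\<^bsub>N\<^esub> right_translation G g \<ominus>\<^bsub>N\<^esub> c g)"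

text \<open>\<open>H\<^sub>1(G; N(G))\<close>\<close>

definition vN_homology1 ::
  "('g, 'x) monoid_scheme \<Rightarrow>
   (('g \<Rightarrow> complex) \<Rightarrow> 'g \<Rightarrow> complex, ('g \<Rightarrow> ('g \<Rightarrow> complex) \<Rightarrow> 'g \<Rightarrow> complex) set) module" where
  "vN_homology1 G =
     quotient_left_module
       ((bar_chains1 G)
          \<lparr>carrier := {c \<in> carrier (bar_chains1 G). bar_boundary1 G c = \<zero>\<^bsub>group_vN_algebra G\<^esub>}\<rparr>)
       (bar_boundary2 G ` carrier (bar_chains2 G))"

definition first_l2_betti :: "('g, 'x) monoid_scheme \<Rightarrow> ennreal" where
  "first_l2_betti G = vN_dim G (vN_homology1 G)"


section \<open>Homeomorphisms of the unit interval and of the line\<close>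

text \<open>
  Maps act on the right, so the product \<open>f \<otimes> g\<close> is first \<open>f\<close>, then \<open>g\<close>.
  Homeomorphisms of \<open>[0,1]\<close> are represented by functions on \<open>\<real>\<close> that are the identity
  outside \<open>[0,1]\<close>; orientation-reversing ones are included.
\<close>

definition Homeo_unit :: "(real \<Rightarrow> real) monoid" where
  "Homeo_unit =
     \<lparr>carrier = {f. (\<exists>g. homeomorphism {0..1} {0..1} f g) \<and> (\<forall>x. x \<notin> {0..1} \<longrightarrow> f x = x)},
      mult = (\<lambda>f g. g \<circ> f), one = id\<rparr>"

definition Homeo_plus_real :: "(real \<Rightarrow> real) monoid" where
  "Homeo_plus_real =
     \<lparr>carrier = {f. (\<exists>g. homeomorphism UNIV UNIV f g) \<and> strict_mono f},
      mult = (\<lambda>f g. g \<circ> f), one = id\<rparr>"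

definition Supp :: "(real \<Rightarrow> real) \<Rightarrow> real set" where
  "Supp f = {x. f x \<noteq> x}"

definition piecewise_linear_unit :: "(real \<Rightarrow> real) \<Rightarrow> bool" where
  "piecewise_linear_unit f \<longleftrightarrow>
     (\<exists>S. finite S \<and>
          (\<forall>x\<in>{0..1}. \<forall>y\<in>{0..1}. x < y \<and> {x<..<y} \<inter> S = {} \<longrightarrow>
             (\<exists>m c. \<forall>t\<in>{x..y}. f t = m * t + c)))"

definition thompson_F :: "(real \<Rightarrow> real) monoid" where
  "thompson_F =
     Homeo_unit\<lparr>carrier :=
       {f \<in> carrier Homeo_unit.
          strict_mono_on {0..1} f \<and>
          piecewise_linear_unit f \<and>
          (\<exists>S. finite S \<and> S \<subseteq> dyadics \<and>
               (\<forall>x\<in>{0..1} - S. f differentiable (at x within {0..1}))) \<and>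
          (\<forall>x\<in>{0..1}. \<forall>D. (f has_real_derivative D) (at x within {0..1}) \<longrightarrow>
               (\<exists>k::int. D = 2 powi k))}\<rparr>"

definition thompson_F_on :: "real \<Rightarrow> real \<Rightarrow> (real \<Rightarrow> real) set" where
  "thompson_F_on r s = {f \<in> carrier thompson_F. Supp f \<subseteq> {r..s}}"

definition iota0 :: "real \<Rightarrow> real" where
  "iota0 t = (if t \<in> {0..1} then 1 - t else t)"

definition flip :: "(real \<Rightarrow> real) \<Rightarrow> real \<Rightarrow> real" where
  "flip f = iota0 \<otimes>\<^bsub>Homeo_unit\<^esub> f \<otimes>\<^bsub>Homeo_unit\<^esub> iota0"

definition nu1 :: "(real \<Rightarrow> real) \<Rightarrow> real \<Rightarrow> real" where
  "nu1 c0 = c0 \<otimes>\<^bsub>Homeo_unit\<^esub> flip c0"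


section \<open>Labellings\<close>

datatype letter = Gen_a | Gen_b | Gen_a_inv | Gen_b_inv

fun letter_inv :: "letter \<Rightarrow> letter" where
  "letter_inv Gen_a = Gen_a_inv"
| "letter_inv Gen_b = Gen_b_inv"
| "letter_inv Gen_a_inv = Gen_a"
| "letter_inv Gen_b_inv = Gen_b"

definition half_integers :: "real set" where
  "half_integers = {x. 2 * x \<in> \<int>}"

text \<open>Only the values of a labelling on \<open>half_integers\<close> matter.\<close>

definition labelling :: "(real \<Rightarrow> letter) \<Rightarrow> bool" where
  "labelling \<rho> \<longleftrightarrow>
     (\<forall>k\<in>\<int>. \<rho> k \<in> {Gen_a, Gen_a_inv}) \<and>
     (\<forall>k\<in>half_integers - \<int>. \<rho> k \<in> {Gen_b, Gen_b_inv})"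

definition is_block :: "real set \<Rightarrow> bool" where
  "is_block B \<longleftrightarrow> (\<exists>k\<in>half_integers. \<exists>n::nat. B = (\<lambda>i. k + real i / 2) ` {..n})"

definition block_word :: "(real \<Rightarrow> letter) \<Rightarrow> real set \<Rightarrow> letter list" where
  "block_word \<rho> B = map \<rho> (sorted_list_of_set B)"

definition inverse_word :: "letter list \<Rightarrow> letter list" where
  "inverse_word w = map letter_inv (rev w)"

definition quasi_periodic :: "(real \<Rightarrow> letter) \<Rightarrow> bool" where
  "quasi_periodic \<rho> \<longleftrightarrow>
     (\<forall>B. is_block B \<longrightarrow>
        (\<exists>n. \<forall>B'. is_block B' \<and> n \<le> card B' \<longrightarrow> sublist (block_word \<rho> B) (block_word \<rho> B'))) \<and>
     (\<forall>B. is_block B \<longrightarrow>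
        (\<exists>B'. is_block B' \<and> block_word \<rho> B' = inverse_word (block_word \<rho> B)))"


section \<open>The group of a labelling\<close>

text \<open>
  A point of \<open>\<real>\<close> is written as \<open>n + t\<close>, respectively \<open>n - 1/2 + t\<close>, with \<open>t \<in> [0,1)\<close>; for
  \<open>t = 1\<close> the defining formulas agree because \<open>\<nu>\<close> fixes the endpoints of \<open>[0,1]\<close>.
\<close>

definition zeta :: "(real \<Rightarrow> letter) \<Rightarrow> (real \<Rightarrow> real) \<Rightarrow> real \<Rightarrow> real" where
  "zeta \<rho> \<nu> x =
     (let n = of_int \<lfloor>x\<rfloor>; t = x - n in
      n + (if \<rho> (n + 1/2) = Gen_b then \<nu> t else flip \<nu> t))"

definition chi :: "(real \<Rightarrow> letter) \<Rightarrow> (real \<Rightarrow> real) \<Rightarrow> real \<Rightarrow> real" where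
  "chi \<rho> \<nu> x =
     (let n = of_int \<lfloor>x + 1/2\<rfloor>; t = x - (n - 1/2) in
      n - 1/2 + (if \<rho> n = Gen_a then \<nu> t else flip \<nu> t))"

definition G_rho ::
  "(real \<Rightarrow> real) \<Rightarrow> (real \<Rightarrow> real) \<Rightarrow> (real \<Rightarrow> real) \<Rightarrow> (real \<Rightarrow> letter) \<Rightarrow> (real \<Rightarrow> real) monoid" where
  "G_rho \<nu>1 \<nu>2 \<nu>3 \<rho> =
     Homeo_plus_real\<lparr>carrier :=
       generate Homeo_plus_real
         {zeta \<rho> \<nu>1, zeta \<rho> \<nu>2, zeta \<rho> \<nu>3, chi \<rho> \<nu>1, chi \<rho> \<nu>2, chi \<rho> \<nu>3}\<rparr>"

end

theory Submission
  imports Defs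
begin

text \<open>
  In the left \<open>\<int>G\<close>-module generated by symbols \<open>[g]\<close> with \<open>[gh] = [g] + g[h]\<close>, an identity
  \<open>hg = gk\<close> gives \<open>(h - 1)[g] = g[k] - [h]\<close>. Over \<open>N(G)\<close> the element \<open>h - 1\<close> is a non-zero-divisor
  when \<open>h\<close> has infinite order, and the non-zero-divisors satisfy the Ore condition. Hence, after
  inverting them, the set \<open>S\<close> of all \<open>g\<close> for which \<open>[g]\<close> is a multiple of a fixed \<open>[t]\<close> is a subgroup
  that contains every \<open>g\<close> conjugating a nontrivial element of \<open>S\<close> into \<open>S\<close>. If \<open>S = G\<close>, then every
  cycle is homologous, up to a non-zero-divisor, to some \<open>y[t]\<close> with \<open>y(t - 1) = 0\<close>, so \<open>H\<^sub>1(G; N(G))\<close>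
  is torsion, and its dimension is \<open>0\<close>.

  In \<open>G\<^sub>\<rho>\<close> take \<open>t\<close> to be the copy along the integer intervals of an element of Thompson's group
  supported in \<open>[3/8, 5/8]\<close>. It commutes with the copy of \<open>\<nu>\<^sub>1\<close>, with the copies of the elements
  supported in \<open>[1/16, 1/4]\<close>, and with the copy of the same element along the shifted intervals.
  Every \<open>f\<close> in \<open>F\<^bsub>[1/16, 15/16]\<^esub>\<close> conjugates an element supported close to \<open>1/16\<close> to one supported in
  \<open>[1/16, 1/4]\<close>. So \<open>S\<close> contains all six generators.
\<close>

section \<open>Hilbert spaces\<close>

text \<open>Two obstacles shape the proof. The first is analytic: non-zero-divisors of N(G) and
  their Ore condition are often treated through unbounded affiliated operators or polar
  decomposition. Here one finiteness fact, \<open>injective_dense_range\<close>, stands in for both;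
  it rests on comparing traces of powers and needs no functional calculus. The Ore condition applies
  it to 2x2 matrices, so commutants are treated abstractly and the trace is a sum over finitely many
  vectors. Inner products are real; complex linearity is encoded as commutation with complex
  multiples of translations.

  The second is dynamical: the support of an element of the Thompson subgroup may overlap
  [3/8, 5/8], so it need not commute with its counterpart there. Commutation gives way to
  conjugation: f fixes every point below 1/16, so by continuity a short interval starting at 1/16
  stays left of 1/4 under f.

  The interval [3/8, 5/8] is symmetric about 1/2, hence stable under flips; it misses (0, 1/4) and
  (3/4, 1), where \<nu>1 moves points; and it is disjoint modulo 1 from its translate by
  1/2.\<close>

lemma parallelogram_midpoint:
  fixes x u v :: "'h::real_inner"
  shows "(norm (u - v))\<^sup>2 =
    2 * (norm (x - u))\<^sup>2 + 2 * (norm (x - v))\<^sup>2 - 4 * (norm (x - (1/2) *\<^sub>R (u + v)))\<^sup>2"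
  by (simp add: power2_norm_eq_inner inner_diff_left inner_diff_right inner_add_left inner_add_right
      inner_commute algebra_simps)

lemma orthogonal_projection_exists:
  fixes V :: "'h::{real_inner,complete_space} set"
  assumes "closed V" "subspace V"
  shows "\<exists>p\<in>V. \<forall>v\<in>V. (x - p) \<bullet> v = 0"
proof -
  define D where "D = (\<lambda>v. (norm (x - v))\<^sup>2) ` V"
  define d where "d = Inf D"
  have ne: "D \<noteq> {}" using assms(2) subspace_0 by (auto simp: D_def)
  have bdd: "bdd_below D" by (auto simp: D_def intro!: bdd_belowI[of _ 0])
  have d_le: "d \<le> (norm (x - v))\<^sup>2" if "v \<in> V" for v
    using that bdd by (auto simp: d_def D_def intro!: cInf_lower)
  have "\<exists>v\<in>V. (norm (x - v))\<^sup>2 < d + inverse (real (Suc n))" for n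
  proof -
    have "Inf D < d + inverse (real (Suc n))" by (simp add: d_def)
    then show ?thesis using cInf_lessD[OF ne] by (fastforce simp: D_def)
  qed
  then obtain v where v: "\<And>n. v n \<in> V"
    and vd: "\<And>n. (norm (x - v n))\<^sup>2 < d + inverse (real (Suc n))" by metis
  \<comment> \<open>The midpoint of two near-minimisers stays in V, so its distance to x cannot drop
    below the infimum; the parallelogram identity then forces the two to be close.\<close>
  have close: "(norm (v m - v n))\<^sup>2 \<le> 2 * inverse (real (Suc m)) + 2 * inverse (real (Suc n))" for m n
  proof -
    have "(1/2) *\<^sub>R (v m + v n) \<in> V"
      using v assms(2) by (simp add: subspace_add subspace_scale del: scaleR_half_double)
    then have "d \<le> (norm (x - (1/2) *\<^sub>R (v m + v n)))\<^sup>2" by (rule d_le)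
    then show ?thesis using vd[of m] vd[of n] parallelogram_midpoint[of "v m" "v n" x] by argo
  qed
  have "Cauchy v"
  proof (rule metric_CauchyI)
    fix e :: real assume "e > 0"
    then have "e\<^sup>2 / 4 > 0" by simp
    then obtain N where N: "inverse (real (Suc N)) < e\<^sup>2 / 4" using reals_Archimedean by blast
    show "\<exists>M. \<forall>m\<ge>M. \<forall>n\<ge>M. dist (v m) (v n) < e"
    proof (intro exI allI impI)
      fix m n assume mn: "m \<ge> N" "n \<ge> N"
      have "inverse (real (Suc m)) \<le> inverse (real (Suc N))"
        "inverse (real (Suc n)) \<le> inverse (real (Suc N))" using mn by (auto intro!: le_imp_inverse_le)
      then have "(norm (v m - v n))\<^sup>2 < e\<^sup>2" using close[of m n] N by linarith
      then show "dist (v m) (v n) < e"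
        using \<open>e > 0\<close> by (simp add: dist_norm power_less_imp_less_base)
    qed
  qed
  then obtain p where p: "v \<longlonglongrightarrow> p" using Cauchy_convergent_iff convergent_def by blast
  have pV: "p \<in> V" using assms(1) p v closed_sequentially by blast
  have "(\<lambda>n. (norm (x - v n))\<^sup>2) \<longlonglongrightarrow> (norm (x - p))\<^sup>2" by (intro tendsto_intros p)
  moreover have "(\<lambda>n. d + inverse (real (Suc n))) \<longlonglongrightarrow> d + 0"
    by (intro tendsto_intros LIMSEQ_inverse_real_of_nat)
  ultimately have xp: "(norm (x - p))\<^sup>2 \<le> d"
    using vd LIMSEQ_le[of "\<lambda>n. (norm (x - v n))\<^sup>2" _ "\<lambda>n. d + inverse (real (Suc n))"]
    by (force intro: less_imp_le)
  have "(x - p) \<bullet> w = 0" if w: "w \<in> V" for w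
  proof (cases "w = 0")
    case False
    \<comment> \<open>The value of t that minimises the distance from x to p + t w. As p is already
      a nearest point, this move cannot gain anything, which forces the inner product to
      vanish.\<close>
    define t where "t = ((x - p) \<bullet> w) / (w \<bullet> w)"
    have ww: "w \<bullet> w > 0" using False by simp
    have "p + t *\<^sub>R w \<in> V" using pV w assms(2) by (simp add: subspace_add subspace_scale)
    then have "(norm (x - p))\<^sup>2 \<le> (norm (x - (p + t *\<^sub>R w)))\<^sup>2" by (rule order_trans[OF xp d_le])
    also have "x - (p + t *\<^sub>R w) = (x - p) - t *\<^sub>R w" by simp
    also have "(norm ((x - p) - t *\<^sub>R w))\<^sup>2 = (norm (x - p))\<^sup>2 - 2 * t * ((x - p) \<bullet> w) + t * t * (w \<bullet> w)"
      by (simp add: power2_norm_eq_inner inner_diff_left inner_diff_right inner_commute algebra_simps)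
    also have "t * (w \<bullet> w) = (x - p) \<bullet> w" using ww by (simp add: t_def)
    then have "t * t * (w \<bullet> w) = t * ((x - p) \<bullet> w)" by simp
    finally have "t * ((x - p) \<bullet> w) \<le> 0" by simp
    then have "((x - p) \<bullet> w)\<^sup>2 / (w \<bullet> w) \<le> 0" by (simp add: t_def power2_eq_square)
    then have "((x - p) \<bullet> w)\<^sup>2 \<le> 0" using ww by (simp add: divide_le_0_iff)
    then show ?thesis by simp
  qed simp
  with pV show ?thesis by blast
qed

definition hproj :: "'h::{real_inner,complete_space} set \<Rightarrow> 'h \<Rightarrow> 'h" where
  "hproj V x = (SOME p. p \<in> V \<and> (\<forall>v\<in>V. (x - p) \<bullet> v = 0))"

context
  fixes V :: "'h::{real_inner,complete_space} set"
  assumes V: "closed V" "subspace V"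
begin

lemma hproj_mem: "hproj V x \<in> V"
  and hproj_orth: "v \<in> V \<Longrightarrow> (x - hproj V x) \<bullet> v = 0"
  using someI_ex[of "\<lambda>p. p \<in> V \<and> (\<forall>v\<in>V. (x - p) \<bullet> v = 0)"] orthogonal_projection_exists[OF V, of x]
  unfolding hproj_def by (blast, blast)

text \<open>The difference of two candidates lies in V and is orthogonal to V, hence to
  itself.\<close>

lemma hproj_unique:
  assumes "p \<in> V" "\<And>v. v \<in> V \<Longrightarrow> (x - p) \<bullet> v = 0"
  shows "hproj V x = p"
proof -
  have d: "hproj V x - p \<in> V" using V(2) assms(1) hproj_mem by (simp add: subspace_diff)
  have "(x - p) \<bullet> (hproj V x - p) = 0" "(x - hproj V x) \<bullet> (hproj V x - p) = 0"
    using assms(2)[OF d] hproj_orth[OF d] by auto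
  then have "((x - p) - (x - hproj V x)) \<bullet> (hproj V x - p) = 0" by (simp only: inner_diff_left)
  then show ?thesis by simp
qed

lemma hproj_id: "x \<in> V \<Longrightarrow> hproj V x = x" by (rule hproj_unique) auto

lemma hproj_bounded_linear: "bounded_linear (hproj V)"
proof (rule bounded_linear_intro[where K = 1])
  show "hproj V (x + y) = hproj V x + hproj V y" for x y
    using V(2) hproj_orth[of _ x] hproj_orth[of _ y]
    by (intro hproj_unique) (auto simp: subspace_add hproj_mem inner_diff_left inner_add_left)
  show "hproj V (r *\<^sub>R x) = r *\<^sub>R hproj V x" for r x using V(2) hproj_orth[of _ x]
    by (intro hproj_unique) (auto simp: subspace_scale hproj_mem inner_diff_left)
  show "norm (hproj V x) \<le> norm x * 1" for x
  proof -
    have "hproj V x \<bullet> hproj V x = x \<bullet> hproj V x"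
      using hproj_orth[OF hproj_mem[of x], of x] by (simp add: inner_diff_left)
    then have "norm (hproj V x) * norm (hproj V x) \<le> norm x * norm (hproj V x)"
      using norm_cauchy_schwarz[of x "hproj V x"] by (simp add: dot_square_norm power2_eq_square)
    then show ?thesis by (cases "hproj V x = 0") auto
  qed
qed

end

text \<open>The kernel is a closed hyperplane. A vector n orthogonal to it represents the functional
  after scaling, because x differs from a multiple of n by an element of the kernel.\<close>

lemma riesz_representation:
  fixes \<phi> :: "'h::{real_inner,complete_space} \<Rightarrow> real"
  assumes "bounded_linear \<phi>"
  shows "\<exists>z. \<forall>x. \<phi> x = x \<bullet> z"
proof (cases "\<forall>x. \<phi> x = 0")
  case True
  then show ?thesis by (intro exI[of _ 0]) simp
next
  case False
  then obtain x0 where x0: "\<phi> x0 \<noteq> 0" by blast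
  interpret bounded_linear \<phi> by fact
  define V where "V = {x. \<phi> x = 0}"
  have cl: "closed V"
    unfolding V_def by (intro closed_Collect_eq continuous_on_const linear_continuous_on assms)
  have sub: "subspace V" by (auto simp: V_def subspace_def add scaleR zero)
  define n where "n = x0 - hproj V x0"
  have \<phi>n: "\<phi> n = \<phi> x0" using hproj_mem[OF cl sub, of x0] by (simp add: n_def V_def diff)
  have n0: "n \<bullet> n \<noteq> 0" using \<phi>n x0 zero by auto
  have "\<phi> x = x \<bullet> ((\<phi> n / (n \<bullet> n)) *\<^sub>R n)" for x
  proof -
    have "x - (\<phi> x / \<phi> n) *\<^sub>R n \<in> V" using \<phi>n x0 by (simp add: V_def diff scaleR)
    then have "n \<bullet> (x - (\<phi> x / \<phi> n) *\<^sub>R n) = 0" using hproj_orth[OF cl sub] by (simp add: n_def)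
    then have "x \<bullet> n = \<phi> x / \<phi> n * (n \<bullet> n)" by (simp add: inner_diff_right inner_commute)
    then show ?thesis using n0 \<phi>n x0 by simp
  qed
  then show ?thesis by blast
qed

text \<open>\<open>adjoint\<close> is a Hilbert choice, so its properties hold once some operator
  with the defining identity is exhibited. The Riesz vectors of the functionals that send x to the
  inner product of T x and y supply one.\<close>

lemma
  fixes T :: "'h::{real_inner,complete_space} \<Rightarrow> 'h"
  assumes "bounded_linear T"
  shows adjoint_inner: "T x \<bullet> y = x \<bullet> adjoint T y"
    and adjoint_bounded_linear: "bounded_linear (adjoint T)"
proof -
  interpret bounded_linear T by fact
  have "\<exists>z. \<forall>x. T x \<bullet> y = x \<bullet> z" for y
    by (rule riesz_representation) (rule bounded_linear_compose[OF bounded_linear_inner_left assms])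
  then obtain g where g: "\<And>x y. T x \<bullet> y = x \<bullet> g y" by metis
  have adj: "adjoint T = g" using g by (intro adjoint_unique) auto
  then show inner: "T x \<bullet> y = x \<bullet> adjoint T y" for x y using g by simp
  obtain K where K: "\<And>x. norm (T x) \<le> norm x * K" "K > 0" using pos_bounded by blast
  show "bounded_linear (adjoint T)" unfolding adj
  proof (rule bounded_linear_intro[where K = K])
    show "g (x + y) = g x + g y" for x y
      by (rule vector_eq_ldot[THEN iffD1]) (simp add: g[symmetric] inner_add_right)
    show "g (r *\<^sub>R x) = r *\<^sub>R g x" for r x
      by (rule vector_eq_ldot[THEN iffD1]) (simp add: g[symmetric])
    show "norm (g x) \<le> norm x * K" for x
    proof -
      have "g x \<bullet> g x = T (g x) \<bullet> x" by (simp add: g)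
      also have "\<dots> \<le> norm (T (g x)) * norm x" by (rule norm_cauchy_schwarz)
      also have "\<dots> \<le> norm (g x) * K * norm x" by (intro mult_right_mono K) auto
      finally have "norm (g x) * norm (g x) \<le> norm (g x) * (norm x * K)"
        by (simp add: dot_square_norm power2_eq_square mult_ac)
      then show ?thesis using K(2) by (cases "g x = 0") (auto simp: mult_le_cancel_left)
    qed
  qed
qed

lemma funpow_symmetric:
  fixes R :: "'h::real_inner \<Rightarrow> 'h"
  assumes "\<And>x y. R x \<bullet> y = x \<bullet> R y"
  shows "(R ^^ m) x \<bullet> y = x \<bullet> (R ^^ m) y"
  by (induction m arbitrary: x y) (simp_all add: assms funpow_swap1)

text \<open>
  The quadratic form \<open>a m = \<langle>(1 - S)\<^sup>m x, x\<rangle>\<close> of a positive contraction is decreasing and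
  nonnegative, and it controls the distances between the iterates.
\<close>

lemma positive_contraction_iterates_converge:
  fixes S :: "'h::{real_inner,complete_space} \<Rightarrow> 'h"
  assumes bl: "bounded_linear S" and sym: "\<And>x y. S x \<bullet> y = x \<bullet> S y"
    and pos: "\<And>x. S x \<bullet> S x \<le> S x \<bullet> x"
  obtains z where "(\<lambda>m. ((\<lambda>y. y - S y) ^^ m) x) \<longlonglongrightarrow> z" "S z = 0"
proof -
  interpret bounded_linear S by fact
  define R where "R = (\<lambda>y. y - S y)"
  define y where "y m = (R ^^ m) x" for m
  define a where "a m = y m \<bullet> x" for m
  have Rsym: "R u \<bullet> v = u \<bullet> R v" for u v by (simp add: R_def inner_diff_left inner_diff_right sym)
  have y_Suc: "y (Suc m) = y m - S (y m)" for m by (simp add: y_def R_def)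
  note Rm_sym = funpow_symmetric[of R, OF Rsym]
  \<comment> \<open>By symmetry of R the Gram matrix of the iterates depends only on the sum of the
    indices, so every estimate below reduces to the one sequence \<open>a\<close>.\<close>
  have yy: "y m \<bullet> y n = a (m + n)" for m n
  proof -
    have "y (n + m) = (R ^^ n) (y m)" by (simp add: y_def funpow_add)
    then show ?thesis by (simp add: a_def Rm_sym y_def[of n] add.commute)
  qed
  \<comment> \<open>Splits the power between the two sides. For even index the decrement of
    \<open>a\<close> becomes a value of the form of S, for odd index a value of the form of S - S S;
    \<open>pos\<close> makes both nonnegative.\<close>
  have Sy: "S (y (k + j)) \<bullet> x = S (y j) \<bullet> y k" for k j
  proof -
    have "S (y (k + j)) = y (k + j) - y (Suc (k + j))" by (simp add: y_Suc)
    then have "S (y (k + j)) \<bullet> x = a (j + k) - a (Suc j + k)"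
      by (simp add: inner_diff_left a_def add.commute)
    also have "\<dots> = (y j - y (Suc j)) \<bullet> y k" by (simp only: inner_diff_left yy)
    finally show ?thesis by (simp add: y_Suc)
  qed
  have dec: "a (Suc m) \<le> a m" for m
  proof -
    have "a m - a (Suc m) = S (y m) \<bullet> x" by (simp add: a_def y_Suc inner_diff_left)
    moreover have "0 \<le> S (y m) \<bullet> x"
    proof (cases "even m")
      case True
      then obtain k where "m = k + k" by (metis evenE mult_2)
      then have "S (y m) \<bullet> x = S (y k) \<bullet> y k" using Sy[of k k] by simp
      moreover have "0 \<le> S (y k) \<bullet> S (y k)" by simp
      ultimately show ?thesis using pos[of "y k"] by linarith
    next
      case False
      then obtain k where "m = k + Suc k" by (metis oddE mult_2 add_Suc_right Suc_eq_plus1)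
      then have "S (y m) \<bullet> x = S (y k) \<bullet> y k - S (y k) \<bullet> S (y k)"
        using Sy[of k "Suc k"] sym[of "S (y k)" "y k"] by (simp add: y_Suc diff inner_diff_left)
      then show ?thesis using pos[of "y k"] by simp
    qed
    ultimately show ?thesis by simp
  qed
  have "decseq a" using dec by (simp add: decseq_Suc_iff)
  have nonneg: "0 \<le> a m" for m
  proof -
    have "a (m + m) \<le> a m" by (rule decseqD[OF \<open>decseq a\<close>]) simp
    then show ?thesis using yy[of m m] inner_ge_zero[of "y m"] by linarith
  qed
  then obtain l where l: "a \<longlonglongrightarrow> l" "\<And>i. l \<le> a i"     using decseq_convergent[OF \<open>decseq a\<close>, of 0] nonneg by metis
  \<comment> \<open>The squared distance is a(2m) + a(2n) - 2 a(m + n), and a(m + n) is at least the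
    limit l.\<close>
  have dist: "(norm (y m - y n))\<^sup>2 \<le> a (m + m) - l + (a (n + n) - l)" for m n
    using l(2)[of "m + n"]
    by (simp add: power2_norm_eq_inner inner_diff_left inner_diff_right yy add.commute)
  have "Cauchy y"
  proof (rule metric_CauchyI)
    fix e :: real assume "e > 0"
    then have "e\<^sup>2 / 2 > 0" by simp
    then obtain N where N: "\<And>n. n \<ge> N \<Longrightarrow> \<bar>a n - l\<bar> < e\<^sup>2 / 2"
      using l(1) unfolding LIMSEQ_iff by (metis real_norm_def)
    show "\<exists>M. \<forall>m\<ge>M. \<forall>n\<ge>M. dist (y m) (y n) < e"
    proof (intro exI allI impI)
      fix m n assume mn: "m \<ge> N" "n \<ge> N"
      have "a (m + m) - l < e\<^sup>2 / 2" "a (n + n) - l < e\<^sup>2 / 2"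
        using N[of "m + m"] N[of "n + n"] mn abs_ge_self[of "a (m + m) - l"]
          abs_ge_self[of "a (n + n) - l"] by linarith+
      then have "(norm (y m - y n))\<^sup>2 < e\<^sup>2" using dist[of m n] by linarith
      then show "dist (y m) (y n) < e"
        using \<open>e > 0\<close> by (simp add: dist_norm power_less_imp_less_base)
    qed
  qed
  then obtain z where z: "y \<longlonglongrightarrow> z" using Cauchy_convergent_iff convergent_def by blast
  have "(\<lambda>m. y m - y (Suc m)) \<longlonglongrightarrow> z - z" by (intro tendsto_intros z LIMSEQ_Suc)
  then have "(\<lambda>m. S (y m)) \<longlonglongrightarrow> 0" by (simp add: y_Suc)
  moreover have "(\<lambda>m. S (y m)) \<longlonglongrightarrow> S z" by (rule tendsto[OF z])
  ultimately have "S z = 0" using LIMSEQ_unique by blast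
  moreover have "y = (\<lambda>m. ((\<lambda>y. y - S y) ^^ m) x)" by (simp add: fun_eq_iff y_def R_def)
  ultimately show thesis using z that[of z] by (simp only:)
qed

section \<open>Commutants with a trace\<close>

text \<open>Bounded linearity is over the reals. Complex linearity is obtained in the application by
  putting complex multiples into U.\<close>

definition commutant :: "('h::real_normed_vector \<Rightarrow> 'h) set \<Rightarrow> ('h \<Rightarrow> 'h) set" where
  "commutant U = {T. bounded_linear T \<and> (\<forall>u\<in>U. \<forall>x. T (u x) = u (T x))}"

locale adjoint_closed =
  fixes U :: "('h::{real_inner,complete_space} \<Rightarrow> 'h) set"
  assumes U_bounded_linear: "u \<in> U \<Longrightarrow> bounded_linear u"
    and U_adjoint: "u \<in> U \<Longrightarrow> \<exists>v\<in>U. \<forall>x y. u x \<bullet> y = x \<bullet> v y"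
begin

definition star :: "('h \<Rightarrow> 'h) \<Rightarrow> 'h \<Rightarrow> 'h" where
  "star u = (SOME v. v \<in> U \<and> (\<forall>x y. u x \<bullet> y = x \<bullet> v y))"

lemma
  assumes "u \<in> U"
  shows star_mem: "star u \<in> U" and star_inner: "u x \<bullet> y = x \<bullet> star u y"
proof -
  have "\<exists>v. v \<in> U \<and> (\<forall>x y. u x \<bullet> y = x \<bullet> v y)" using U_adjoint[OF assms] by (simp only: Bex_def)
  then have "star u \<in> U \<and> (\<forall>x y. u x \<bullet> y = x \<bullet> star u y)" unfolding star_def by (rule someI_ex)
  then show "star u \<in> U" "u x \<bullet> y = x \<bullet> star u y" by simp_all
qed

lemma commutantD:
  assumes "T \<in> commutant U"
  shows "bounded_linear T" "u \<in> U \<Longrightarrow> T (u x) = u (T x)" using assms by (auto simp: commutant_def)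

lemma commutant_id: "(\<lambda>x. x) \<in> commutant U" by (simp add: commutant_def bounded_linear_ident)

lemma commutant_comp: "S \<in> commutant U \<Longrightarrow> T \<in> commutant U \<Longrightarrow> (\<lambda>x. S (T x)) \<in> commutant U"
  by (auto simp: commutant_def intro: bounded_linear_compose)

lemma commutant_add: "S \<in> commutant U \<Longrightarrow> T \<in> commutant U \<Longrightarrow> (\<lambda>x. S x + T x) \<in> commutant U"
  using U_bounded_linear by (auto simp: commutant_def intro: bounded_linear_add bounded_linear.linear
      simp: linear_simps)

lemma commutant_diff: "S \<in> commutant U \<Longrightarrow> T \<in> commutant U \<Longrightarrow> (\<lambda>x. S x - T x) \<in> commutant U"
  using U_bounded_linear by (auto simp: commutant_def intro: bounded_linear_sub bounded_linear.linear
      simp: linear_simps)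

lemma commutant_scaleR: "T \<in> commutant U \<Longrightarrow> (\<lambda>x. c *\<^sub>R T x) \<in> commutant U"
  using U_bounded_linear by (auto simp: commutant_def linear_simps
      intro: bounded_linear_compose[OF bounded_linear_scaleR_right])

text \<open>Commutation with u is moved across the inner product, where it becomes commutation of T
  with \<open>star u\<close>, again an element of U.\<close>

lemma commutant_adjoint:
  assumes T: "T \<in> commutant U"
  shows "adjoint T \<in> commutant U"
proof -
  have "adjoint T (u x) = u (adjoint T x)" if u: "u \<in> U" for u x
  proof (rule vector_eq_ldot[THEN iffD1], rule allI)
    fix y
    have v': "y \<bullet> u x = star u y \<bullet> x" for x y
      using star_inner[OF u, of x y] by (simp only: inner_commute)
    show "y \<bullet> adjoint T (u x) = y \<bullet> u (adjoint T x)"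
      by (simp only: adjoint_inner[OF commutantD(1)[OF T], symmetric]
          commutantD(2)[OF T star_mem[OF u]] v')
  qed
  then show ?thesis using adjoint_bounded_linear T by (auto simp: commutant_def)
qed

text \<open>Invariance of V under \<open>star u\<close> means that u preserves the orthogonal
  complement of V. So u respects both summands and commutes with the projection.\<close>

lemma commutant_hproj:
  assumes V: "closed V" "subspace V" and inv: "\<And>u x. u \<in> U \<Longrightarrow> x \<in> V \<Longrightarrow> u x \<in> V"
  shows "hproj V \<in> commutant U"
proof -
  have "hproj V (u x) = u (hproj V x)" if u: "u \<in> U" for u x
  proof (rule hproj_unique[OF V])
    show "u (hproj V x) \<in> V" by (rule inv[OF u hproj_mem[OF V]])
    show "(u x - u (hproj V x)) \<bullet> v = 0" if "v \<in> V" for v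
    proof -
      have "(x - hproj V x) \<bullet> star u v = 0" by (rule hproj_orth[OF V inv[OF star_mem[OF u] that]])
      then have "u (x - hproj V x) \<bullet> v = 0" by (simp only: star_inner[OF u])
      then show ?thesis
        by (simp only: linear_diff[OF bounded_linear.linear[OF U_bounded_linear[OF u]]])
    qed
  qed
  then show ?thesis using hproj_bounded_linear[OF V] by (auto simp: commutant_def)
qed

end

text \<open>The space of interest is the fixed space of P inside an ambient space; P lies in U, so
  the commutant preserves it. The sum over E plays the role of the real part of a trace, and
  \<open>cyclic\<close> says that what happens on E determines an operator of the commutant on that
  space.\<close>

locale traced_commutant = adjoint_closed U
  for U :: "('h::{real_inner,complete_space} \<Rightarrow> 'h) set" +
  fixes P :: "'h \<Rightarrow> 'h" and E :: "'h set"
  assumes P_mem: "P \<in> U"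
    and finite_E: "finite E" and P_E: "e \<in> E \<Longrightarrow> P e = e"
    and cyclic: "{x. P x = x} \<subseteq> closure (span {u e |u e. u \<in> U \<and> e \<in> E})"
    and trace_commute: "A \<in> commutant U \<Longrightarrow> B \<in> commutant U \<Longrightarrow>
      (\<Sum>e\<in>E. A (B e) \<bullet> e) = (\<Sum>e\<in>E. B (A e) \<bullet> e)"
begin

text \<open>
  Finiteness. For \<open>S = T\<^sup>*T\<close> and \<open>S' = TT\<^sup>*\<close> the traces of \<open>(1 - S)\<^sup>m\<close> and \<open>(1 - S')\<^sup>m\<close> agree;
  the former tends to 0 as \<open>T\<close> is injective, and \<open>(1 - S')\<^sup>m\<close> fixes the complement of the range.
\<close>

lemma injective_dense_range_contraction:
  assumes T: "T \<in> commutant U" and contr: "\<And>x. norm (T x) \<le> norm x"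
    and inj: "\<And>x. P x = x \<Longrightarrow> T x = 0 \<Longrightarrow> x = 0"
    and w: "P w = w" "\<And>x. T x \<bullet> w = 0"
  shows "w = 0"
proof -
  note blT = commutantD(1)[OF T]
  interpret T: bounded_linear T by (fact blT)
  define A where "A = adjoint T"
  have A: "A \<in> commutant U" unfolding A_def by (rule commutant_adjoint[OF T])
  interpret A: bounded_linear A using commutantD(1)[OF A] .
  have TA: "T x \<bullet> y = x \<bullet> A y" for x y unfolding A_def by (rule adjoint_inner[OF blT])
  have AT: "A x \<bullet> y = x \<bullet> T y" for x y using TA[of y x] by (simp add: inner_commute)
  have contrA: "norm (A y) \<le> norm y" for y
  proof -
    have "A y \<bullet> A y = T (A y) \<bullet> y" by (simp add: TA)
    also have "\<dots> \<le> norm (T (A y)) * norm y" by (rule norm_cauchy_schwarz)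
    also have "\<dots> \<le> norm (A y) * norm y" by (intro mult_right_mono contr) auto
    finally have "norm (A y) * norm (A y) \<le> norm (A y) * norm y"
      by (simp add: dot_square_norm power2_eq_square)
    then show ?thesis by (cases "A y = 0") auto
  qed
  define S where "S x = A (T x)" for x
  define S' where "S' x = T (A x)" for x
  define R where "R m = (\<lambda>y. y - S y) ^^ m" for m
  define R' where "R' m = (\<lambda>y. y - S' y) ^^ m" for m
  have blS: "bounded_linear S" "bounded_linear S'" unfolding S_def S'_def
    by (intro bounded_linear_compose[OF A.bounded_linear_axioms T.bounded_linear_axioms]
        bounded_linear_compose[OF T.bounded_linear_axioms A.bounded_linear_axioms])+
  have sym: "S x \<bullet> y = x \<bullet> S y" "S' x \<bullet> y = x \<bullet> S' y" for x y
    by (simp_all add: S_def S'_def TA AT)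
  have pos: "S x \<bullet> S x \<le> S x \<bullet> x" "S' x \<bullet> S' x \<le> S' x \<bullet> x" for x
  proof -
    have "S x \<bullet> S x \<le> T x \<bullet> T x" "S' x \<bullet> S' x \<le> A x \<bullet> A x" using contrA[of "T x"] contr[of "A x"]
      by (simp_all add: S_def S'_def dot_square_norm power_mono)
    then show "S x \<bullet> S x \<le> S x \<bullet> x" "S' x \<bullet> S' x \<le> S' x \<bullet> x"
      using AT[of "T x" x] TA[of "A x" x] by (simp_all add: S_def S'_def)
  qed
  have comm: "(\<lambda>x. S x) \<in> commutant U" "(\<lambda>x. S' x) \<in> commutant U"
    unfolding S_def S'_def by (rule commutant_comp[OF A T] commutant_comp[OF T A])+
  have R_Suc: "R (Suc m) x = R m x - S (R m x)" "R' (Suc m) x = R' m x - S' (R' m x)" for m x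
    by (simp_all add: R_def R'_def)
  have R_comm: "R m \<in> commutant U" "R' m \<in> commutant U" for m
  proof -
    have "R m \<in> commutant U \<and> R' m \<in> commutant U"
    proof (induction m)
      case 0
      show ?case by (simp add: R_def R'_def id_def commutant_id)
    next
      case (Suc m)
      then have "(\<lambda>x. R m x - S (R m x)) \<in> commutant U" "(\<lambda>x. R' m x - S' (R' m x)) \<in> commutant U"
        using comm by (metis commutant_diff commutant_comp)+
      then show ?case by (simp only: R_Suc[symmetric])
    qed
    then show "R m \<in> commutant U" "R' m \<in> commutant U" by auto
  qed
  have R_linear: "R m (u - v) = R m u - R m v" "R' m (u - v) = R' m u - R' m v" for m u v
    using R_comm[THEN commutantD(1)] by (simp_all add: linear_simps)
  have intertwine: "T (R m x) = R' m (T x)" for m x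
    by (induction m) (simp_all add: R_Suc T.diff S_def S'_def, simp_all add: R_def R'_def)
  have S'R': "S' (R' m x) = R' m (S' x)" for m x
    by (induction m) (simp_all add: R_Suc blS linear_simps, simp_all add: R'_def)
  define \<tau> where "\<tau> B = (\<Sum>e\<in>E. B e \<bullet> e)" for B :: "'h \<Rightarrow> 'h"
  \<comment> \<open>The decrements are the traces of A T R_m and of S' R'_m. Exchanging A with T R_m
    under the trace gives T R_m A, which equals R'_m S' by \<open>intertwine\<close>.\<close>
  have tr: "\<tau> (R m) = \<tau> (R' m)" for m
  proof (induction m)
    case 0
    then show ?case by (simp add: R_def R'_def)
  next
    case (Suc m)
    have "(\<lambda>x. T (R m x)) \<in> commutant U" by (rule commutant_comp[OF T R_comm(1)])
    from trace_commute[OF A this]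
    have "\<tau> (\<lambda>x. S (R m x)) = \<tau> (\<lambda>x. S' (R' m x))"
      by (simp add: \<tau>_def S_def intertwine S'R') (simp add: S'_def)
    with Suc show ?case by (simp add: \<tau>_def R_Suc inner_diff_left sum_subtractf)
  qed
  have symR: "R m x \<bullet> y = x \<bullet> R m y" "R' m x \<bullet> y = x \<bullet> R' m y" for m x y unfolding R_def R'_def
    by (rule funpow_symmetric, simp add: inner_diff_left inner_diff_right sym)+
  have normR: "(norm (R m x))\<^sup>2 = R (m + m) x \<bullet> x" "(norm (R' m x))\<^sup>2 = R' (m + m) x \<bullet> x" for m x
  proof -
    have "R m x \<bullet> R m x = x \<bullet> R m (R m x)" "R' m x \<bullet> R' m x = x \<bullet> R' m (R' m x)"
      by (simp_all add: symR)
    then show "(norm (R m x))\<^sup>2 = R (m + m) x \<bullet> x" "(norm (R' m x))\<^sup>2 = R' (m + m) x \<bullet> x"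
      by (simp_all add: power2_norm_eq_inner R_def R'_def funpow_add inner_commute)
  qed
  have R_lim: "(\<lambda>m. R m e) \<longlonglongrightarrow> 0" if e: "e \<in> E" for e
  proof -
    obtain z where z: "(\<lambda>m. R m e) \<longlonglongrightarrow> z" "S z = 0"
      using positive_contraction_iterates_converge[OF blS(1) sym(1) pos(1)] unfolding R_def by metis
    \<comment> \<open>The limit has to be fixed by P, since T is injective only there.\<close>
    have "P (R m e) = R m e" for m using commutantD(2)[OF R_comm(1) P_mem] P_E[OF e] by metis
    moreover have "(\<lambda>m. P (R m e)) \<longlonglongrightarrow> P z"
      by (rule bounded_linear.tendsto[OF U_bounded_linear[OF P_mem] z(1)])
    ultimately have "P z = z" using z(1) LIMSEQ_unique by auto
    moreover have "T z = 0" using z(2) AT[of "T z" z] by (simp add: S_def)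
    ultimately show ?thesis using z(1) inj by blast
  qed
  have "(\<lambda>m. (norm (R m e))\<^sup>2) \<longlonglongrightarrow> 0" if "e \<in> E" for e
    using tendsto_power[OF tendsto_norm[OF R_lim[OF that]], of 2] by simp
  then have "(\<lambda>m. \<Sum>e\<in>E. (norm (R m e))\<^sup>2) \<longlonglongrightarrow> 0" by (rule tendsto_null_sum)
  moreover have "(\<Sum>e\<in>E. (norm (R m e))\<^sup>2) = (\<Sum>e\<in>E. (norm (R' m e))\<^sup>2)" for m
    using tr[of "m + m"] by (simp only: \<tau>_def normR)
  ultimately have sum0: "(\<lambda>m. \<Sum>e\<in>E. (norm (R' m e))\<^sup>2) \<longlonglongrightarrow> 0" by (simp only:)
  have R'_lim: "(\<lambda>m. R' m e) \<longlonglongrightarrow> 0" if e: "e \<in> E" for e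
  proof -
    have "(\<lambda>m. (norm (R' m e))\<^sup>2) \<longlonglongrightarrow> 0"
    proof (rule Lim_null_comparison[OF _ sum0], rule always_eventually, rule allI)
      show "norm ((norm (R' m e))\<^sup>2) \<le> (\<Sum>e\<in>E. (norm (R' m e))\<^sup>2)" for m
        using member_le_sum[of e E "\<lambda>e. (norm (R' m e))\<^sup>2"] e finite_E by simp
    qed
    then have "(\<lambda>m. sqrt ((norm (R' m e))\<^sup>2)) \<longlonglongrightarrow> sqrt 0" by (rule tendsto_real_sqrt)
    then show ?thesis by (simp add: tendsto_norm_zero_iff)
  qed
  have contrR': "norm (R' m x) \<le> norm x" for m x
  proof (induction m)
    case (Suc m)
    let ?y = "R' m x"
    have "(norm (?y - S' ?y))\<^sup>2 = ?y \<bullet> ?y - 2 * (S' ?y \<bullet> ?y) + S' ?y \<bullet> S' ?y"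
      by (simp add: power2_norm_eq_inner inner_diff_left inner_diff_right inner_commute)
    also have "\<dots> \<le> (norm ?y)\<^sup>2" using pos(2)[of ?y] inner_ge_zero[of "S' ?y"]
      unfolding power2_norm_eq_inner by linarith
    finally have "(norm (?y - S' ?y))\<^sup>2 \<le> (norm ?y)\<^sup>2" .
    then have "norm (?y - S' ?y) \<le> norm ?y" by (rule power2_le_imp_le) simp
    with Suc show ?case by (simp only: R_Suc)
  qed (simp add: R'_def)
  \<comment> \<open>R' commutes with U, so convergence to 0 passes from E to the span of the vectors
    u e. The R'_m are contractions, so it extends to the closure, which contains w.\<close>
  define Z where "Z = {x. (\<lambda>m. R' m x) \<longlonglongrightarrow> 0}"
  have "subspace Z"
  proof (rule subspaceI)
    note [simp] = bounded_linear.linear[OF commutantD(1)[OF R_comm(2)], THEN linear_0]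
      bounded_linear.linear[OF commutantD(1)[OF R_comm(2)], THEN linear_add]
      bounded_linear.linear[OF commutantD(1)[OF R_comm(2)], THEN linear_scale]
    show "0 \<in> Z" by (simp add: Z_def)
    show "x + y \<in> Z" if "x \<in> Z" "y \<in> Z" for x y
      using that tendsto_add[of "\<lambda>m. R' m x" 0 _ "\<lambda>m. R' m y" 0] by (simp add: Z_def)
    show "c *\<^sub>R x \<in> Z" if "x \<in> Z" for c x
      using that tendsto_scaleR[of "\<lambda>_. c" c _ "\<lambda>m. R' m x" 0] by (simp add: Z_def)
  qed
  moreover have "u e \<in> Z" if "u \<in> U" "e \<in> E" for u e
    using bounded_linear.tendsto[OF U_bounded_linear[OF that(1)] R'_lim[OF that(2)]]
    by (simp only: Z_def mem_Collect_eq commutantD(2)[OF R_comm(2) that(1)]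
        linear_0[OF bounded_linear.linear[OF U_bounded_linear[OF that(1)]]])
  ultimately have "span {u e |u e. u \<in> U \<and> e \<in> E} \<subseteq> Z" by (intro span_minimal) auto
  then have sub: "closure (span {u e |u e. u \<in> U \<and> e \<in> E}) \<subseteq> closure Z" by (rule closure_mono)
  have "w \<in> {x. P x = x}" using w(1) by simp
  then have "w \<in> closure Z" by (rule subsetD[OF sub, OF subsetD[OF cyclic]])
  have "w \<in> Z" unfolding Z_def mem_Collect_eq LIMSEQ_iff
  proof (intro allI impI)
    fix r :: real assume r: "r > 0"
    then obtain z where z: "z \<in> Z" "dist z w < r / 2"
      using \<open>w \<in> closure Z\<close> unfolding closure_approachable by (metis half_gt_zero)
    then obtain N where N: "\<And>m. m \<ge> N \<Longrightarrow> norm (R' m z) < r / 2"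
      using r unfolding Z_def mem_Collect_eq LIMSEQ_iff by (metis diff_zero half_gt_zero)
    show "\<exists>N. \<forall>m\<ge>N. norm (R' m w - 0) < r"
    proof (intro exI allI impI)
      fix m assume "m \<ge> N"
      have "norm (R' m w) \<le> norm (R' m z) + norm (R' m (w - z))"
        using norm_triangle_ineq[of "R' m z" "R' m w - R' m z"] by (simp add: R_linear)
      also have "\<dots> < r" using N[OF \<open>m \<ge> N\<close>] contrR'[of m "w - z"] z(2)
        by (simp add: dist_norm norm_minus_commute)
      finally show "norm (R' m w - 0) < r" by simp
    qed
  qed
  have R'w: "R' m w = w" for m
  proof -
    have "A w \<bullet> A w = 0" using w(2)[of "A w"] by (simp add: TA)
    then have "S' w = 0" by (simp add: S'_def T.zero)
    then show ?thesis by (induction m) (simp_all add: R_Suc, simp add: R'_def)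
  qed
  from \<open>w \<in> Z\<close> have "(\<lambda>m. w) \<longlonglongrightarrow> 0" by (simp only: Z_def mem_Collect_eq R'w)
  then show "w = 0" by (simp only: LIMSEQ_const_iff)
qed

text \<open>Dividing T by a bound makes it a contraction and changes neither its kernel nor the
  orthogonal complement of its range.\<close>

lemma injective_dense_range:
  assumes T: "T \<in> commutant U" and inj: "\<And>x. P x = x \<Longrightarrow> T x = 0 \<Longrightarrow> x = 0"
    and w: "P w = w" "\<And>x. T x \<bullet> w = 0"
  shows "w = 0"
proof -
  obtain K where K: "K > 0" "\<And>x. norm (T x) \<le> norm x * K"
    using bounded_linear.pos_bounded[OF commutantD(1)[OF T]] by metis
  show ?thesis
  proof (rule injective_dense_range_contraction)
    show "(\<lambda>x. inverse K *\<^sub>R T x) \<in> commutant U" by (rule commutant_scaleR[OF T])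
    show "norm (inverse K *\<^sub>R T x) \<le> norm x" for x
    proof -
      have "inverse K * norm (T x) \<le> inverse K * (norm x * K)"
        using K by (intro mult_left_mono) auto
      also have "\<dots> = norm x" using K(1) by simp
      finally show ?thesis using K(1) by simp
    qed
    show "x = 0" if "P x = x" "inverse K *\<^sub>R T x = 0" for x
    proof (rule inj[OF that(1)])
      show "T x = 0" using that(2) K(1) by simp
    qed
    show "P w = w" by (rule w)
    show "(inverse K *\<^sub>R T x) \<bullet> w = 0" for x by (simp add: w(2))
  qed
qed

end

lemma subspace_closure:
  fixes S :: "'a::real_normed_vector set"
  assumes "subspace S"
  shows "subspace (closure S)"
proof (rule subspaceI)
  show "0 \<in> closure S" using subspace_0[OF assms] closure_subset by (rule subsetD[rotated])
next
  fix x y assume "x \<in> closure S" "y \<in> closure S"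
  then obtain f g where f: "\<And>n. f n \<in> S" "f \<longlonglongrightarrow> x" and g: "\<And>n. g n \<in> S" "g \<longlonglongrightarrow> y"
    unfolding closure_sequential by auto
  show "x + y \<in> closure S" unfolding closure_sequential
    by (rule exI[of _ "\<lambda>n. f n + g n"]) (simp add: f g assms subspace_add tendsto_add)
next
  fix c x assume "x \<in> closure S"
  then obtain f where f: "\<And>n. f n \<in> S" "f \<longlonglongrightarrow> x" unfolding closure_sequential by auto
  show "c *\<^sub>R x \<in> closure S" unfolding closure_sequential
    by (rule exI[of _ "\<lambda>n. c *\<^sub>R f n"]) (simp add: f assms subspace_scale tendsto_scaleR)
qed

section \<open>Pairs of vectors and the Ore condition\<close>

locale trace_vector = traced_commutant U P "{e}"
  for U :: "('h::{real_inner,complete_space} \<Rightarrow> 'h) set" and P and e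
begin

text \<open>The diagonal action on pairs. Its commutant is the algebra of 2x2 matrices with entries
  in \<open>commutant U\<close>; \<open>entry_commutant\<close> extracts the entries.\<close>

definition "U2 = (\<lambda>u. map_prod u u) ` U"

lemma linear_U: "u \<in> U \<Longrightarrow> linear u" by (rule bounded_linear.linear[OF U_bounded_linear])

lemma adjoint_closed_U2: "adjoint_closed U2" unfolding adjoint_closed_def
proof (intro conjI allI impI)
  fix v assume "v \<in> U2"
  then obtain u where u: "u \<in> U" and v: "v = map_prod u u" by (auto simp: U2_def)
  have map: "map_prod w w = (\<lambda>z. (w (fst z), w (snd z)))" for w :: "'h \<Rightarrow> 'h"
    by (simp add: fun_eq_iff map_prod_def split_beta)
  show "bounded_linear v" unfolding v map
    by (intro bounded_linear_Pair bounded_linear_compose[OF U_bounded_linear[OF u]]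
        bounded_linear_fst bounded_linear_snd)
  show "\<exists>v'\<in>U2. \<forall>x y. v x \<bullet> y = x \<bullet> v' y"
  proof (rule bexI[of _ "map_prod (star u) (star u)"])
    show "\<forall>x y. v x \<bullet> y = x \<bullet> map_prod (star u) (star u) y" by (simp add: v star_inner[OF u])
    show "map_prod (star u) (star u) \<in> U2" using star_mem[OF u] by (simp add: U2_def)
  qed
qed

sublocale D: adjoint_closed U2 by (rule adjoint_closed_U2)

lemma entry_commutant:
  assumes A: "A \<in> commutant U2"
  shows "(\<lambda>x. fst (A (x, 0))) \<in> commutant U" "(\<lambda>x. snd (A (x, 0))) \<in> commutant U"
    "(\<lambda>x. fst (A (0, x))) \<in> commutant U" "(\<lambda>x. snd (A (0, x))) \<in> commutant U"
proof -
  note bl = D.commutantD(1)[OF A]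
  have comm: "A (u x, u y) = (u (fst (A (x, y))), u (snd (A (x, y))))" if u: "u \<in> U" for u x y
  proof -
    have "map_prod u u \<in> U2" using u by (simp add: U2_def)
    from D.commutantD(2)[OF A this, of "(x, y)"] show ?thesis
      by (simp add: map_prod_def split_beta)
  qed
  have c0: "A (u x, 0) = (u (fst (A (x, 0))), u (snd (A (x, 0))))"
    "A (0, u x) = (u (fst (A (0, x))), u (snd (A (0, x))))" if u: "u \<in> U" for u x
    using comm[OF u, of x 0] comm[OF u, of 0 x] by (simp_all add: linear_0[OF linear_U[OF u]])
  have b: "bounded_linear (\<lambda>x. A (x, 0))" "bounded_linear (\<lambda>x. A (0, x))"
    by (intro bounded_linear_compose[OF bl] bounded_linear_Pair bounded_linear_ident
        bounded_linear_zero)+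
  show "(\<lambda>x. fst (A (x, 0))) \<in> commutant U" "(\<lambda>x. snd (A (x, 0))) \<in> commutant U"
    "(\<lambda>x. fst (A (0, x))) \<in> commutant U" "(\<lambda>x. snd (A (0, x))) \<in> commutant U"
    using b by (simp_all add: commutant_def c0 bounded_linear_fst_comp bounded_linear_snd_comp)
qed

lemma P_zero: "P 0 = 0" by (rule linear_0[OF linear_U[OF P_mem]])

sublocale D: traced_commutant U2 "map_prod P P" "{(e, 0), (0, e)}"
proof unfold_locales
  show "map_prod P P \<in> U2" using P_mem by (simp add: U2_def)
  show "finite {(e, 0), (0, e)}" by simp
  have Pe: "P e = e" by (rule P_E) simp
  show "map_prod P P z = z" if "z \<in> {(e, 0), (0, e)}" for z using that Pe P_zero by auto
next
  let ?E = "{(e, 0), (0, e)}"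
  define B where "B = {u e' |u e'. u \<in> U \<and> e' \<in> {e}}"
  define B2 where "B2 = {u e' |u e'. u \<in> U2 \<and> e' \<in> ?E}"
  have inc: "bounded_linear (\<lambda>x::'h. (x, 0::'h))" "bounded_linear (\<lambda>x::'h. (0::'h, x))"
    by (intro bounded_linear_Pair bounded_linear_ident bounded_linear_zero)+
  have inc_closure: "i x \<in> closure (span B2)"
    if i: "bounded_linear i" and iB: "i ` B \<subseteq> B2" and x: "P x = x" for i x
  proof -
    have "i ` closure (span B) \<subseteq> closure (i ` span B)"
      by (rule closure_bounded_linear_image_subset[OF i])
    also have "i ` span B = span (i ` B)"
      by (rule linear_span_image[OF bounded_linear.linear[OF i], symmetric])
    also have "closure (span (i ` B)) \<subseteq> closure (span B2)" by (intro closure_mono span_mono iB)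
    finally have sub: "i ` closure (span B) \<subseteq> closure (span B2)" .
    have "x \<in> {x. P x = x}" using x by simp
    then have "x \<in> closure (span B)" unfolding B_def by (rule subsetD[OF cyclic])
    then show ?thesis by (rule subsetD[OF sub, OF imageI])
  qed
  have incB: "(\<lambda>x. (x, 0)) ` B \<subseteq> B2" "(\<lambda>x. (0, x)) ` B \<subseteq> B2"
  proof -
    have "(u e, 0) \<in> B2 \<and> (0, u e) \<in> B2" if u: "u \<in> U" for u
    proof -
      have m: "map_prod u u \<in> U2" using u by (simp add: U2_def)
      have "(u e, 0) = map_prod u u (e, 0)" "(0, u e) = map_prod u u (0, e)"
        by (simp_all add: linear_0[OF linear_U[OF u]])
      with m show ?thesis unfolding B2_def by fastforce
    qed
    then show "(\<lambda>x. (x, 0)) ` B \<subseteq> B2" "(\<lambda>x. (0, x)) ` B \<subseteq> B2" by (auto simp: B_def)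
  qed
  have "z \<in> closure (span B2)" if z: "map_prod P P z = z" for z
  proof -
    have "P (fst z) = fst z" "P (snd z) = snd z"
      using arg_cong[OF z, of fst] arg_cong[OF z, of snd] by simp_all
    then have "(fst z, 0) + (0, snd z) \<in> closure (span B2)"
      by (intro subspace_add subspace_closure subspace_span inc_closure[OF inc(1) incB(1)]
          inc_closure[OF inc(2) incB(2)])
    then show ?thesis by simp
  qed
  then show "{z. map_prod P P z = z} \<subseteq> closure (span {u e' |u e'. u \<in> U2 \<and> e' \<in> ?E})"
    by (auto simp: B2_def)
next
  fix A B :: "'h \<times> 'h \<Rightarrow> 'h \<times> 'h" assume AB: "A \<in> commutant U2" "B \<in> commutant U2"
  have split: "A (x, y) = A (x, 0) + A (0, y)" if "A \<in> commutant U2" for A x y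
    using linear_add[OF bounded_linear.linear[OF D.commutantD(1)[OF that]], of "(x, 0)" "(0, y)"]
    by simp
  have zero: "A 0 = 0" if "A \<in> commutant U2" for A
    by (rule linear_0[OF bounded_linear.linear[OF D.commutantD(1)[OF that]]])
  have tr: "F (G e) \<bullet> e = G (F e) \<bullet> e" if "F \<in> commutant U" "G \<in> commutant U" for F G
    using trace_commute[OF that] by simp
  \<comment> \<open>The trace of a product of 2x2 matrices as a sum of four traces of products of
    entries. Exchanging the factors in each of them gives the trace of the product in the other
    order.\<close>
  have *: "A (B (e, 0)) \<bullet> (e, 0) + A (B (0, e)) \<bullet> (0, e) =
    fst (A (fst (B (e, 0)), 0)) \<bullet> e + fst (A (0, snd (B (e, 0)))) \<bullet> e +
    (snd (A (fst (B (0, e)), 0)) \<bullet> e + snd (A (0, snd (B (0, e)))) \<bullet> e)"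
    if "A \<in> commutant U2" for A B using split[OF that, of "fst (B (e, 0))" "snd (B (e, 0))"]
      split[OF that, of "fst (B (0, e))" "snd (B (0, e))"]
    by (simp add: inner_prod_def inner_add_left)
  have "A (B (e, 0)) \<bullet> (e, 0) + A (B (0, e)) \<bullet> (0, e) =
    B (A (e, 0)) \<bullet> (e, 0) + B (A (0, e)) \<bullet> (0, e)" unfolding *[OF AB(1)] *[OF AB(2)]
    using tr[OF entry_commutant(1)[OF AB(1)] entry_commutant(1)[OF AB(2)]]
      tr[OF entry_commutant(3)[OF AB(1)] entry_commutant(2)[OF AB(2)]]
      tr[OF entry_commutant(2)[OF AB(1)] entry_commutant(3)[OF AB(2)]]
      tr[OF entry_commutant(4)[OF AB(1)] entry_commutant(4)[OF AB(2)]] by simp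
  \<comment> \<open>If e = 0 the set of trace vectors collapses to one point, and the sum over it is
    no longer a sum of two terms; both sides are then 0.\<close>
  then show "(\<Sum>z\<in>{(e, 0), (0, e)}. A (B z) \<bullet> z) = (\<Sum>z\<in>{(e, 0), (0, e)}. B (A z) \<bullet> z)"
    by (cases "e = 0") (simp_all add: zero AB)
qed

text \<open>
  The Ore condition. With \<open>Q\<close> the projection onto the complement of the closure \<open>\<Gamma>\<close> of
  \<open>{(sv, xv)}\<close>, the second row of \<open>Q\<close> solves the equation. A vector in the kernel of \<open>r\<close> would give
  \<open>(0, w) \<in> \<Gamma>\<close>; but compressing \<open>(s, x)(s, x)\<^sup>*\<close> to the complement of the space \<open>W\<close> of these
  vectors leaves it injective on \<open>\<Gamma>\<close>, so \<open>W = 0\<close> by finiteness.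
\<close>

lemma ore_condition:
  assumes x: "x \<in> commutant U" and s: "s \<in> commutant U"
    and inj: "\<And>v. P v = v \<Longrightarrow> s v = 0 \<Longrightarrow> v = 0"
  obtains r y where "r \<in> commutant U" "y \<in> commutant U" "\<And>v. r (x v) = y (s v)"
    "\<And>v. P v = v \<Longrightarrow> r v = 0 \<Longrightarrow> v = 0"
proof -
  note bl = commutantD(1)[OF x] commutantD(1)[OF s]
  note lin = bl[THEN bounded_linear.linear]
  note sx = adjoint_inner[OF bl(1)] adjoint_inner[OF bl(2)]
  define \<Gamma>0 where "\<Gamma>0 = range (\<lambda>v. (s v, x v))"
  define \<Gamma> where "\<Gamma> = closure \<Gamma>0"
  define W where "W = \<Gamma> \<inter> {z. fst z = 0}"
  have \<Gamma>_mem: "(s v, x v) \<in> \<Gamma>" for v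
  proof -
    have "(s v, x v) \<in> \<Gamma>0" by (simp add: \<Gamma>0_def)
    then show ?thesis unfolding \<Gamma>_def by (rule subsetD[OF closure_subset])
  qed
  have "linear (\<lambda>v. (s v, x v))" by (intro bounded_linear.linear bounded_linear_Pair bl)
  then have "subspace \<Gamma>0" unfolding \<Gamma>0_def by (rule linear_subspace_image) simp
  then have \<Gamma>: "closed \<Gamma>" "subspace \<Gamma>" by (simp_all add: \<Gamma>_def subspace_closure)
  have "closed {z :: 'h \<times> 'h. fst z = 0}" by (intro closed_Collect_eq continuous_intros)
  then have W: "closed W" "subspace W" using \<Gamma> by (auto simp: W_def closed_Int subspace_def)
  have "v ` \<Gamma>0 \<subseteq> \<Gamma>0" if v: "v \<in> U2" for v
  proof -
    obtain u where u: "u \<in> U" "v = map_prod u u" using v by (auto simp: U2_def)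
    have "v (s a, x a) = (s (u a), x (u a))" for a
      by (simp add: u(2) commutantD(2)[OF x u(1)] commutantD(2)[OF s u(1)])
    then show ?thesis by (auto simp: \<Gamma>0_def)
  qed
  then have "v ` \<Gamma> \<subseteq> \<Gamma>" if v: "v \<in> U2" for v
    using closure_bounded_linear_image_subset[OF D.U_bounded_linear[OF v], of \<Gamma>0]
      closure_mono[of "v ` \<Gamma>0" \<Gamma>0] v unfolding \<Gamma>_def by (meson order_trans)
  then have \<Gamma>_inv: "v z \<in> \<Gamma>" if "v \<in> U2" "z \<in> \<Gamma>" for v z using that by (meson image_subset_iff)
  have W_inv: "v z \<in> W" if v: "v \<in> U2" and z: "z \<in> W" for v z
  proof -
    obtain u where u: "u \<in> U" "v = map_prod u u" using v by (auto simp: U2_def)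
    have "fst (v z) = 0" using z by (simp add: u(2) W_def linear_0[OF linear_U[OF u(1)]])
    then show ?thesis using \<Gamma>_inv[OF v] z by (simp add: W_def)
  qed
  define Q where "Q z = z - hproj \<Gamma> z" for z
  have Q: "Q \<in> commutant U2" unfolding Q_def[abs_def]
    by (rule D.commutant_diff[OF D.commutant_id D.commutant_hproj[OF \<Gamma>]]) (rule \<Gamma>_inv)
  note Qlin = bounded_linear.linear[OF D.commutantD(1)[OF Q]]
  have Q_\<Gamma>: "Q z = 0" if "z \<in> \<Gamma>" for z by (simp add: Q_def hproj_id[OF \<Gamma> that])
  have Q_orth: "Q z \<bullet> g = 0" if "g \<in> \<Gamma>" for z g unfolding Q_def by (rule hproj_orth[OF \<Gamma> that])
  have QQ: "Q z \<bullet> z = Q z \<bullet> Q z" for z using Q_orth[OF hproj_mem[OF \<Gamma>, of z], of z]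
    by (simp only: Q_def[of z] inner_diff_right)
  \<comment> \<open>\<open>a\<close> is the adjoint of the column that sends v to (s v, x v), and
    \<open>K\<close> is the column composed with its adjoint.\<close>
  define a where "a z = adjoint s (fst z) + adjoint x (snd z)" for z
  define K where "K z = (s (a z), x (a z))" for z
  have Ka: "(s v, x v) \<bullet> z = v \<bullet> a z" for v z
    by (simp add: a_def inner_prod_def inner_add_right sx)
  have a_comm: "a (map_prod u u z) = u (a z)" if u: "u \<in> U" for u z
    by (simp add: a_def commutantD(2)[OF commutant_adjoint[OF x] u]
        commutantD(2)[OF commutant_adjoint[OF s] u] linear_add[OF linear_U[OF u]])
  have a_bl: "bounded_linear a" unfolding a_def[abs_def]
    by (intro bounded_linear_add bounded_linear_compose[OF adjoint_bounded_linear[OF bl(1)]]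
        bounded_linear_compose[OF adjoint_bounded_linear[OF bl(2)]]
        bounded_linear_fst bounded_linear_snd)
  have K: "K \<in> commutant U2" unfolding commutant_def mem_Collect_eq
  proof (intro conjI ballI allI)
    show "bounded_linear K" unfolding K_def[abs_def]
      by (intro bounded_linear_Pair bounded_linear_compose[OF bl(1) a_bl]
          bounded_linear_compose[OF bl(2) a_bl])
    fix v z assume "v \<in> U2"
    then obtain u where u: "u \<in> U" "v = map_prod u u" by (auto simp: U2_def)
    show "K (v z) = v (K z)"
      by (simp add: K_def u(2) a_comm[OF u(1)] commutantD(2)[OF x u(1)] commutantD(2)[OF s u(1)])
  qed
  have K_\<Gamma>: "K z \<in> \<Gamma>" for z unfolding K_def by (rule \<Gamma>_mem)
  \<comment> \<open>The range of T is orthogonal to W: the first part is projected away from W, and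
    the range of Q is orthogonal to \<Gamma>, which contains W. Once T is injective, finiteness
    leaves no room for W.\<close>
  define T where "T z = (K z - hproj W (K z)) + Q z" for z
  have "(\<lambda>z. hproj W (K z)) \<in> commutant U2"
    by (rule D.commutant_comp[OF D.commutant_hproj[OF W] K]) (rule W_inv)
  then have T: "T \<in> commutant U2"
    unfolding T_def[abs_def] by (rule D.commutant_add[OF D.commutant_diff[OF K] Q])
  have W\<Gamma>: "hproj W z \<in> \<Gamma>" for z using hproj_mem[OF W, of z] by (simp add: W_def)
  have T_inj: "z = 0" if Pz: "map_prod P P z = z" and Tz: "T z = 0" for z
  proof -
    \<comment> \<open>The two parts of T z lie in \<Gamma> and in its orthogonal complement, so T z
      = 0 makes both vanish. Then z is in \<Gamma> and K z in W, whence s (a z) = 0, a z = 0 and z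
      is orthogonal to \<Gamma>.\<close>
    have "K z - hproj W (K z) \<in> \<Gamma>" by (rule subspace_diff[OF \<Gamma>(2) K_\<Gamma> W\<Gamma>])
    then have "Q z \<bullet> (K z - hproj W (K z)) = 0" by (rule Q_orth)
    moreover have "Q z \<bullet> ((K z - hproj W (K z)) + Q z) = 0"
      using Tz unfolding T_def by (simp only: inner_zero_right)
    ultimately have "Q z \<bullet> Q z = 0" by (simp only: inner_add_right)
    then have Qz: "Q z = 0" by simp
    then have z\<Gamma>: "z \<in> \<Gamma>" using hproj_mem[OF \<Gamma>, of z] by (simp add: Q_def)
    have "K z = hproj W (K z)" using Tz Qz by (simp add: T_def)
    then have "K z \<in> W" using hproj_mem[OF W, of "K z"] by simp
    then have "s (a z) = 0" by (simp add: W_def K_def)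
    moreover have "P (a z) = a z" using a_comm[OF P_mem, of z] Pz by simp
    ultimately have "a z = 0" by (rule inj[rotated])
    then have "(s v, x v) \<bullet> z = 0" for v by (simp only: Ka inner_zero_right)
    then have "\<Gamma>0 \<subseteq> {g. g \<bullet> z = 0}" by (auto simp: \<Gamma>0_def)
    moreover have "closed {g. g \<bullet> z = 0}" by (intro closed_Collect_eq continuous_intros)
    ultimately have "\<Gamma> \<subseteq> {g. g \<bullet> z = 0}" unfolding \<Gamma>_def by (rule closure_minimal)
    then have "z \<in> {g. g \<bullet> z = 0}" using z\<Gamma> by (rule subsetD)
    then have "z \<bullet> z = 0" by (simp only: mem_Collect_eq)
    then show "z = 0" by simp
  qed
  \<comment> \<open>Q kills (s v, x v); the sign in \<open>y\<close> turns the vanishing of the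
    second component into r x = y s.\<close>
  define r where "r v = snd (Q (0, v))" for v
  define y where "y v = - snd (Q (v, 0))" for v
  have r: "r \<in> commutant U" unfolding r_def[abs_def] by (rule entry_commutant(4)[OF Q])
  have "(\<lambda>v. (-1) *\<^sub>R snd (Q (v, 0))) \<in> commutant U"
    by (rule commutant_scaleR[OF entry_commutant(2)[OF Q]])
  then have y: "y \<in> commutant U" by (simp add: y_def[abs_def])
  have eq: "r (x v) = y (s v)" for v
  proof -
    have "Q (s v, 0) + Q (0, x v) = Q (s v, x v)"
      using linear_add[OF Qlin, of "(s v, 0)" "(0, x v)"] by simp
    then have "Q (s v, 0) + Q (0, x v) = 0" by (simp only: Q_\<Gamma>[OF \<Gamma>_mem])
    then have "snd (Q (s v, 0)) + snd (Q (0, x v)) = 0" by (metis snd_add snd_zero)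
    then show ?thesis unfolding r_def y_def by (simp add: eq_neg_iff_add_eq_0 add.commute)
  qed
  have r_inj: "w = 0" if Pw: "P w = w" and rw: "r w = 0" for w
  proof -
    define z where "z = (0::'h, w)"
    \<comment> \<open>The form of a projection at z is the squared length of Q z. So the vanishing
      of one matrix entry on w already gives Q (0, w) = 0.\<close>
    have "Q z \<bullet> z = 0" using rw by (simp add: z_def r_def inner_prod_def)
    then have "Q z = 0" by (simp only: QQ inner_eq_zero_iff)
    then have "z \<in> \<Gamma>" using hproj_mem[OF \<Gamma>, of z] by (simp add: Q_def)
    then have zW: "z \<in> W" by (simp add: W_def z_def)
    have "z = 0"
    proof (rule D.injective_dense_range[OF T T_inj])
      show "map_prod P P z = z" by (simp add: z_def Pw P_zero)
      show "T v \<bullet> z = 0" for v using hproj_orth[OF W zW, of "K v"] Q_orth[OF \<open>z \<in> \<Gamma>\<close>, of v]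
        by (simp only: T_def inner_add_left)
    qed
    then show ?thesis by (simp add: z_def zero_prod_def)
  qed
  from r y eq r_inj show thesis by (rule that)
qed

end

section \<open>The Hilbert space of square-summable families\<close>

lemma square_summable_inner:
  fixes f g :: "'a \<Rightarrow> complex"
  assumes "(\<lambda>x. (cmod (f x))\<^sup>2) summable_on A" "(\<lambda>x. (cmod (g x))\<^sup>2) summable_on A"
  shows "(\<lambda>x. f x \<bullet> g x) summable_on A"
proof -
  have "(\<lambda>x. (cmod (f x))\<^sup>2 + (cmod (g x))\<^sup>2) summable_on A" by (rule summable_on_add[OF assms])
  then have "(\<lambda>x. norm ((cmod (f x))\<^sup>2 + (cmod (g x))\<^sup>2)) summable_on A"
    by (rule summable_on_iff_abs_summable_on_real[THEN iffD1])
  then have "(\<lambda>x. norm (f x \<bullet> g x)) summable_on A"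
  proof (rule Infinite_Sum.abs_summable_on_comparison_test)
    fix x
    have "\<bar>f x \<bullet> g x\<bar> \<le> cmod (f x) * cmod (g x)" by (rule Cauchy_Schwarz_ineq2)
    also have "\<dots> \<le> (cmod (f x))\<^sup>2 + (cmod (g x))\<^sup>2"
    proof -
      have "2 * (cmod (f x) * cmod (g x)) \<le> (cmod (f x))\<^sup>2 + (cmod (g x))\<^sup>2"
        using sum_squares_bound[of "cmod (f x)" "cmod (g x)"] by (simp add: mult.assoc)
      moreover have "0 \<le> cmod (f x) * cmod (g x)" by simp
      ultimately show ?thesis by linarith
    qed
    finally show "norm (f x \<bullet> g x) \<le> norm ((cmod (f x))\<^sup>2 + (cmod (g x))\<^sup>2)" by simp
  qed
  then show ?thesis by (rule summable_on_iff_abs_summable_on_real[THEN iffD2])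
qed

lemma square_summable_add:
  fixes f g :: "'a \<Rightarrow> complex"
  assumes "(\<lambda>x. (cmod (f x))\<^sup>2) summable_on A" "(\<lambda>x. (cmod (g x))\<^sup>2) summable_on A"
  shows "(\<lambda>x. (cmod (f x + g x))\<^sup>2) summable_on A"
proof -
  have "(\<lambda>x. (cmod (f x))\<^sup>2 + (cmod (g x))\<^sup>2 + 2 * (f x \<bullet> g x)) summable_on A"
    by (intro summable_on_add assms summable_on_cmult_right square_summable_inner)
  moreover have "(cmod (f x + g x))\<^sup>2 = (cmod (f x))\<^sup>2 + (cmod (g x))\<^sup>2 + 2 * (f x \<bullet> g x)" for x
    by (simp add: power2_norm_eq_inner inner_add_left inner_add_right inner_commute)
  ultimately show ?thesis by simp
qed

lemma square_summable_mult:
  fixes f :: "'a \<Rightarrow> complex"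
  assumes "(\<lambda>x. (cmod (f x))\<^sup>2) summable_on A"
  shows "(\<lambda>x. (cmod (c * f x))\<^sup>2) summable_on A"
  using assms by (simp add: norm_mult power_mult_distrib summable_on_cmult_right)

text \<open>Families on the whole type, as a type cannot depend on the carrier of a group. The space
  over the carrier appears later as the fixed space of \<open>restr\<close>.\<close>

typedef 'a ell2 = "{f :: 'a \<Rightarrow> complex. (\<lambda>x. (cmod (f x))\<^sup>2) summable_on UNIV}"
  morphisms coord Ell2 by (rule exI[of _ "\<lambda>_. 0"]) simp

setup_lifting type_definition_ell2

lemma coord_summable: "(\<lambda>x. (cmod (coord f x))\<^sup>2) summable_on UNIV" using coord[of f] by simp

lemma coord_Ell2: "(\<lambda>x. (cmod (f x))\<^sup>2) summable_on UNIV \<Longrightarrow> coord (Ell2 f) = f"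
  by (simp add: Ell2_inverse)

lemma ell2_eqI: "(\<And>x. coord f x = coord g x) \<Longrightarrow> f = g"
  by (rule coord_inject[THEN iffD1]) (rule ext)

instantiation ell2 :: (type) real_vector
begin

lift_definition zero_ell2 :: "'a ell2" is "\<lambda>_. 0" by simp
lift_definition plus_ell2 :: "'a ell2 \<Rightarrow> 'a ell2 \<Rightarrow> 'a ell2" is "\<lambda>f g x. f x + g x"
  by (rule square_summable_add)
lift_definition uminus_ell2 :: "'a ell2 \<Rightarrow> 'a ell2" is "\<lambda>f x. - f x" by simp
lift_definition minus_ell2 :: "'a ell2 \<Rightarrow> 'a ell2 \<Rightarrow> 'a ell2" is "\<lambda>f g x. f x - g x"
  subgoal for f g using square_summable_add[of f UNIV "\<lambda>x. - g x"] by simp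
  done
lift_definition scaleR_ell2 :: "real \<Rightarrow> 'a ell2 \<Rightarrow> 'a ell2" is "\<lambda>c f x. c *\<^sub>R f x"
  by (simp add: power_mult_distrib summable_on_cmult_right)

instance by standard (transfer; simp add: fun_eq_iff algebra_simps)+

end

lemmas coord_simps [simp] = zero_ell2.rep_eq plus_ell2.rep_eq uminus_ell2.rep_eq
  minus_ell2.rep_eq scaleR_ell2.rep_eq

instantiation ell2 :: (type) real_inner
begin

definition inner_ell2 :: "'a ell2 \<Rightarrow> 'a ell2 \<Rightarrow> real" where
  "inner_ell2 f g = (\<Sum>\<^sub>\<infinity>x. coord f x \<bullet> coord g x)"
definition norm_ell2 :: "'a ell2 \<Rightarrow> real" where "norm_ell2 f = sqrt (inner f f)"
definition sgn_ell2 :: "'a ell2 \<Rightarrow> 'a ell2" where "sgn_ell2 f = f /\<^sub>R norm f"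
definition dist_ell2 :: "'a ell2 \<Rightarrow> 'a ell2 \<Rightarrow> real" where "dist_ell2 f g = norm (f - g)"
definition uniformity_ell2 :: "('a ell2 \<times> 'a ell2) filter" where
  "uniformity_ell2 = (INF e\<in>{0<..}. principal {(f, g). dist f g < e})"
definition open_ell2 :: "'a ell2 set \<Rightarrow> bool" where
  "open_ell2 S = (\<forall>f\<in>S. \<forall>\<^sub>F (f', g) in uniformity. f' = f \<longrightarrow> g \<in> S)"

instance
proof
  fix f g h :: "'a ell2" and r :: real
  note s = square_summable_inner[OF coord_summable coord_summable]
  show "dist f g = norm (f - g)" by (rule dist_ell2_def)
  show "sgn f = f /\<^sub>R norm f" by (rule sgn_ell2_def)
  show "uniformity = (INF e\<in>{0<..}. principal {(f :: 'a ell2, g). dist f g < e})"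
    by (rule uniformity_ell2_def)
  show "open S = (\<forall>f\<in>S. \<forall>\<^sub>F (f', g) in uniformity. f' = f \<longrightarrow> g \<in> S)" for S :: "'a ell2 set"
    by (rule open_ell2_def)
  show "f \<bullet> g = g \<bullet> f" by (simp add: inner_ell2_def inner_commute)
  show "(f + g) \<bullet> h = f \<bullet> h + g \<bullet> h"
    unfolding inner_ell2_def by (simp add: inner_add_left infsum_add[OF s s])
  show "(r *\<^sub>R f) \<bullet> g = r * (f \<bullet> g)" unfolding inner_ell2_def by (simp add: infsum_cmult_right')
  show "0 \<le> f \<bullet> f" unfolding inner_ell2_def by (rule infsum_nonneg) simp
  show "f \<bullet> f = 0 \<longleftrightarrow> f = 0"
  proof
    assume "f \<bullet> f = 0"
    then have "coord f x \<bullet> coord f x = 0" for x unfolding inner_ell2_def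
      by (intro nonneg_infsum_le_0D[of "\<lambda>x. coord f x \<bullet> coord f x" UNIV]) (simp_all add: s)
    then show "f = 0" by (intro ell2_eqI) simp
  qed (simp add: inner_ell2_def)
  show "norm f = sqrt (f \<bullet> f)" by (rule norm_ell2_def)
qed

end

lemma norm_ell2_squared: "(norm f)\<^sup>2 = (\<Sum>\<^sub>\<infinity>x. (cmod (coord f x))\<^sup>2)"
  by (simp add: power2_norm_eq_inner inner_ell2_def)

lemma finite_sum_le_norm_ell2:
  assumes "finite F"
  shows "(\<Sum>x\<in>F. (cmod (coord f x))\<^sup>2) \<le> (norm f)\<^sup>2"
  unfolding norm_ell2_squared by (rule finite_sum_le_infsum[OF coord_summable assms]) auto

lemma coord_le_norm: "cmod (coord f x) \<le> norm f"
proof (rule power2_le_imp_le)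
  show "(cmod (coord f x))\<^sup>2 \<le> (norm f)\<^sup>2" using finite_sum_le_norm_ell2[of "{x}" f] by simp
qed simp

instance ell2 :: (type) complete_space
proof
  fix h :: "nat \<Rightarrow> 'a ell2" assume h: "Cauchy h"
  have "Cauchy (\<lambda>n. coord (h n) x)" for x
  proof (rule metric_CauchyI)
    fix e :: real assume "e > 0"
    then obtain N where N: "\<And>m n. m \<ge> N \<Longrightarrow> n \<ge> N \<Longrightarrow> dist (h m) (h n) < e"
      using metric_CauchyD[OF h] by metis
    have "dist (coord (h m) x) (coord (h n) x) < e" if "m \<ge> N" "n \<ge> N" for m n
      using coord_le_norm[of "h m - h n" x] N[OF that] by (simp add: dist_norm)
    then show "\<exists>M. \<forall>m\<ge>M. \<forall>n\<ge>M. dist (coord (h m) x) (coord (h n) x) < e" by blast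
  qed
  then have "\<exists>l. (\<lambda>n. coord (h n) x) \<longlonglongrightarrow> l" for x using Cauchy_convergent convergent_def by metis
  then obtain f where f: "\<And>x. (\<lambda>n. coord (h n) x) \<longlonglongrightarrow> f x" by metis
  \<comment> \<open>The estimate is uniform in the finite set F: it holds for h m in place of f and
    passes to the limit over finitely many coordinates. It yields both the summability of f and the
    rate of convergence.\<close>
  have bound: "(\<Sum>x\<in>F. (cmod (f x - coord (h n) x))\<^sup>2) \<le> e\<^sup>2"
    if F: "finite F" and N: "\<And>m. m \<ge> N \<Longrightarrow> dist (h m) (h n) < e" for F n N e
  proof (rule LIMSEQ_le_const2)
    show "(\<lambda>m. \<Sum>x\<in>F. (cmod (coord (h m) x - coord (h n) x))\<^sup>2) \<longlonglongrightarrow>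
      (\<Sum>x\<in>F. (cmod (f x - coord (h n) x))\<^sup>2)"
      by (intro tendsto_sum tendsto_power tendsto_norm tendsto_diff f tendsto_const)
    have "(\<Sum>x\<in>F. (cmod (coord (h m) x - coord (h n) x))\<^sup>2) \<le> e\<^sup>2" if "m \<ge> N" for m
    proof -
      have "(\<Sum>x\<in>F. (cmod (coord (h m) x - coord (h n) x))\<^sup>2) \<le> (norm (h m - h n))\<^sup>2"
        using finite_sum_le_norm_ell2[OF F, of "h m - h n"] by simp
      also have "\<dots> \<le> e\<^sup>2" using N[OF that] by (intro power_mono) (auto simp: dist_norm)
      finally show ?thesis .
    qed
    then show "\<exists>N. \<forall>m\<ge>N. (\<Sum>x\<in>F. (cmod (coord (h m) x - coord (h n) x))\<^sup>2) \<le> e\<^sup>2" by blast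
  qed
  have summ: "(\<lambda>x. (cmod (f x - coord (h n) x))\<^sup>2) summable_on UNIV"
    if N: "\<And>m. m \<ge> N \<Longrightarrow> dist (h m) (h n) < e" for n N e
    by (rule nonneg_bounded_partial_sums_imp_summable_on[where C = "e\<^sup>2"])
      (auto intro!: eventually_finite_subsets_at_top_weakI bound N)
  \<comment> \<open>f is the sum of h N1 and of a difference that is square summable by
    \<open>summ\<close>.\<close>
  obtain N1 where N1: "\<And>m n. m \<ge> N1 \<Longrightarrow> n \<ge> N1 \<Longrightarrow> dist (h m) (h n) < 1"
    using metric_CauchyD[OF h, of 1] by auto
  have "(\<lambda>x. (cmod ((f x - coord (h N1) x) + coord (h N1) x))\<^sup>2) summable_on UNIV"
    by (rule square_summable_add[OF summ[of N1 N1 1] coord_summable]) (simp add: N1)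
  then have cf: "coord (Ell2 f) = f" by (intro coord_Ell2) simp
  have "h \<longlonglongrightarrow> Ell2 f"
  proof (rule metric_LIMSEQ_I)
    fix r :: real assume "r > 0"
    then have "r / 2 > 0" by simp
    then obtain N where N: "\<And>m n. m \<ge> N \<Longrightarrow> n \<ge> N \<Longrightarrow> dist (h m) (h n) < r / 2"
      using metric_CauchyD[OF h] by metis
    have "dist (h n) (Ell2 f) < r" if n: "n \<ge> N" for n
    proof -
      have "(norm (Ell2 f - h n))\<^sup>2 \<le> (r / 2)\<^sup>2" unfolding norm_ell2_squared
        by (rule infsum_le_finite_sums[OF coord_summable])
          (use bound[of _ N n "r / 2"] N n in \<open>simp add: cf\<close>)
      then have "norm (Ell2 f - h n) \<le> r / 2" by (rule power2_le_imp_le) (use \<open>r > 0\<close> in simp)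
      then show ?thesis using \<open>r > 0\<close> by (simp add: dist_norm norm_minus_commute)
    qed
    then show "\<exists>N. \<forall>n\<ge>N. dist (h n) (Ell2 f) < r" by blast
  qed
  then show "convergent h" by (rule convergentI)
qed

lemma summable_on_extend_zero:
  assumes "F (0::complex) = (0::real)"
  shows "(\<lambda>x. F (if x \<in> A then f x else 0)) summable_on UNIV \<longleftrightarrow> (\<lambda>x. F (f x)) summable_on A"
  by (rule summable_on_cong_neutral) (use assms in auto)

text \<open>One formula covers left and right translations, complex scalars and, for \<phi> the
  identity on A, the cut-off to A. The inverse permutation together with the conjugate scalar gives
  the adjoint.\<close>

definition pull :: "'a set \<Rightarrow> complex \<Rightarrow> ('a \<Rightarrow> 'a) \<Rightarrow> 'a ell2 \<Rightarrow> 'a ell2" where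
  "pull A c \<phi> f = Ell2 (\<lambda>x. if x \<in> A then c * coord f (\<phi> x) else 0)"

locale permutation_pair =
  fixes A :: "'a set" and \<phi> \<psi> :: "'a \<Rightarrow> 'a"
  assumes maps: "x \<in> A \<Longrightarrow> \<phi> x \<in> A" "x \<in> A \<Longrightarrow> \<psi> x \<in> A"
    and inverse: "x \<in> A \<Longrightarrow> \<phi> (\<psi> x) = x" "x \<in> A \<Longrightarrow> \<psi> (\<phi> x) = x"
begin

lemma coord_pull: "coord (pull A c \<phi> f) x = (if x \<in> A then c * coord f (\<phi> x) else 0)"
proof -
  have "(\<lambda>x. (cmod (coord f x))\<^sup>2) summable_on A"
    by (rule summable_on_subset[OF coord_summable]) simp
  then have "(\<lambda>x. (cmod (coord f (\<phi> x)))\<^sup>2) summable_on A"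
    by (subst summable_on_reindex_bij_witness[of A \<psi> \<phi> A "\<lambda>x. (cmod (coord f x))\<^sup>2"])
      (auto simp: maps inverse)
  then have "(\<lambda>x. (cmod (c * coord f (\<phi> x)))\<^sup>2) summable_on A" by (rule square_summable_mult)
  then have "(\<lambda>x. (cmod (if x \<in> A then c * coord f (\<phi> x) else 0))\<^sup>2) summable_on UNIV"
    by (subst summable_on_extend_zero) auto
  then show ?thesis unfolding pull_def by (subst coord_Ell2) auto
qed

lemma norm_pull: "norm (pull A c \<phi> f) \<le> norm f * cmod c"
proof (rule power2_le_imp_le)
  have "(norm (pull A c \<phi> f))\<^sup>2 = (\<Sum>\<^sub>\<infinity>x\<in>A. (cmod c)\<^sup>2 * (cmod (coord f (\<phi> x)))\<^sup>2)"
    unfolding norm_ell2_squared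
    by (rule infsum_cong_neutral) (auto simp: coord_pull norm_mult power_mult_distrib)
  also have "\<dots> = (cmod c)\<^sup>2 * (\<Sum>\<^sub>\<infinity>x\<in>A. (cmod (coord f (\<phi> x)))\<^sup>2)" by (rule infsum_cmult_right')
  also have "(\<Sum>\<^sub>\<infinity>x\<in>A. (cmod (coord f (\<phi> x)))\<^sup>2) = (\<Sum>\<^sub>\<infinity>x\<in>A. (cmod (coord f x))\<^sup>2)"
    by (rule infsum_reindex_bij_witness[of A \<psi> \<phi>]) (auto simp: maps inverse)
  finally have eq: "(norm (pull A c \<phi> f))\<^sup>2 = (cmod c)\<^sup>2 * (\<Sum>\<^sub>\<infinity>x\<in>A. (cmod (coord f x))\<^sup>2)" .
  have "(\<Sum>\<^sub>\<infinity>x\<in>A. (cmod (coord f x))\<^sup>2) \<le> (\<Sum>\<^sub>\<infinity>x. (cmod (coord f x))\<^sup>2)"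
    by (rule infsum_mono2) (auto intro: coord_summable summable_on_subset[OF coord_summable])
  also have "\<dots> = (norm f)\<^sup>2" by (rule norm_ell2_squared[symmetric])
  finally have "(cmod c)\<^sup>2 * (\<Sum>\<^sub>\<infinity>x\<in>A. (cmod (coord f x))\<^sup>2) \<le> (cmod c)\<^sup>2 * (norm f)\<^sup>2"
    by (rule mult_left_mono) simp
  then show "(norm (pull A c \<phi> f))\<^sup>2 \<le> (norm f * cmod c)\<^sup>2"
    unfolding eq by (simp only: power_mult_distrib mult.commute)
qed simp

lemma pull_bounded_linear: "bounded_linear (pull A c \<phi>)"
proof (rule bounded_linear_intro)
  show "pull A c \<phi> (f + g) = pull A c \<phi> f + pull A c \<phi> g" for f g
    by (rule ell2_eqI) (simp add: coord_pull distrib_left)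
  show "pull A c \<phi> (r *\<^sub>R f) = r *\<^sub>R pull A c \<phi> f" for r f by (rule ell2_eqI) (simp add: coord_pull)
  show "norm (pull A c \<phi> f) \<le> norm f * cmod c" for f by (rule norm_pull)
qed

lemma inner_mult_cnj: "(c * u) \<bullet> v = u \<bullet> (cnj c * v)" for c u v :: complex
  by (simp add: inner_complex_def algebra_simps)

lemma inner_pull: "pull A c \<phi> f \<bullet> g = f \<bullet> pull A (cnj c) \<psi> g"
proof -
  interpret inv: permutation_pair A \<psi> \<phi> by unfold_locales (auto simp: maps inverse)
  have "pull A c \<phi> f \<bullet> g = (\<Sum>\<^sub>\<infinity>x\<in>A. (c * coord f (\<phi> x)) \<bullet> coord g x)"
    unfolding inner_ell2_def by (rule infsum_cong_neutral) (auto simp: coord_pull)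
  also have "\<dots> = (\<Sum>\<^sub>\<infinity>x\<in>A. (c * coord f x) \<bullet> coord g (\<psi> x))"
    by (rule infsum_reindex_bij_witness[of A \<psi> \<phi>]) (auto simp: maps inverse)
  also have "\<dots> = f \<bullet> pull A (cnj c) \<psi> g" unfolding inner_ell2_def
    by (rule infsum_cong_neutral) (auto simp: inv.coord_pull inner_mult_cnj)
  finally show ?thesis .
qed

end

definition kron :: "'a \<Rightarrow> complex \<Rightarrow> 'a ell2" where
  "kron x c = Ell2 (\<lambda>y. if y = x then c else 0)"

lemma coord_kron: "coord (kron x c) y = (if y = x then c else 0)"
proof -
  have "(\<lambda>y. (cmod (if y = x then c else 0))\<^sup>2) summable_on UNIV"
    by (rule finite_nonzero_values_imp_summable_on) (rule finite_subset[of _ "{x}"], auto)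
  then show ?thesis by (simp add: kron_def coord_Ell2)
qed

text \<open>The inner product is the real part of the Hermitian one, so a complex coordinate is
  recovered by testing with both c = 1 and c = i.\<close>

lemma inner_kron: "f \<bullet> kron x c = coord f x \<bullet> c"
proof -
  have "(\<Sum>\<^sub>\<infinity>y. coord f y \<bullet> coord (kron x c) y) = (\<Sum>\<^sub>\<infinity>y\<in>{x}. coord f y \<bullet> c)"
    by (rule infsum_cong_neutral) (auto simp: coord_kron)
  then show ?thesis by (simp add: inner_ell2_def)
qed

section \<open>The group von Neumann algebra as a commutant\<close>

context group
begin

definition trans :: "complex \<Rightarrow> 'a \<Rightarrow> 'a ell2 \<Rightarrow> 'a ell2" where
  "trans c g = pull (carrier G) c (\<lambda>x. inv g \<otimes> x)"

definition rtrans :: "'a \<Rightarrow> 'a ell2 \<Rightarrow> 'a ell2" where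
  "rtrans g = pull (carrier G) 1 (\<lambda>x. x \<otimes> g)"

text \<open>The scalars c make the commuting operators complex linear. With c = 1 and g the identity
  the family contains \<open>restr\<close>, which confines attention to functions on the
  carrier.\<close>

definition translation_ops :: "('a ell2 \<Rightarrow> 'a ell2) set" where
  "translation_ops = {trans c g |c g. g \<in> carrier G}"

abbreviation right_ops ("\<R>") where "\<R> \<equiv> commutant translation_ops"

abbreviation restr where "restr \<equiv> trans 1 \<one>"

lemma left_pair: "g \<in> carrier G \<Longrightarrow> permutation_pair (carrier G) (\<lambda>x. inv g \<otimes> x) (\<lambda>x. g \<otimes> x)"
  by unfold_locales (auto simp: m_assoc[symmetric])

lemma right_pair: "g \<in> carrier G \<Longrightarrow> permutation_pair (carrier G) (\<lambda>x. x \<otimes> g) (\<lambda>x. x \<otimes> inv g)"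
  by unfold_locales (auto simp: m_assoc)

lemma coord_trans:
  "g \<in> carrier G \<Longrightarrow> coord (trans c g f) x = (if x \<in> carrier G then c * coord f (inv g \<otimes> x) else 0)"
  unfolding trans_def by (rule permutation_pair.coord_pull[OF left_pair])

lemma coord_rtrans:
  "g \<in> carrier G \<Longrightarrow> coord (rtrans g f) x = (if x \<in> carrier G then coord f (x \<otimes> g) else 0)"
  unfolding rtrans_def by (subst permutation_pair.coord_pull[OF right_pair]) auto

lemma coord_restr: "coord (restr f) x = (if x \<in> carrier G then coord f x else 0)"
  by (simp add: coord_trans)

lemma trans_bounded_linear: "g \<in> carrier G \<Longrightarrow> bounded_linear (trans c g)"
  unfolding trans_def by (rule permutation_pair.pull_bounded_linear[OF left_pair])

lemma inner_trans: "g \<in> carrier G \<Longrightarrow> trans c g f \<bullet> h = f \<bullet> trans (cnj c) (inv g) h"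
  unfolding trans_def by (subst permutation_pair.inner_pull[OF left_pair]) auto

lemma trans_kron:
  assumes "g \<in> carrier G"
  shows "trans c g (kron \<one> 1) = kron g c"
proof (rule ell2_eqI)
  fix x
  have "inv g \<otimes> x = \<one> \<longleftrightarrow> x = g" if "x \<in> carrier G"
    using that assms inv_equality[of "inv g" x] by (metis inv_inv inv_closed l_inv)
  then show "coord (trans c g (kron \<one> 1)) x = coord (kron g c) x"
    using assms by (simp add: coord_trans coord_kron)
qed

lemma restr_eq_iff: "restr f = f \<longleftrightarrow> (\<forall>x. x \<notin> carrier G \<longrightarrow> coord f x = 0)"
proof
  assume "restr f = f"
  then show "\<forall>x. x \<notin> carrier G \<longrightarrow> coord f x = 0" by (metis coord_restr)
next
  assume "\<forall>x. x \<notin> carrier G \<longrightarrow> coord f x = 0"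
  then show "restr f = f" by (intro ell2_eqI) (simp add: coord_restr)
qed

lemma restr_restr [simp]: "restr (restr f) = restr f" by (simp add: restr_eq_iff coord_restr)

lemma adjoint_closed_translation_ops: "adjoint_closed translation_ops"
  unfolding adjoint_closed_def
proof (intro conjI allI impI)
  fix u assume "u \<in> translation_ops"
  then obtain c g where u: "u = trans c g" "g \<in> carrier G" by (auto simp: translation_ops_def)
  show "bounded_linear u" unfolding u(1) by (rule trans_bounded_linear[OF u(2)])
  have "trans (cnj c) (inv g) \<in> translation_ops" using u(2) by (auto simp: translation_ops_def)
  then show "\<exists>v\<in>translation_ops. \<forall>x y. u x \<bullet> y = x \<bullet> v y" using inner_trans[OF u(2)] u(1) by blast
qed

interpretation tr: adjoint_closed translation_ops by (rule adjoint_closed_translation_ops)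

lemma restr_mem: "restr \<in> translation_ops" unfolding translation_ops_def by blast

lemma commutant_trans:
  assumes "T \<in> \<R>" "g \<in> carrier G"
  shows "T (trans c g f) = trans c g (T f)"
  using tr.commutantD(2)[OF assms(1)] assms(2) by (auto simp: translation_ops_def)

text \<open>A commutes with the translation that carries the delta function at the identity to
  \<open>kron g c\<close>. So pairing \<open>kron g c\<close> with the adjoint applied to delta
  reads off one coordinate of A delta; c = 1 and c = i give the complex equality.\<close>

lemma coord_adjoint_delta:
  assumes A: "A \<in> \<R>" and g: "g \<in> carrier G"
  shows "coord (adjoint A (kron \<one> 1)) g = cnj (coord (A (kron \<one> 1)) (inv g))"
proof -
  have "coord (adjoint A (kron \<one> 1)) g \<bullet> c = Re (c * coord (A (kron \<one> 1)) (inv g))" for c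
  proof -
    have "coord (adjoint A (kron \<one> 1)) g \<bullet> c = kron g c \<bullet> adjoint A (kron \<one> 1)"
      by (simp only: inner_kron inner_commute[of "kron g c"])
    also have "\<dots> = A (trans c g (kron \<one> 1)) \<bullet> kron \<one> 1"
      by (simp only: adjoint_inner[OF tr.commutantD(1)[OF A]] trans_kron[OF g])
    also have "\<dots> = trans c g (A (kron \<one> 1)) \<bullet> kron \<one> 1" by (simp only: commutant_trans[OF A g])
    also have "\<dots> = (c * coord (A (kron \<one> 1)) (inv g)) \<bullet> 1"
      using g by (simp add: inner_kron coord_trans)
    finally show ?thesis by (simp add: inner_complex_def)
  qed
  from this[of 1] this[of \<i>] show ?thesis by (simp add: inner_complex_def complex_eq_iff)
qed

text \<open>Cyclicity: a function on the carrier that is orthogonal to all \<open>kron g c\<close>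
  has no nonzero coordinate. Trace property: in coordinates the trace of A B is a sum over g of a
  product taken at g and at its inverse, so reindexing by inversion exchanges A and B.\<close>

lemma trace_vector_translation_ops: "trace_vector translation_ops restr (kron \<one> 1)"
proof -
  let ?\<delta> = "kron \<one> 1 :: 'a ell2"
  have restr_\<delta>: "restr ?\<delta> = ?\<delta>" by (simp add: restr_eq_iff coord_kron)
  define V where "V = closure (span {u e |u e. u \<in> translation_ops \<and> e \<in> {?\<delta>}})"
  have V: "closed V" "subspace V" by (simp_all add: V_def subspace_closure)
  have kron_V: "kron g c \<in> V" if "g \<in> carrier G" for g c
  proof -
    have "trans c g \<in> translation_ops" using that by (auto simp: translation_ops_def)
    then have "kron g c \<in> {u e |u e. u \<in> translation_ops \<and> e \<in> {?\<delta>}}" unfolding mem_Collect_eq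
      by (intro exI[of _ "trans c g"] exI[of _ ?\<delta>] conjI) (simp_all add: trans_kron[OF that])
    then show ?thesis unfolding V_def by (rule subsetD[OF closure_subset, OF span_base])
  qed
  have "f \<in> V" if f: "restr f = f" for f
  proof -
    define n where "n = f - hproj V f"
    have orth: "n \<bullet> v = 0" if "v \<in> V" for v unfolding n_def by (rule hproj_orth[OF V that])
    have "coord n g = 0" if "g \<in> carrier G" for g
      using orth[OF kron_V[OF that, of 1]] orth[OF kron_V[OF that, of \<i>]]
      by (simp add: inner_kron inner_complex_def complex_eq_iff)
    then have "coord n x \<bullet> coord f x = 0" for x
      using f by (cases "x \<in> carrier G") (auto simp: restr_eq_iff)
    then have "n \<bullet> f = 0" by (simp add: inner_ell2_def)
    then have "n \<bullet> n = 0"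
      using orth[OF hproj_mem[OF V, of f]] by (simp add: n_def inner_diff_right)
    then have "f = hproj V f" by (simp add: n_def)
    then show ?thesis using hproj_mem[OF V, of f] by simp
  qed
  then have cyc: "{x. restr x = x} \<subseteq> V" by auto
  have tr: "A (B ?\<delta>) \<bullet> ?\<delta> = (\<Sum>\<^sub>\<infinity>g\<in>carrier G. Re (coord (B ?\<delta>) g * coord (A ?\<delta>) (inv g)))"
    if A: "A \<in> \<R>" and B: "B \<in> \<R>" for A B
  proof -
    have "restr (B ?\<delta>) = B ?\<delta>" using commutant_trans[OF B one_closed, of 1 ?\<delta>] restr_\<delta> by simp
    then have B0: "coord (B ?\<delta>) g = 0" if "g \<notin> carrier G" for g
      using that by (simp add: restr_eq_iff)
    have "A (B ?\<delta>) \<bullet> ?\<delta> = B ?\<delta> \<bullet> adjoint A ?\<delta>" by (rule adjoint_inner[OF tr.commutantD(1)[OF A]])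
    also have "\<dots> = (\<Sum>\<^sub>\<infinity>g. coord (B ?\<delta>) g \<bullet> coord (adjoint A ?\<delta>) g)" by (rule inner_ell2_def)
    also have "\<dots> = (\<Sum>\<^sub>\<infinity>g\<in>carrier G. Re (coord (B ?\<delta>) g * coord (A ?\<delta>) (inv g)))"
      by (rule infsum_cong_neutral)
        (auto simp: B0 coord_adjoint_delta[OF A] inner_complex_def)
    finally show ?thesis .
  qed
  have "A (B ?\<delta>) \<bullet> ?\<delta> = B (A ?\<delta>) \<bullet> ?\<delta>" if A: "A \<in> \<R>" and B: "B \<in> \<R>" for A B
    unfolding tr[OF A B] tr[OF B A]
    by (rule infsum_reindex_bij_witness[of _ "\<lambda>g. inv g" "\<lambda>g. inv g"]) (auto simp: mult.commute)
  then show ?thesis using restr_mem restr_\<delta> cyc unfolding V_def by unfold_locales simp_all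
qed

interpretation tr: trace_vector translation_ops restr "kron \<one> 1"
  by (rule trace_vector_translation_ops)

section \<open>Dictionary between N(G) and the commutant\<close>

abbreviation N where "N \<equiv> group_vN_algebra G"

lemma l2_iff:
  "f \<in> l2 G \<longleftrightarrow> (\<forall>x. x \<notin> carrier G \<longrightarrow> f x = 0) \<and> (\<lambda>x. (cmod (f x))\<^sup>2) summable_on UNIV"
proof (cases "\<forall>x. x \<notin> carrier G \<longrightarrow> f x = 0")
  case True
  then have "(\<lambda>x. (cmod (f x))\<^sup>2) summable_on UNIV \<longleftrightarrow> (\<lambda>x. (cmod (f x))\<^sup>2) summable_on carrier G"
    by (intro summable_on_cong_neutral) auto
  with True show ?thesis by (auto simp: l2_def)
qed (auto simp: l2_def)

lemma coord_Ell2_l2 [simp]: "f \<in> l2 G \<Longrightarrow> coord (Ell2 f) = f" by (simp add: l2_iff coord_Ell2)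

lemma restr_Ell2: "f \<in> l2 G \<Longrightarrow> restr (Ell2 f) = Ell2 f"
  by (simp add: restr_eq_iff) (simp add: l2_iff)

lemma coord_mem_l2: "restr f = f \<Longrightarrow> coord f \<in> l2 G"
  by (simp add: restr_eq_iff l2_iff coord_summable)

lemma coord_restr_mem: "coord (restr f) \<in> l2 G" by (rule coord_mem_l2) simp

lemma Ell2_coord [simp]: "Ell2 (coord f) = f" by (rule coord_inverse)

lemma l2_norm_eq: "f \<in> l2 G \<Longrightarrow> l2_norm G f = norm (Ell2 f)"
proof -
  assume f: "f \<in> l2 G"
  then have "(\<Sum>\<^sub>\<infinity>x\<in>carrier G. (cmod (f x))\<^sup>2) = (\<Sum>\<^sub>\<infinity>x. (cmod (f x))\<^sup>2)"
    by (intro infsum_cong_neutral) (auto simp: l2_iff)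
  then show ?thesis
    using f norm_ell2_squared[of "Ell2 f"] by (simp add: l2_norm_def real_sqrt_unique)
qed

lemma left_translation_eq:
  assumes "g \<in> carrier G" "f \<in> l2 G"
  shows "left_translation G g f = coord (trans 1 g (Ell2 f))"
  using assms by (auto simp: left_translation_def coord_trans)

text \<open>Passes from operators on the type \<open>ell2\<close> to the extensional functions on
  \<open>l2 G\<close> that make up N(G). Operators that agree on the fixed space of
  \<open>restr\<close> have the same image.\<close>

definition as_op :: "('a ell2 \<Rightarrow> 'a ell2) \<Rightarrow> ('a \<Rightarrow> complex) \<Rightarrow> 'a \<Rightarrow> complex" where
  "as_op T = (\<lambda>f\<in>l2 G. coord (T (Ell2 f)))"

lemma commutant_restr:
  assumes "T \<in> \<R>" "restr f = f"
  shows "restr (T f) = T f" using commutant_trans[OF assms(1) one_closed, of 1 f] assms(2) by simp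

lemma as_op_closed: "T \<in> \<R> \<Longrightarrow> f \<in> l2 G \<Longrightarrow> coord (T (Ell2 f)) \<in> l2 G"
  by (rule coord_mem_l2[OF commutant_restr[OF _ restr_Ell2]])

lemma as_op_mem:
  assumes T: "T \<in> \<R>"
  shows "as_op T \<in> carrier N"
proof -
  interpret T: bounded_linear T by (rule tr.commutantD(1)[OF T])
  have l2_add: "(\<lambda>x. f x + h x) \<in> l2 G" if "f \<in> l2 G" "h \<in> l2 G" for f h
    using that by (auto simp: l2_iff square_summable_add)
  have l2_mult: "(\<lambda>x. c * f x) \<in> l2 G" if "f \<in> l2 G" for c f
    using that square_summable_mult[of f UNIV c] by (auto simp: l2_iff)
  have "as_op T (\<lambda>x. f x + h x) = (\<lambda>x. as_op T f x + as_op T h x)"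
    if fh: "f \<in> l2 G" "h \<in> l2 G" for f h
  proof -
    have "Ell2 (\<lambda>x. f x + h x) = Ell2 f + Ell2 h" by (rule ell2_eqI) (simp add: fh l2_add)
    then show ?thesis by (simp add: as_op_def fh l2_add T.add)
  qed
  moreover have "as_op T (\<lambda>x. c * f x) = (\<lambda>x. c * as_op T f x)" if f: "f \<in> l2 G" for c f
  proof -
    have "f x = 0" if "x \<notin> carrier G" for x using f that by (simp add: l2_iff)
    \<comment> \<open>Multiplication by c is the translation operator at the identity with scalar c,
      so complex linearity is an instance of commutation.\<close>
    then have "Ell2 (\<lambda>x. c * f x) = trans c \<one> (Ell2 f)" by (intro ell2_eqI)
        (simp add: coord_Ell2_l2[OF l2_mult[OF f]] coord_Ell2_l2[OF f] coord_trans)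
    then have "as_op T (\<lambda>x. c * f x) = coord (trans c \<one> (T (Ell2 f)))"
      by (simp add: as_op_def f l2_mult commutant_trans[OF T])
    also have "\<dots> = (\<lambda>x. c * as_op T f x)"
      using as_op_closed[OF T f] f by (auto simp: coord_trans as_op_def l2_iff)
    finally show ?thesis .
  qed
  moreover have "\<exists>K. \<forall>f\<in>l2 G. l2_norm G (as_op T f) \<le> K * l2_norm G f"
  proof -
    obtain K where "\<And>f. norm (T f) \<le> norm f * K" using T.bounded by metis
    then have "\<forall>f\<in>l2 G. l2_norm G (as_op T f) \<le> K * l2_norm G f"
      by (simp add: as_op_def l2_norm_eq as_op_closed[OF T] mult.commute)
    then show ?thesis by blast
  qed
  moreover have "as_op T (left_translation G g f) = left_translation G g (as_op T f)"
    if g: "g \<in> carrier G" and f: "f \<in> l2 G" for g f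
  proof -
    have "restr (trans 1 g (Ell2 f)) = trans 1 g (Ell2 f)"
      using g by (simp add: restr_eq_iff coord_trans)
    then show ?thesis using g f as_op_closed[OF T f]
      by (simp add: left_translation_eq as_op_def coord_mem_l2 commutant_trans[OF T])
  qed
  moreover have "as_op T \<in> l2 G \<rightarrow>\<^sub>E l2 G" using as_op_closed[OF T] by (auto simp: as_op_def)
  ultimately show ?thesis by (simp add: group_vN_algebra_def)
qed

lemma N_eq_as_op:
  assumes S: "S \<in> carrier N"
  obtains T where "T \<in> \<R>" "S = as_op T"
proof -
  have Smem: "S \<in> l2 G \<rightarrow>\<^sub>E l2 G"
    and Sadd: "\<And>f h. f \<in> l2 G \<Longrightarrow> h \<in> l2 G \<Longrightarrow> S (\<lambda>x. f x + h x) = (\<lambda>x. S f x + S h x)"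
    and Smult: "\<And>c f. f \<in> l2 G \<Longrightarrow> S (\<lambda>x. c * f x) = (\<lambda>x. c * S f x)"
    and Sbound: "\<exists>K. \<forall>f\<in>l2 G. l2_norm G (S f) \<le> K * l2_norm G f"
    and Strans: "\<And>g f. g \<in> carrier G \<Longrightarrow> f \<in> l2 G \<Longrightarrow>
      S (left_translation G g f) = left_translation G g (S f)"
    using S unfolding group_vN_algebra_def by auto
  have Sl2: "S f \<in> l2 G" if "f \<in> l2 G" for f using Smem that by auto
  \<comment> \<open>Precomposing with \<open>restr\<close> extends S to families that do not vanish
    off the carrier.\<close>
  define T where "T v = Ell2 (S (coord (restr v)))" for v
  have coordT: "coord (T v) = S (coord (restr v))" for v
    unfolding T_def by (rule coord_Ell2_l2[OF Sl2[OF coord_restr_mem]])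
  obtain K where K: "\<And>f. f \<in> l2 G \<Longrightarrow> l2_norm G (S f) \<le> K * l2_norm G f" using Sbound by blast
  have "bounded_linear T"
  proof (rule bounded_linear_intro)
    show "T (v + w) = T v + T w" for v w
    proof (rule ell2_eqI)
      have "coord (restr (v + w)) = (\<lambda>x. coord (restr v) x + coord (restr w) x)"
        by (auto simp: coord_restr)
      then show "coord (T (v + w)) x = coord (T v + T w) x" for x
        by (simp add: coordT Sadd[OF coord_restr_mem coord_restr_mem])
    qed
    show "T (r *\<^sub>R v) = r *\<^sub>R T v" for r v
    proof (rule ell2_eqI)
      have "coord (restr (r *\<^sub>R v)) = (\<lambda>x. of_real r * coord (restr v) x)"
        by (auto simp: coord_restr scaleR_conv_of_real)
      then show "coord (T (r *\<^sub>R v)) x = coord (r *\<^sub>R T v) x" for x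
        by (simp add: coordT Smult[OF coord_restr_mem] scaleR_conv_of_real)
    qed
    show "norm (T v) \<le> norm v * \<bar>K\<bar>" for v
    proof -
      have "norm (T v) = l2_norm G (S (coord (restr v)))"
        unfolding T_def by (rule l2_norm_eq[symmetric, OF Sl2[OF coord_restr_mem]])
      also have "\<dots> \<le> K * l2_norm G (coord (restr v))" by (rule K[OF coord_restr_mem])
      also have "\<dots> = K * norm (restr v)" by (simp add: l2_norm_eq[OF coord_restr_mem])
      also have "\<dots> \<le> \<bar>K\<bar> * norm (restr v)" by (intro mult_right_mono) auto
      also have "norm (restr v) \<le> norm v"
        unfolding trans_def using permutation_pair.norm_pull[OF left_pair[OF one_closed], of 1 v] by simp
      then have "\<bar>K\<bar> * norm (restr v) \<le> \<bar>K\<bar> * norm v" by (intro mult_left_mono) auto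
      finally show ?thesis by (simp add: mult.commute)
    qed
  qed
  moreover have "T (trans c g v) = trans c g (T v)" if g: "g \<in> carrier G" for c g v
  proof (rule ell2_eqI)
    have l2_left: "left_translation G g (coord (restr v)) \<in> l2 G"
      using g by (simp add: left_translation_eq coord_restr_mem coord_mem_l2 restr_eq_iff coord_trans)
    have "coord (restr (trans c g v)) = (\<lambda>x. c * left_translation G g (coord (restr v)) x)"
      using g by (auto simp: coord_restr coord_trans left_translation_def)
    then show "coord (T (trans c g v)) x = coord (trans c g (T v)) x" for x
      using g Sl2[OF coord_restr_mem[of v]]
      by (simp add: coordT Smult[OF l2_left] Strans[OF g coord_restr_mem] coord_trans)
        (simp add: left_translation_def)
  qed
  ultimately have T: "T \<in> \<R>" by (auto simp: commutant_def translation_ops_def)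
  have "S f = as_op T f" for f
  proof (cases "f \<in> l2 G")
    case True
    then show ?thesis by (simp add: as_op_def coordT restr_Ell2)
  next
    case False
    then show ?thesis using Smem by (auto simp: as_op_def)
  qed
  then have "S = as_op T" by (rule ext)
  with T show thesis by (rule that)
qed

lemma as_op_eq_iff: "as_op S = as_op T \<longleftrightarrow> (\<forall>v. restr v = v \<longrightarrow> S v = T v)"
proof
  assume eq: "as_op S = as_op T"
  show "\<forall>v. restr v = v \<longrightarrow> S v = T v"
  proof (intro allI impI)
    fix v assume "restr v = v"
    then have "coord v \<in> l2 G" by (rule coord_mem_l2)
    then have "coord (S v) = coord (T v)" using fun_cong[OF eq, of "coord v"] by (simp add: as_op_def)
    then show "S v = T v" by (simp add: coord_inject)
  qed
next
  assume "\<forall>v. restr v = v \<longrightarrow> S v = T v"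
  then show "as_op S = as_op T" using restr_Ell2 by (auto simp: as_op_def)
qed

lemma add_as_op: "as_op S \<oplus>\<^bsub>N\<^esub> as_op T = as_op (\<lambda>v. S v + T v)"
  by (auto simp: group_vN_algebra_def as_op_def)

lemma mult_as_op:
  assumes "T \<in> \<R>"
  shows "as_op S \<otimes>\<^bsub>N\<^esub> as_op T = as_op (\<lambda>v. S (T v))"
  using as_op_closed[OF assms] by (auto simp: group_vN_algebra_def as_op_def compose_def)

lemma zero_as_op: "\<zero>\<^bsub>N\<^esub> = as_op (\<lambda>v. 0)" by (auto simp: group_vN_algebra_def as_op_def)

lemma one_as_op: "\<one>\<^bsub>N\<^esub> = as_op (\<lambda>v. v)" by (auto simp: group_vN_algebra_def as_op_def)

lemma zero_mem_commutant: "(\<lambda>v. 0) \<in> \<R>"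
  using tr.commutant_diff[OF tr.commutant_id tr.commutant_id] by simp

lemma carrier_N: "carrier N = as_op ` \<R>"
proof (rule equalityI; rule subsetI)
  fix x assume "x \<in> carrier N"
  then obtain T where "T \<in> \<R>" "x = as_op T" by (rule N_eq_as_op)
  then show "x \<in> as_op ` \<R>" by simp
next
  fix x assume "x \<in> as_op ` \<R>"
  then show "x \<in> carrier N" using as_op_mem by auto
qed

lemma ring_N: "ring N"
proof (rule ringI)
  show "abelian_group N"
  proof (rule abelian_groupI)
    fix x y assume "x \<in> carrier N" "y \<in> carrier N"
    then show "x \<oplus>\<^bsub>N\<^esub> y \<in> carrier N" by (auto simp: carrier_N add_as_op intro: tr.commutant_add)
  next
    show "\<zero>\<^bsub>N\<^esub> \<in> carrier N" using zero_mem_commutant by (auto simp: carrier_N zero_as_op)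
  next
    fix x assume "x \<in> carrier N"
    then obtain S where S: "S \<in> \<R>" "x = as_op S" by (auto simp: carrier_N)
    have "(\<lambda>v. (-1) *\<^sub>R S v) \<in> \<R>" by (rule tr.commutant_scaleR[OF S(1)])
    moreover have "as_op (\<lambda>v. (-1) *\<^sub>R S v) \<oplus>\<^bsub>N\<^esub> x = \<zero>\<^bsub>N\<^esub>" by (simp add: S add_as_op zero_as_op)
    ultimately show "\<exists>y\<in>carrier N. y \<oplus>\<^bsub>N\<^esub> x = \<zero>\<^bsub>N\<^esub>" unfolding carrier_N by blast
  qed (auto simp: carrier_N add_as_op zero_as_op add_ac)
  show "Group.monoid N"
    by (rule monoidI) (auto simp: carrier_N mult_as_op one_as_op tr.commutant_comp
        tr.commutant_id)
  fix x y z assume "x \<in> carrier N" "y \<in> carrier N" "z \<in> carrier N"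
  then obtain S T R where S: "S \<in> \<R>" "x = as_op S"
    and T: "T \<in> \<R>" "y = as_op T"
    and R: "R \<in> \<R>" "z = as_op R" by (auto simp: carrier_N)
  interpret R: bounded_linear R by (rule tr.commutantD(1)[OF R(1)])
  show "(x \<oplus>\<^bsub>N\<^esub> y) \<otimes>\<^bsub>N\<^esub> z = x \<otimes>\<^bsub>N\<^esub> z \<oplus>\<^bsub>N\<^esub> y \<otimes>\<^bsub>N\<^esub> z" by (simp add: S T R add_as_op mult_as_op)
  show "z \<otimes>\<^bsub>N\<^esub> (x \<oplus>\<^bsub>N\<^esub> y) = z \<otimes>\<^bsub>N\<^esub> x \<oplus>\<^bsub>N\<^esub> z \<otimes>\<^bsub>N\<^esub> y"
    by (simp add: S T R add_as_op mult_as_op tr.commutant_add R.add)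
qed

text \<open>In a finite von Neumann algebra the injective elements are the non-zero-divisors.\<close>

definition regular :: "(('a \<Rightarrow> complex) \<Rightarrow> 'a \<Rightarrow> complex) set" where
  "regular = {as_op S |S. S \<in> \<R> \<and> (\<forall>v. restr v = v \<longrightarrow> S v = 0 \<longrightarrow> v = 0)}"

lemma regular_closed: "r \<in> regular \<Longrightarrow> r \<in> carrier N" by (auto simp: regular_def carrier_N)

lemma regular_one: "\<one>\<^bsub>N\<^esub> \<in> regular" using tr.commutant_id by (auto simp: regular_def one_as_op)

lemma regular_mult:
  assumes "r \<in> regular" "s \<in> regular"
  shows "r \<otimes>\<^bsub>N\<^esub> s \<in> regular"
proof -
  obtain R S where R: "R \<in> \<R>" "r = as_op R"
      "\<And>v. restr v = v \<Longrightarrow> R v = 0 \<Longrightarrow> v = 0"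
    and S: "S \<in> \<R>" "s = as_op S" "\<And>v. restr v = v \<Longrightarrow> S v = 0 \<Longrightarrow> v = 0"
    using assms by (auto simp: regular_def)
  have "v = 0" if "restr v = v" "R (S v) = 0" for v
    by (rule S(3)[OF that(1) R(3)[OF commutant_restr[OF S(1) that(1)] that(2)]])
  moreover have "(\<lambda>v. R (S v)) \<in> \<R>" by (rule tr.commutant_comp[OF R(1) S(1)])
  ultimately show ?thesis by (auto simp: regular_def R S mult_as_op)
qed

lemma regular_cancel_left:
  assumes "r \<in> regular" "x \<in> carrier N" "r \<otimes>\<^bsub>N\<^esub> x = \<zero>\<^bsub>N\<^esub>"
  shows "x = \<zero>\<^bsub>N\<^esub>"
proof -
  obtain R S where R: "R \<in> \<R>" "r = as_op R"
      "\<And>v. restr v = v \<Longrightarrow> R v = 0 \<Longrightarrow> v = 0"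
    and S: "S \<in> \<R>" "x = as_op S" using assms(1,2) by (auto simp: regular_def carrier_N)
  have "R (S v) = 0" if "restr v = v" for v
    using assms(3) that by (simp add: R(2) S mult_as_op zero_as_op as_op_eq_iff)
  then have "S v = 0" if "restr v = v" for v
    using R(3)[OF commutant_restr[OF S(1) that]] that by simp
  then show ?thesis by (simp add: S zero_as_op as_op_eq_iff)
qed

text \<open>Finiteness enters here: the element vanishes on the range of r, which is dense by
  \<open>injective_dense_range\<close>. The argument is phrased through the adjoint, whose values
  are orthogonal to that range.\<close>

lemma regular_cancel_right:
  assumes "r \<in> regular" "x \<in> carrier N" "x \<otimes>\<^bsub>N\<^esub> r = \<zero>\<^bsub>N\<^esub>"
  shows "x = \<zero>\<^bsub>N\<^esub>"
proof -
  obtain R S where R: "R \<in> \<R>" "r = as_op R"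
      "\<And>v. restr v = v \<Longrightarrow> R v = 0 \<Longrightarrow> v = 0"
    and S: "S \<in> \<R>" "x = as_op S" using assms(1,2) by (auto simp: regular_def carrier_N)
  note blS = tr.commutantD(1)[OF S(1)]
  have SR: "S (R v) = 0" if "restr v = v" for v
    using assms(3) that by (simp add: R S(2) mult_as_op zero_as_op as_op_eq_iff)
  have "adjoint S w = 0" if w: "restr w = w" for w
  proof (rule tr.injective_dense_range[OF R(1) R(3)])
    show P: "restr (adjoint S w) = adjoint S w"
      by (rule commutant_restr[OF tr.commutant_adjoint[OF S(1)] w])
    show "R v \<bullet> adjoint S w = 0" for v
    proof -
      \<comment> \<open>S R is known to vanish on functions on the carrier, so \<open>restr\<close>
        is inserted next to the adjoint, which it fixes, and moved across the inner product onto
        v.\<close>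
      have "R v \<bullet> adjoint S w = R v \<bullet> restr (adjoint S w)" by (simp only: P)
      also have "\<dots> = restr (R v) \<bullet> adjoint S w"
        using inner_trans[OF one_closed, of 1 "R v" "adjoint S w"] by simp
      also have "\<dots> = S (R (restr v)) \<bullet> w"
        by (simp only: commutant_trans[OF R(1) one_closed] adjoint_inner[OF blS])
      finally show ?thesis by (simp add: SR)
    qed
  qed
  then have "S v \<bullet> S v = 0" if "restr v = v" for v
    using commutant_restr[OF S(1) that] by (simp add: adjoint_inner[OF blS])
  then show ?thesis by (simp add: S zero_as_op as_op_eq_iff)
qed

lemma regular_ore:
  assumes "x \<in> carrier N" "s \<in> regular"
  obtains r y where "r \<in> regular" "y \<in> carrier N" "r \<otimes>\<^bsub>N\<^esub> x = y \<otimes>\<^bsub>N\<^esub> s"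
proof -
  obtain T S where T: "T \<in> \<R>" "x = as_op T"
    and S: "S \<in> \<R>" "s = as_op S"
    and inj: "\<forall>v. restr v = v \<longrightarrow> S v = 0 \<longrightarrow> v = 0" using assms by (auto simp: regular_def carrier_N)
  have S_inj: "v = 0" if "restr v = v" "S v = 0" for v using inj that by simp
  obtain R Y where R: "R \<in> \<R>" "Y \<in> \<R>"
    "\<And>v. R (T v) = Y (S v)" "\<And>v. restr v = v \<Longrightarrow> R v = 0 \<Longrightarrow> v = 0"
    using tr.ore_condition[OF T(1) S(1) S_inj] by metis
  show thesis
  proof (rule that)
    show "as_op R \<in> regular" using R(1,4) by (auto simp: regular_def)
    show "as_op Y \<in> carrier N" by (rule as_op_mem[OF R(2)])
    show "as_op R \<otimes>\<^bsub>N\<^esub> x = as_op Y \<otimes>\<^bsub>N\<^esub> s" by (simp add: T S mult_as_op R(2,3))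
  qed
qed

lemma right_translation_as_op: "g \<in> carrier G \<Longrightarrow> right_translation G g = as_op (rtrans g)"
  unfolding right_translation_def as_op_def by (intro restrict_ext ext) (simp add: coord_rtrans)

lemma rtrans_mem:
  assumes g: "g \<in> carrier G"
  shows "rtrans g \<in> \<R>"
proof -
  have "rtrans g (trans c h v) = trans c h (rtrans g v)" if "h \<in> carrier G" for c h v
    using that g by (intro ell2_eqI) (auto simp: coord_rtrans coord_trans m_assoc)
  then show ?thesis using permutation_pair.pull_bounded_linear[OF right_pair[OF g], of 1]
    by (auto simp: commutant_def translation_ops_def rtrans_def)
qed

lemma right_translation_mem: "g \<in> carrier G \<Longrightarrow> right_translation G g \<in> carrier N"
  by (simp add: right_translation_as_op rtrans_mem as_op_mem)

lemma right_translation_mult: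
  assumes "g \<in> carrier G" "h \<in> carrier G"
  shows "right_translation G (g \<otimes> h) = right_translation G g \<otimes>\<^bsub>N\<^esub> right_translation G h"
proof -
  have "rtrans (g \<otimes> h) v = rtrans g (rtrans h v)" for v
    using assms by (intro ell2_eqI) (simp add: coord_rtrans m_assoc)
  then have "rtrans (g \<otimes> h) = (\<lambda>v. rtrans g (rtrans h v))" by (rule ext)
  then show ?thesis using assms by (simp add: right_translation_as_op mult_as_op rtrans_mem)
qed

lemma right_translation_one: "right_translation G \<one> = \<one>\<^bsub>N\<^esub>"
proof -
  have "rtrans \<one> v = v" if "restr v = v" for v
    using that by (intro ell2_eqI) (auto simp: coord_rtrans restr_eq_iff)
  then show ?thesis by (simp add: right_translation_as_op one_as_op as_op_eq_iff)
qed

text \<open>A vector fixed by \<open>g\<close> is constant along the infinite sets \<open>{x g\<^sup>k}\<close>, hence zero.\<close>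

lemma right_translation_minus_one_regular:
  assumes g: "g \<in> carrier G" and tf: "\<And>n::nat. 0 < n \<Longrightarrow> g [^] n \<noteq> \<one>"
  shows "right_translation G g \<ominus>\<^bsub>N\<^esub> \<one>\<^bsub>N\<^esub> \<in> regular"
proof -
  interpret N: ring N by (rule ring_N)
  have mem: "(\<lambda>v. rtrans g v - v) \<in> \<R>"
    by (rule tr.commutant_diff[OF rtrans_mem[OF g] tr.commutant_id])
  \<comment> \<open>The additive inverse in N(G) is abstract, so the difference is found by writing
    the right translation as a sum and cancelling.\<close>
  have sum: "right_translation G g = as_op (\<lambda>v. rtrans g v - v) \<oplus>\<^bsub>N\<^esub> \<one>\<^bsub>N\<^esub>"
    by (simp add: one_as_op add_as_op right_translation_as_op[OF g])
  have eq: "right_translation G g \<ominus>\<^bsub>N\<^esub> \<one>\<^bsub>N\<^esub> = as_op (\<lambda>v. rtrans g v - v)"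
    unfolding sum using as_op_mem[OF mem] by (simp add: N.minus_eq N.a_assoc N.r_neg)
  have inj: "i = j" if ij: "g [^] (i::nat) = g [^] (j::nat)" for i j
  proof -
    have "i \<le> j \<Longrightarrow> g [^] i = g [^] j \<Longrightarrow> i = j" for i j :: nat
    proof -
      assume "i \<le> j" and e: "g [^] i = g [^] j"
      have "g [^] i \<otimes> g [^] (j - i) = g [^] (i + (j - i))" by (rule nat_pow_mult[OF g])
      also have "\<dots> = g [^] i" using \<open>i \<le> j\<close> e by simp
      finally have "g [^] i \<otimes> g [^] (j - i) = g [^] i \<otimes> \<one>" using g by simp
      then have "g [^] (j - i) = \<one>" using g by (simp only: l_cancel nat_pow_closed one_closed)
      then show "i = j" using tf[of "j - i"] \<open>i \<le> j\<close> by (cases "j - i = 0") auto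
    qed
    from this[of i j] this[of j i] ij show ?thesis by (cases "i \<le> j") auto
  qed
  have "v = 0" if P: "restr v = v" and fixed: "rtrans g v - v = 0" for v
  proof (rule ell2_eqI)
    fix x
    show "coord v x = coord 0 x"
    proof (cases "x \<in> carrier G")
      case False
      then show ?thesis using P by (simp add: restr_eq_iff)
    next
      case x: True
      have step: "coord v (y \<otimes> g) = coord v y" if "y \<in> carrier G" for y
        using arg_cong[OF fixed, of "\<lambda>w. coord w y"] that by (simp add: coord_rtrans[OF g])
      have const: "coord v (x \<otimes> g [^] (k::nat)) = coord v x" for k
      proof (induction k)
        case (Suc k)
        have "x \<otimes> g [^] Suc k = (x \<otimes> g [^] k) \<otimes> g" using x g by (simp add: m_assoc)
        then show ?case using step[of "x \<otimes> g [^] k"] x g Suc by simp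
      qed (use x in simp)
      have bound: "real n * (cmod (coord v x))\<^sup>2 \<le> (norm v)\<^sup>2" for n
      proof -
        have inj': "inj_on (\<lambda>k::nat. x \<otimes> g [^] k) {..<n}" using x g inj by (auto intro!: inj_onI)
        have "real n * (cmod (coord v x))\<^sup>2 = (\<Sum>k<n. (cmod (coord v (x \<otimes> g [^] k)))\<^sup>2)"
          by (simp add: const)
        also have "\<dots> = (\<Sum>y\<in>(\<lambda>k. x \<otimes> g [^] k) ` {..<n}. (cmod (coord v y))\<^sup>2)"
          by (simp add: sum.reindex[OF inj'])
        also have "\<dots> \<le> (norm v)\<^sup>2" by (rule finite_sum_le_norm_ell2) simp
        finally show ?thesis .
      qed
      show ?thesis
      proof (rule ccontr)
        assume "coord v x \<noteq> coord 0 x"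
        then have "0 < (cmod (coord v x))\<^sup>2" by simp
        then obtain n :: nat where "(norm v)\<^sup>2 < real n * (cmod (coord v x))\<^sup>2"
          using reals_Archimedean3 by blast
        with bound[of n] show False by linarith
      qed
    qed
  qed
  then show ?thesis unfolding eq regular_def using mem by blast
qed

lemma vN_trace_zero: "vN_trace G \<zero>\<^bsub>N\<^esub> = 0"
proof -
  have "(\<lambda>x. if x = \<one> then 1 else 0) = coord (kron \<one> 1)" by (simp add: fun_eq_iff coord_kron)
  moreover have "coord (kron \<one> 1) \<in> l2 G" by (rule coord_mem_l2) (simp add: restr_eq_iff coord_kron)
  ultimately show ?thesis by (simp add: vN_trace_def group_vN_algebra_def)
qed

end

section \<open>Free modules and the bar complex\<close>

context ring
begin

abbreviation FM :: "'i set \<Rightarrow> ('a, 'i \<Rightarrow> 'a) module" where "FM I \<equiv> free_left_module R I"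

lemma free_module_simps [simp]:
  "x \<oplus>\<^bsub>FM I\<^esub> y = (\<lambda>i. x i \<oplus> y i)"
  "\<zero>\<^bsub>FM I\<^esub> = (\<lambda>i. \<zero>)"
  "r \<odot>\<^bsub>FM I\<^esub> x = (\<lambda>i. r \<otimes> x i)" by (simp_all add: free_left_module_def)

lemma free_module_carrier:
  "c \<in> carrier (FM I) \<longleftrightarrow> (\<forall>i. c i \<in> carrier R) \<and> {i. c i \<noteq> \<zero>} \<subseteq> I \<and> finite {i. c i \<noteq> \<zero>}"
  by (simp add: free_left_module_def)

lemma free_module_memI:
  assumes "\<And>i. c i \<in> carrier R" "\<And>i. i \<notin> F \<Longrightarrow> c i = \<zero>" "finite F" "F \<subseteq> I"
  shows "c \<in> carrier (FM I)"
proof -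
  have "{i. c i \<noteq> \<zero>} \<subseteq> F" using assms(2) by auto
  then show ?thesis
    unfolding free_module_carrier using assms(1,3,4) finite_subset by (metis order_trans)
qed

lemma free_module_pointwise_mem:
  assumes c: "c \<in> carrier (FM I)" and d: "d \<in> carrier (FM I)"
    and f: "\<And>a b. a \<in> carrier R \<Longrightarrow> b \<in> carrier R \<Longrightarrow> f a b \<in> carrier R" "f \<zero> \<zero> = \<zero>"
  shows "(\<lambda>i. f (c i) (d i)) \<in> carrier (FM I)"
proof (rule free_module_memI)
  show "f (c i) (d i) \<in> carrier R" for i
    using c d by (intro f) (simp_all add: free_module_carrier)
  show "f (c i) (d i) = \<zero>" if "i \<notin> {i. c i \<noteq> \<zero>} \<union> {i. d i \<noteq> \<zero>}" for i using that f(2) by simp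
  show "finite ({i. c i \<noteq> \<zero>} \<union> {i. d i \<noteq> \<zero>})" "{i. c i \<noteq> \<zero>} \<union> {i. d i \<noteq> \<zero>} \<subseteq> I"
    using c d by (auto simp: free_module_carrier)
qed

lemma free_module_abelian_group: "abelian_group (FM I)"
proof (rule abelian_groupI)
  fix c d e
  assume c: "c \<in> carrier (FM I)" and d: "d \<in> carrier (FM I)"
    and e: "e \<in> carrier (FM I)"
  show "c \<oplus>\<^bsub>FM I\<^esub> d \<in> carrier (FM I)"
    using free_module_pointwise_mem[OF c d, of "\<lambda>a b. a \<oplus> b"] by simp
  show "c \<oplus>\<^bsub>FM I\<^esub> d \<oplus>\<^bsub>FM I\<^esub> e = c \<oplus>\<^bsub>FM I\<^esub> (d \<oplus>\<^bsub>FM I\<^esub> e)"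
    using c d e by (simp add: free_module_carrier a_assoc)
  show "c \<oplus>\<^bsub>FM I\<^esub> d = d \<oplus>\<^bsub>FM I\<^esub> c" using c d by (simp add: free_module_carrier a_comm)
next
  show "\<zero>\<^bsub>FM I\<^esub> \<in> carrier (FM I)" by (simp add: free_module_carrier)
  fix c assume c: "c \<in> carrier (FM I)"
  then show "\<zero>\<^bsub>FM I\<^esub> \<oplus>\<^bsub>FM I\<^esub> c = c" by (simp add: free_module_carrier)
  have "(\<lambda>i. \<ominus> c i) \<in> carrier (FM I)"
    using free_module_pointwise_mem[OF c c, of "\<lambda>a b. \<ominus> a"] by simp
  moreover have "(\<lambda>i. \<ominus> c i) \<oplus>\<^bsub>FM I\<^esub> c = \<zero>\<^bsub>FM I\<^esub>" using c by (simp add: free_module_carrier l_neg)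
  ultimately show "\<exists>d\<in>carrier (FM I).
      d \<oplus>\<^bsub>FM I\<^esub> c = \<zero>\<^bsub>FM I\<^esub>" by (intro bexI[of _ "\<lambda>i. \<ominus> c i"])
qed

lemma free_module_smult_mem:
  assumes "r \<in> carrier R" "c \<in> carrier (FM I)"
  shows "(\<lambda>i. r \<otimes> c i) \<in> carrier (FM I)"
  using free_module_pointwise_mem[OF assms(2) assms(2), of "\<lambda>a b. r \<otimes> a"] assms(1) by simp

lemma single_mem: "i \<in> I \<Longrightarrow> a \<in> carrier R \<Longrightarrow> single R i a \<in> carrier (FM I)"
  by (rule free_module_memI[where F = "{i}"]) (auto simp: single_def)

lemma single_add:
  "a \<in> carrier R \<Longrightarrow> b \<in> carrier R \<Longrightarrow> single R i (a \<oplus> b) = single R i a \<oplus>\<^bsub>FM I\<^esub> single R i b"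
  by (auto simp: single_def)

lemma smult_single:
  "r \<in> carrier R \<Longrightarrow> r \<odot>\<^bsub>FM I\<^esub> single R i a = single R i (r \<otimes> a)" by (auto simp: single_def)

lemma single_zero: "single R i \<zero> = \<zero>\<^bsub>FM I\<^esub>" by (auto simp: single_def)

lemma free_module_induct [consumes 1, case_names zero add]:
  assumes "c \<in> carrier (FM I)"
    and "Q (\<lambda>i. \<zero>)"
    and "\<And>c i a. c \<in> carrier (FM I) \<Longrightarrow> i \<in> I \<Longrightarrow> a \<in> carrier R \<Longrightarrow> Q c \<Longrightarrow> Q (c \<oplus>\<^bsub>FM I\<^esub> single R i a)"
  shows "Q c"
proof -
  have gen: "Q c" if "finite F" "F \<subseteq> I" "\<And>i. c i \<in> carrier R" "\<And>i. i \<notin> F \<Longrightarrow> c i = \<zero>" for F c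
    using that
  proof (induction F arbitrary: c rule: finite_induct)
    case empty
    then have "c = (\<lambda>i. \<zero>)" by auto
    then show ?case using assms(2) by simp
  next
    case (insert j F)
    define d where "d = c(j := \<zero>)"
    have d0: "d i = \<zero>" if "i \<notin> F" for i using that insert.prems(3) by (auto simp: d_def)
    have dc: "d i \<in> carrier R" for i using insert.prems(2) by (simp add: d_def)
    have "Q d" using insert.prems(1) dc d0 by (intro insert.IH) auto
    moreover have "d \<in> carrier (FM I)"
      using insert.prems(1) insert.hyps(1) dc d0 by (intro free_module_memI[where F = F]) auto
    ultimately have "Q (d \<oplus>\<^bsub>FM I\<^esub> single R j (c j))"
      using insert.prems(1,2) by (intro assms(3)) auto
    also have "d \<oplus>\<^bsub>FM I\<^esub> single R j (c j) = c"
      using insert.prems(2) by (auto simp: d_def single_def)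
    finally show ?case .
  qed
  show ?thesis by (rule gen[of "{i. c i \<noteq> \<zero>}"]) (use assms(1) in \<open>auto simp: free_module_carrier\<close>)
qed

end

text \<open>One proof of linearity serves both boundary maps, each a sum over the support of the
  coefficients. The scalar action is a parameter because one target is the ring record of N(G)
  itself and the other a module record.\<close>

locale linear_extension = R: ring R + M: abelian_group M
  for R :: "('r, 'x) ring_scheme" and M :: "('m, 'y) ring_scheme" +
  fixes act :: "'r \<Rightarrow> 'm \<Rightarrow> 'm" and I :: "'i set" and f :: "'i \<Rightarrow> 'r \<Rightarrow> 'm"
  assumes act_closed: "r \<in> carrier R \<Longrightarrow> m \<in> carrier M \<Longrightarrow> act r m \<in> carrier M"
    and act_add: "r \<in> carrier R \<Longrightarrow> m \<in> carrier M \<Longrightarrow> m' \<in> carrier M \<Longrightarrow>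
      act r (m \<oplus>\<^bsub>M\<^esub> m') = act r m \<oplus>\<^bsub>M\<^esub> act r m'"
    and f_closed: "i \<in> I \<Longrightarrow> a \<in> carrier R \<Longrightarrow> f i a \<in> carrier M"
    and f_add: "i \<in> I \<Longrightarrow> a \<in> carrier R \<Longrightarrow> b \<in> carrier R \<Longrightarrow> f i (a \<oplus>\<^bsub>R\<^esub> b) = f i a \<oplus>\<^bsub>M\<^esub> f i b"
    and f_act: "i \<in> I \<Longrightarrow> r \<in> carrier R \<Longrightarrow> a \<in> carrier R \<Longrightarrow> f i (r \<otimes>\<^bsub>R\<^esub> a) = act r (f i a)"
begin

definition extend :: "('i \<Rightarrow> 'r) \<Rightarrow> 'm" where
  "extend c = (\<Oplus>\<^bsub>M\<^esub>i\<in>{i. c i \<noteq> \<zero>\<^bsub>R\<^esub>}. f i (c i))"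

abbreviation "F \<equiv> free_left_module R I"

lemma f_zero: "i \<in> I \<Longrightarrow> f i \<zero>\<^bsub>R\<^esub> = \<zero>\<^bsub>M\<^esub>" using f_add[of i "\<zero>\<^bsub>R\<^esub>" "\<zero>\<^bsub>R\<^esub>"] f_closed[of i "\<zero>\<^bsub>R\<^esub>"]
  by (metis M.add.r_cancel_one' R.r_zero R.zero_closed)

lemma act_zero:
  assumes r: "r \<in> carrier R"
  shows "act r \<zero>\<^bsub>M\<^esub> = \<zero>\<^bsub>M\<^esub>"
proof -
  have "act r \<zero>\<^bsub>M\<^esub> \<oplus>\<^bsub>M\<^esub> act r \<zero>\<^bsub>M\<^esub> = act r \<zero>\<^bsub>M\<^esub>" using act_add[OF r M.zero_closed M.zero_closed] by simp
  then show ?thesis using act_closed[OF r M.zero_closed] M.add.r_cancel_one by blast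
qed

text \<open>The support varies with the chain. Summing over a common finite set that contains the
  supports reduces additivity to single terms.\<close>

lemma extend_eq:
  assumes c: "\<And>i. c i \<in> carrier R" and "finite A" "A \<subseteq> I" "\<And>i. i \<notin> A \<Longrightarrow> c i = \<zero>\<^bsub>R\<^esub>"
  shows "extend c = (\<Oplus>\<^bsub>M\<^esub>i\<in>A. f i (c i))" unfolding extend_def
proof (rule M.add.finprod_mono_neutral_cong_left[OF assms(2)])
  show "{i. c i \<noteq> \<zero>\<^bsub>R\<^esub>} \<subseteq> A" using assms(4) by auto
  show "f i (c i) = \<zero>\<^bsub>M\<^esub>" if "i \<in> A - {i. c i \<noteq> \<zero>\<^bsub>R\<^esub>}" for i using that assms(3) f_zero[of i] by auto
  show "f i (c i) = f i (c i)" for i ..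
  show "(\<lambda>i. f i (c i)) \<in> A \<rightarrow> carrier M" using c assms(3) f_closed by auto
qed

lemma extend_closed: "c \<in> carrier F \<Longrightarrow> extend c \<in> carrier M"
  unfolding extend_def by (rule M.finsum_closed) (auto simp: R.free_module_carrier intro: f_closed)

lemma extend_add:
  assumes c: "c \<in> carrier F" and d: "d \<in> carrier F"
  shows "extend (c \<oplus>\<^bsub>F\<^esub> d) = extend c \<oplus>\<^bsub>M\<^esub> extend d"
proof -
  define A where "A = {i. c i \<noteq> \<zero>\<^bsub>R\<^esub>} \<union> {i. d i \<noteq> \<zero>\<^bsub>R\<^esub>}"
  have A: "finite A" "A \<subseteq> I" using c d by (auto simp: A_def R.free_module_carrier)
  have cd: "c i \<in> carrier R" "d i \<in> carrier R" for i using c d by (simp_all add: R.free_module_carrier)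
  have A0: "c i = \<zero>\<^bsub>R\<^esub>" "d i = \<zero>\<^bsub>R\<^esub>" if "i \<notin> A" for i using that by (auto simp: A_def)
  have "extend (c \<oplus>\<^bsub>F\<^esub> d) = (\<Oplus>\<^bsub>M\<^esub>i\<in>A. f i (c i \<oplus>\<^bsub>R\<^esub> d i))"
    using A cd A0 by (subst extend_eq[of _ A]) auto
  also have "\<dots> = (\<Oplus>\<^bsub>M\<^esub>i\<in>A. f i (c i) \<oplus>\<^bsub>M\<^esub> f i (d i))"
    using A cd by (intro M.finsum_cong') (auto intro!: f_add f_closed)
  also have "\<dots> = (\<Oplus>\<^bsub>M\<^esub>i\<in>A. f i (c i)) \<oplus>\<^bsub>M\<^esub> (\<Oplus>\<^bsub>M\<^esub>i\<in>A. f i (d i))"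
    using A cd by (intro M.finsum_addf) (auto intro!: f_closed)
  also have "\<dots> = extend c \<oplus>\<^bsub>M\<^esub> extend d"
    using A cd A0 by (simp add: extend_eq[of c A] extend_eq[of d A])
  finally show ?thesis .
qed

lemma extend_single:
  assumes "i \<in> I" "a \<in> carrier R"
  shows "extend (single R i a) = f i a"
proof -
  have "extend (single R i a) = (\<Oplus>\<^bsub>M\<^esub>j\<in>{i}. f j (single R i a j))"
    using assms by (intro extend_eq) (auto simp: single_def)
  also have "\<dots> = f i a" using assms f_closed[OF assms] by (simp add: single_def)
  finally show ?thesis .
qed

lemma extend_zero: "extend (\<lambda>i. \<zero>\<^bsub>R\<^esub>) = \<zero>\<^bsub>M\<^esub>" by (simp add: extend_def)

lemma extend_smult:
  assumes r: "r \<in> carrier R" and c: "c \<in> carrier F"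
  shows "extend (r \<odot>\<^bsub>F\<^esub> c) = act r (extend c)" using c
proof (induction rule: R.free_module_induct)
  case zero
  show ?case using r by (simp add: extend_zero act_zero)
next
  case (add c i a)
  interpret F: abelian_group F by (rule R.free_module_abelian_group)
  have cc: "c j \<in> carrier R" for j using add.hyps by (simp add: R.free_module_carrier)
  have "r \<odot>\<^bsub>F\<^esub> (c \<oplus>\<^bsub>F\<^esub> single R i a) = r \<odot>\<^bsub>F\<^esub> c \<oplus>\<^bsub>F\<^esub> r \<odot>\<^bsub>F\<^esub> single R i a"
    using r cc add.hyps by (auto simp: single_def R.r_distr)
  also have "\<dots> = r \<odot>\<^bsub>F\<^esub> c \<oplus>\<^bsub>F\<^esub> single R i (r \<otimes>\<^bsub>R\<^esub> a)" by (simp only: R.smult_single[OF r])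
  finally have "extend (r \<odot>\<^bsub>F\<^esub> (c \<oplus>\<^bsub>F\<^esub> single R i a)) =
    extend (r \<odot>\<^bsub>F\<^esub> c \<oplus>\<^bsub>F\<^esub> single R i (r \<otimes>\<^bsub>R\<^esub> a))" by (rule arg_cong)
  also have "\<dots> = extend (r \<odot>\<^bsub>F\<^esub> c) \<oplus>\<^bsub>M\<^esub> extend (single R i (r \<otimes>\<^bsub>R\<^esub> a))"
  proof (rule extend_add)
    show "r \<odot>\<^bsub>F\<^esub> c \<in> carrier F" using R.free_module_smult_mem[OF r add.hyps(1)] by simp
    show "single R i (r \<otimes>\<^bsub>R\<^esub> a) \<in> carrier F" using r add.hyps by (simp add: R.single_mem)
  qed
  also have "\<dots> = act r (extend c) \<oplus>\<^bsub>M\<^esub> act r (f i a)"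
    using r add.hyps by (simp only: add.IH extend_single f_act R.m_closed)
  also have "\<dots> = act r (extend c \<oplus>\<^bsub>M\<^esub> f i a)"
    by (rule act_add[OF r extend_closed[OF add.hyps(1)] f_closed[OF add.hyps(2,3)], symmetric])
  also have "\<dots> = act r (extend (c \<oplus>\<^bsub>F\<^esub> single R i a))"
    by (simp only: extend_add[OF add.hyps(1) R.single_mem[OF add.hyps(2,3)]]
        extend_single[OF add.hyps(2,3)])
  finally show ?case .
qed

end

text \<open>Tailored to the boundary xg[h] - x[gh] + x[g]: if the outer terms lie in a subgroup
  along with the boundary, so does the middle term.\<close>

lemma (in abelian_group) subgroup_middle_term:
  assumes H: "subgroup H (add_monoid G)" and sub: "H \<subseteq> carrier G"
    and "a \<in> H" "c \<in> H" "b \<in> carrier G" "a \<ominus> b \<oplus> c \<in> H"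
  shows "b \<in> H"
proof -
  have mem: "a \<in> carrier G" "c \<in> carrier G" using assms by auto
  have "(a \<oplus> c) \<ominus> (a \<ominus> b \<oplus> c) = b"
  proof -
    have "b \<oplus> (c \<oplus> \<ominus> b) = c" using mem \<open>b \<in> carrier G\<close> a_lcomm[of b c "\<ominus> b"] by (simp add: r_neg)
    then have "b \<oplus> (a \<ominus> b \<oplus> c) = a \<oplus> c" using mem \<open>b \<in> carrier G\<close> by (simp add: minus_eq a_ac)
    then have "(a \<oplus> c) \<ominus> (a \<ominus> b \<oplus> c) = b \<oplus> (a \<ominus> b \<oplus> c) \<ominus> (a \<ominus> b \<oplus> c)" by simp
    also have "\<dots> = b" using mem \<open>b \<in> carrier G\<close> by (simp add: minus_eq a_assoc r_neg del: minus_add)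
    finally show ?thesis .
  qed
  moreover have "(a \<oplus> c) \<ominus> (a \<ominus> b \<oplus> c) \<in> H"
    using assms subgroup.m_closed[OF H] subgroup.m_inv_closed[OF H]
    by (simp add: a_minus_def a_inv_def)
  ultimately show ?thesis by simp
qed

context ring
begin

lemma free_module_smult_add:
  assumes "r \<in> carrier R" "c \<in> carrier (FM I)" "d \<in> carrier (FM I)"
  shows "r \<odot>\<^bsub>FM I\<^esub> (c \<oplus>\<^bsub>FM I\<^esub> d) = r \<odot>\<^bsub>FM I\<^esub> c \<oplus>\<^bsub>FM I\<^esub> r \<odot>\<^bsub>FM I\<^esub> d"
  using assms by (simp add: free_module_carrier r_distr)

lemma free_module_smult_smult:
  assumes "r \<in> carrier R" "s \<in> carrier R" "c \<in> carrier (FM I)"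
  shows "r \<odot>\<^bsub>FM I\<^esub> (s \<odot>\<^bsub>FM I\<^esub> c) = (r \<otimes> s) \<odot>\<^bsub>FM I\<^esub> c"
  using assms by (simp add: free_module_carrier m_assoc)

lemma free_module_smult_one:
  assumes "c \<in> carrier (FM I)"
  shows "\<one> \<odot>\<^bsub>FM I\<^esub> c = c" using assms by (simp add: free_module_carrier)

lemma free_module_smult_closed:
  assumes "r \<in> carrier R" "c \<in> carrier (FM I)"
  shows "r \<odot>\<^bsub>FM I\<^esub> c \<in> carrier (FM I)" using free_module_smult_mem[OF assms] by simp

lemma free_module_smult_distrib:
  assumes "r \<in> carrier R" "s \<in> carrier R" "c \<in> carrier (FM I)"
  shows "(r \<oplus> s) \<odot>\<^bsub>FM I\<^esub> c = r \<odot>\<^bsub>FM I\<^esub> c \<oplus>\<^bsub>FM I\<^esub> s \<odot>\<^bsub>FM I\<^esub> c"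
  using assms by (simp add: free_module_carrier l_distr)

lemma free_module_neg:
  assumes c: "c \<in> carrier (FM I)"
  shows "\<ominus>\<^bsub>FM I\<^esub> c = (\<ominus> \<one>) \<odot>\<^bsub>FM I\<^esub> c"
proof -
  interpret F: abelian_group "FM I" by (rule free_module_abelian_group)
  have "(\<ominus> \<one>) \<odot>\<^bsub>FM I\<^esub> c \<oplus>\<^bsub>FM I\<^esub> c = \<zero>\<^bsub>FM I\<^esub>" using c by (simp add: free_module_carrier l_minus l_neg)
  then show ?thesis by (rule F.minus_equality) (simp_all only: c free_module_smult_closed a_inv_closed one_closed)
qed

lemma free_module_minus_smult:
  assumes "r \<in> carrier R" "c \<in> carrier (FM I)"
  shows "r \<odot>\<^bsub>FM I\<^esub> (\<ominus>\<^bsub>FM I\<^esub> c) = \<ominus>\<^bsub>FM I\<^esub> (r \<odot>\<^bsub>FM I\<^esub> c)" using assms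
  by (simp only: free_module_neg free_module_smult_smult free_module_smult_closed
      a_inv_closed one_closed r_minus l_minus r_one l_one)

end

section \<open>The bar complex in degrees at most 2\<close>

context group
begin

interpretation N: ring N by (rule ring_N)

declare N.free_module_simps [simp del]

abbreviation C1 where "C1 \<equiv> free_left_module N (carrier G)"
abbreviation C2 where "C2 \<equiv> free_left_module N (carrier G \<times> carrier G)"

interpretation C1: abelian_group C1 by (rule N.free_module_abelian_group)

definition bd2 where
  "bd2 p x = single N (snd p) (x \<otimes>\<^bsub>N\<^esub> right_translation G (fst p))
    \<ominus>\<^bsub>C1\<^esub> single N (fst p \<otimes> snd p) x \<oplus>\<^bsub>C1\<^esub> single N (fst p) x"

definition bd1 where "bd1 g x = x \<otimes>\<^bsub>N\<^esub> right_translation G g \<ominus>\<^bsub>N\<^esub> x"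

lemma linear_extension_bd1: "linear_extension N N (\<lambda>r m. r \<otimes>\<^bsub>N\<^esub> m) (carrier G) bd1"
proof unfold_locales
  fix g a b assume g: "g \<in> carrier G" and a: "a \<in> carrier N" and b: "b \<in> carrier N"
  note R = right_translation_mem[OF g]
  show "bd1 g a \<in> carrier N" using a R by (simp add: bd1_def)
  show "bd1 g (a \<oplus>\<^bsub>N\<^esub> b) = bd1 g a \<oplus>\<^bsub>N\<^esub> bd1 g b"
    using a b R by (simp add: bd1_def N.l_distr N.minus_eq N.minus_add N.a_ac)
  show "bd1 g (a \<otimes>\<^bsub>N\<^esub> b) = a \<otimes>\<^bsub>N\<^esub> bd1 g b"
    using a b R by (simp add: bd1_def N.minus_eq N.r_distr N.r_minus N.m_assoc)
qed (simp_all add: N.r_distr)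

lemma single_C1: "g \<in> carrier G \<Longrightarrow> x \<in> carrier N \<Longrightarrow> single N g x \<in> carrier C1"
  by (rule N.single_mem)

lemma bd2_mem:
  assumes "g \<in> carrier G" "h \<in> carrier G" "x \<in> carrier N"
  shows "bd2 (g, h) x \<in> carrier C1"
  using assms by (simp add: bd2_def single_C1 right_translation_mem)

lemma linear_extension_bd2:
  "linear_extension N C1 (\<lambda>r c. r \<odot>\<^bsub>C1\<^esub> c) (carrier G \<times> carrier G) bd2"
proof unfold_locales
  fix r c d assume r: "r \<in> carrier N" and c: "c \<in> carrier C1" and d: "d \<in> carrier C1"
  show "r \<odot>\<^bsub>C1\<^esub> c \<in> carrier C1" by (rule N.free_module_smult_closed[OF r c])
  show "r \<odot>\<^bsub>C1\<^esub> (c \<oplus>\<^bsub>C1\<^esub> d) = r \<odot>\<^bsub>C1\<^esub> c \<oplus>\<^bsub>C1\<^esub> r \<odot>\<^bsub>C1\<^esub> d" by (rule N.free_module_smult_add[OF r c d])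
next
  fix p a b assume p: "p \<in> carrier G \<times> carrier G" and a: "a \<in> carrier N" and b: "b \<in> carrier N"
  then have gh: "fst p \<in> carrier G" "snd p \<in> carrier G" by auto
  note R = right_translation_mem[OF gh(1)]
  show "bd2 p a \<in> carrier C1" using bd2_mem[OF gh a] by simp
  note mem = a b R gh single_C1
  show "bd2 p (a \<oplus>\<^bsub>N\<^esub> b) = bd2 p a \<oplus>\<^bsub>C1\<^esub> bd2 p b"
    by (simp add: mem bd2_def N.l_distr N.single_add[where I = "carrier G"] C1.minus_eq
        C1.minus_add C1.a_ac)
  show "bd2 p (a \<otimes>\<^bsub>N\<^esub> b) = a \<odot>\<^bsub>C1\<^esub> bd2 p b"
    by (simp add: mem bd2_def N.m_assoc N.smult_single[where I = "carrier G", symmetric] C1.minus_eq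
        N.free_module_smult_add N.free_module_minus_smult N.free_module_smult_closed)
qed

interpretation B1: linear_extension N N "\<lambda>r m. r \<otimes>\<^bsub>N\<^esub> m" "carrier G" bd1
  by (rule linear_extension_bd1)

interpretation B2: linear_extension N C1 "\<lambda>r c. r \<odot>\<^bsub>C1\<^esub> c" "carrier G \<times> carrier G" bd2
  by (rule linear_extension_bd2)

lemma boundary1_eq: "bar_boundary1 G = B1.extend"
  by (rule ext) (simp add: bar_boundary1_def B1.extend_def bd1_def Let_def)

lemma boundary2_eq: "bar_boundary2 G = B2.extend"
  by (rule ext) (simp add: bar_boundary2_def B2.extend_def bd2_def bar_chains1_def split_beta Let_def)

lemma B1_minus:
  assumes c: "c \<in> carrier C1" and d: "d \<in> carrier C1"
  shows "B1.extend (c \<ominus>\<^bsub>C1\<^esub> d) = B1.extend c \<ominus>\<^bsub>N\<^esub> B1.extend d"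
proof -
  have "B1.extend (\<ominus>\<^bsub>C1\<^esub> d) = \<ominus>\<^bsub>N\<^esub> B1.extend d" using B1.extend_closed[OF d] d
    by (simp add: N.free_module_neg B1.extend_smult N.l_minus)
  then show ?thesis using c d by (simp add: C1.minus_eq N.minus_eq B1.extend_add)
qed

text \<open>On a generator six terms remain, and they cancel in pairs because
  \<open>right_translation\<close> is multiplicative.\<close>

lemma boundary_boundary:
  assumes "c \<in> carrier C2"
  shows "B1.extend (B2.extend c) = \<zero>\<^bsub>N\<^esub>" using assms
proof (induction rule: N.free_module_induct)
  case zero
  show ?case by (simp add: B2.extend_zero B1.extend_zero N.free_module_simps)
next
  case (add c p a)
  obtain g h where p: "p = (g, h)" and gh: "g \<in> carrier G" "h \<in> carrier G" using add.hyps(2) by auto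
  note mem = gh add.hyps(3) right_translation_mem[OF gh(1)] right_translation_mem[OF gh(2)]
  have "B1.extend (bd2 p a) = bd1 h (a \<otimes>\<^bsub>N\<^esub> right_translation G g) \<ominus>\<^bsub>N\<^esub> bd1 (g \<otimes> h) a \<oplus>\<^bsub>N\<^esub> bd1 g a"
    by (simp add: p bd2_def mem B1.extend_add B1_minus B1.extend_single single_C1)
  also have "\<dots> = \<zero>\<^bsub>N\<^esub>"
    by (simp add: bd1_def mem right_translation_mult N.m_assoc[symmetric] N.minus_eq N.minus_add
        N.a_ac N.r_neg N.r_neg1 N.r_neg2)
  finally have "B1.extend (bd2 p a) = \<zero>\<^bsub>N\<^esub>" .
  then show ?case using add bd2_mem[OF gh add.hyps(3)] B2.extend_closed[OF add.hyps(1)]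
    by (simp add: B2.extend_add B2.extend_single N.single_mem B1.extend_add p)
qed

definition boundaries where "boundaries = bar_boundary2 G ` carrier C2"

lemma boundaries_mem: "b \<in> boundaries \<Longrightarrow> b \<in> carrier C1"
  by (auto simp: boundaries_def boundary2_eq B2.extend_closed)

interpretation C2: abelian_group C2 by (rule N.free_module_abelian_group)

lemma boundaries_add: "b \<in> boundaries \<Longrightarrow> b' \<in> boundaries \<Longrightarrow> b \<oplus>\<^bsub>C1\<^esub> b' \<in> boundaries"
  unfolding boundaries_def boundary2_eq by (auto simp: B2.extend_add[symmetric])

lemma boundaries_smult: "r \<in> carrier N \<Longrightarrow> b \<in> boundaries \<Longrightarrow> r \<odot>\<^bsub>C1\<^esub> b \<in> boundaries"
  unfolding boundaries_def boundary2_eq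
  by (auto simp: B2.extend_smult[symmetric] N.free_module_smult_closed)

lemma boundaries_zero: "\<zero>\<^bsub>C1\<^esub> \<in> boundaries"
proof -
  have "B2.extend \<zero>\<^bsub>C2\<^esub> = \<zero>\<^bsub>C1\<^esub>" by (simp only: N.free_module_simps(2)[of "carrier G \<times> carrier G"] B2.extend_zero)
  then show ?thesis unfolding boundaries_def boundary2_eq using C2.zero_closed by (metis imageI)
qed

lemma bd2_boundary:
  assumes "g \<in> carrier G" "h \<in> carrier G" "x \<in> carrier N"
  shows "bd2 (g, h) x \<in> boundaries"
proof -
  have "B2.extend (single N (g, h) x) = bd2 (g, h) x" using assms by (intro B2.extend_single) auto
  moreover have "single N (g, h) x \<in> carrier C2" using assms by (intro N.single_mem) auto
  ultimately show ?thesis unfolding boundaries_def boundary2_eq by (metis imageI)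
qed

text \<open>
  The chains that become multiples of \<open>[t]\<close> modulo boundaries after inverting the regular elements;
  by the Ore condition they form a submodule.
\<close>

definition reducible where
  "reducible t = {q \<in> carrier C1. \<exists>r\<in>regular. \<exists>y\<in>carrier N. \<exists>b\<in>boundaries.
     r \<odot>\<^bsub>C1\<^esub> q = single N t y \<oplus>\<^bsub>C1\<^esub> b}"

section \<open>Chains and group elements reducible to [t]\<close>

context
  fixes t assumes t: "t \<in> carrier G"
begin

lemma reducibleI:
  assumes "q \<in> carrier C1" "r \<in> regular" "y \<in> carrier N" "b \<in> boundaries"
    "r \<odot>\<^bsub>C1\<^esub> q = single N t y \<oplus>\<^bsub>C1\<^esub> b"
  shows "q \<in> reducible t" using assms unfolding reducible_def by blast

lemma reducibleE:
  assumes "q \<in> reducible t"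
  obtains r y b where "q \<in> carrier C1" "r \<in> regular" "y \<in> carrier N" "b \<in> boundaries"
    "r \<odot>\<^bsub>C1\<^esub> q = single N t y \<oplus>\<^bsub>C1\<^esub> b" using assms unfolding reducible_def by blast

lemma smult_single_add:
  assumes "r \<in> carrier N" "y \<in> carrier N" "b \<in> boundaries"
  shows "r \<odot>\<^bsub>C1\<^esub> (single N t y \<oplus>\<^bsub>C1\<^esub> b) = single N t (r \<otimes>\<^bsub>N\<^esub> y) \<oplus>\<^bsub>C1\<^esub> r \<odot>\<^bsub>C1\<^esub> b"
  by (simp only: N.free_module_smult_add[OF assms(1) single_C1[OF t assms(2)] boundaries_mem[OF assms(3)]]
      N.smult_single[OF assms(1)])

text \<open>The Ore condition provides a common left multiple r r1 = x r2 of the two denominators,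
  so both relations can be brought to it and added.\<close>

lemma reducible_add:
  assumes "p \<in> reducible t" "q \<in> reducible t"
  shows "p \<oplus>\<^bsub>C1\<^esub> q \<in> reducible t"
proof -
  obtain r1 y1 b1 where 1: "p \<in> carrier C1" "r1 \<in> regular" "y1 \<in> carrier N" "b1 \<in> boundaries"
    "r1 \<odot>\<^bsub>C1\<^esub> p = single N t y1 \<oplus>\<^bsub>C1\<^esub> b1" by (rule reducibleE[OF assms(1)])
  obtain r2 y2 b2 where 2: "q \<in> carrier C1" "r2 \<in> regular" "y2 \<in> carrier N" "b2 \<in> boundaries"
    "r2 \<odot>\<^bsub>C1\<^esub> q = single N t y2 \<oplus>\<^bsub>C1\<^esub> b2" by (rule reducibleE[OF assms(2)])
  obtain r x where rx: "r \<in> regular" "x \<in> carrier N" "r \<otimes>\<^bsub>N\<^esub> r1 = x \<otimes>\<^bsub>N\<^esub> r2"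
    by (rule regular_ore[OF regular_closed[OF 1(2)] 2(2)])
  note mem = regular_closed[OF rx(1)] regular_closed[OF 1(2)] regular_closed[OF 2(2)]
  have "(r \<otimes>\<^bsub>N\<^esub> r1) \<odot>\<^bsub>C1\<^esub> p = r \<odot>\<^bsub>C1\<^esub> (r1 \<odot>\<^bsub>C1\<^esub> p)"
    by (rule N.free_module_smult_smult[OF mem(1,2) 1(1), symmetric])
  then have p: "(r \<otimes>\<^bsub>N\<^esub> r1) \<odot>\<^bsub>C1\<^esub> p = single N t (r \<otimes>\<^bsub>N\<^esub> y1) \<oplus>\<^bsub>C1\<^esub> r \<odot>\<^bsub>C1\<^esub> b1"
    by (simp only: 1(5) smult_single_add[OF mem(1) 1(3,4)])
  have "(x \<otimes>\<^bsub>N\<^esub> r2) \<odot>\<^bsub>C1\<^esub> q = x \<odot>\<^bsub>C1\<^esub> (r2 \<odot>\<^bsub>C1\<^esub> q)"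
    by (rule N.free_module_smult_smult[OF rx(2) mem(3) 2(1), symmetric])
  then have q: "(r \<otimes>\<^bsub>N\<^esub> r1) \<odot>\<^bsub>C1\<^esub> q = single N t (x \<otimes>\<^bsub>N\<^esub> y2) \<oplus>\<^bsub>C1\<^esub> x \<odot>\<^bsub>C1\<^esub> b2"
    by (simp only: rx(3) 2(5) smult_single_add[OF rx(2) 2(3,4)])
  note bm = boundaries_smult[OF mem(1) 1(4)] boundaries_smult[OF rx(2) 2(4)]
  show ?thesis
  proof (rule reducibleI)
    show "p \<oplus>\<^bsub>C1\<^esub> q \<in> carrier C1" using 1(1) 2(1) by simp
    show "r \<otimes>\<^bsub>N\<^esub> r1 \<in> regular" by (rule regular_mult[OF rx(1) 1(2)])
    show "r \<otimes>\<^bsub>N\<^esub> y1 \<oplus>\<^bsub>N\<^esub> x \<otimes>\<^bsub>N\<^esub> y2 \<in> carrier N" using mem rx(2) 1(3) 2(3) by simp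
    show "r \<odot>\<^bsub>C1\<^esub> b1 \<oplus>\<^bsub>C1\<^esub> x \<odot>\<^bsub>C1\<^esub> b2 \<in> boundaries" by (rule boundaries_add[OF bm])
    show "(r \<otimes>\<^bsub>N\<^esub> r1) \<odot>\<^bsub>C1\<^esub> (p \<oplus>\<^bsub>C1\<^esub> q) = single N t (r \<otimes>\<^bsub>N\<^esub> y1 \<oplus>\<^bsub>N\<^esub> x \<otimes>\<^bsub>N\<^esub> y2) \<oplus>\<^bsub>C1\<^esub> (r \<odot>\<^bsub>C1\<^esub> b1 \<oplus>\<^bsub>C1\<^esub> x \<odot>\<^bsub>C1\<^esub> b2)"
      using mem rx(2) 1(1,3) 2(1,3) bm[THEN boundaries_mem] t
      by (simp add: N.free_module_smult_add p q N.single_add[where I = "carrier G"] C1.a_ac single_C1)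
  qed
qed

text \<open>The denominator r must be moved past the scalar x: with s x = z r, the chain s (x q)
  equals z (r q).\<close>

lemma reducible_smult:
  assumes x: "x \<in> carrier N" and q: "q \<in> reducible t"
  shows "x \<odot>\<^bsub>C1\<^esub> q \<in> reducible t"
proof -
  obtain r y b where r: "q \<in> carrier C1" "r \<in> regular" "y \<in> carrier N" "b \<in> boundaries"
    "r \<odot>\<^bsub>C1\<^esub> q = single N t y \<oplus>\<^bsub>C1\<^esub> b" by (rule reducibleE[OF q])
  obtain s z where sz: "s \<in> regular" "z \<in> carrier N" "s \<otimes>\<^bsub>N\<^esub> x = z \<otimes>\<^bsub>N\<^esub> r"
    by (rule regular_ore[OF x r(2)])
  show ?thesis
  proof (rule reducibleI)
    show "x \<odot>\<^bsub>C1\<^esub> q \<in> carrier C1" by (rule N.free_module_smult_closed[OF x r(1)])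
    show "s \<in> regular" by (rule sz(1))
    show "z \<otimes>\<^bsub>N\<^esub> y \<in> carrier N" using sz(2) r(3) by simp
    show "z \<odot>\<^bsub>C1\<^esub> b \<in> boundaries" by (rule boundaries_smult[OF sz(2) r(4)])
    have "s \<odot>\<^bsub>C1\<^esub> (x \<odot>\<^bsub>C1\<^esub> q) = (z \<otimes>\<^bsub>N\<^esub> r) \<odot>\<^bsub>C1\<^esub> q"
      by (simp only: N.free_module_smult_smult[OF regular_closed[OF sz(1)] x r(1)] sz(3))
    also have "\<dots> = z \<odot>\<^bsub>C1\<^esub> (single N t y \<oplus>\<^bsub>C1\<^esub> b)"
      by (simp only: N.free_module_smult_smult[OF sz(2) regular_closed[OF r(2)] r(1), symmetric] r(5))
    finally show "s \<odot>\<^bsub>C1\<^esub> (x \<odot>\<^bsub>C1\<^esub> q) = single N t (z \<otimes>\<^bsub>N\<^esub> y) \<oplus>\<^bsub>C1\<^esub> z \<odot>\<^bsub>C1\<^esub> b"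
      by (simp only: smult_single_add[OF sz(2) r(3,4)])
  qed
qed

lemma reducible_saturated:
  assumes s: "s \<in> regular" and q: "q \<in> carrier C1" and sq: "s \<odot>\<^bsub>C1\<^esub> q \<in> reducible t"
  shows "q \<in> reducible t"
proof -
  obtain r y b where r: "r \<in> regular" "y \<in> carrier N" "b \<in> boundaries"
    "r \<odot>\<^bsub>C1\<^esub> (s \<odot>\<^bsub>C1\<^esub> q) = single N t y \<oplus>\<^bsub>C1\<^esub> b" by (rule reducibleE[OF sq])
  have "(r \<otimes>\<^bsub>N\<^esub> s) \<odot>\<^bsub>C1\<^esub> q = single N t y \<oplus>\<^bsub>C1\<^esub> b"
    by (simp only: N.free_module_smult_smult[OF regular_closed[OF r(1)] regular_closed[OF s] q, symmetric] r(4))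
  then show ?thesis by (rule reducibleI[OF q regular_mult[OF r(1) s] r(2,3)])
qed

lemma reducible_boundary:
  assumes b: "b \<in> boundaries"
  shows "b \<in> reducible t"
proof (rule reducibleI[OF boundaries_mem[OF b] regular_one N.zero_closed b])
  show "\<one>\<^bsub>N\<^esub> \<odot>\<^bsub>C1\<^esub> b = single N t \<zero>\<^bsub>N\<^esub> \<oplus>\<^bsub>C1\<^esub> b"
    using boundaries_mem[OF b] by (simp add: N.free_module_smult_one N.single_zero[where I = "carrier G"])
qed

lemma reducible_base: "single N t \<one>\<^bsub>N\<^esub> \<in> reducible t"
  by (rule reducibleI[OF single_C1[OF t N.one_closed] regular_one N.one_closed boundaries_zero])
    (simp add: N.free_module_smult_one single_C1 t)

lemma reducible_subgroup: "subgroup (reducible t) (add_monoid C1)"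
proof (rule C1.add.subgroupI)
  show "reducible t \<subseteq> carrier C1" by (auto simp: reducible_def)
  show "reducible t \<noteq> {}" using reducible_base by auto
  show "\<ominus>\<^bsub>C1\<^esub> a \<in> reducible t" if a: "a \<in> reducible t" for a
  proof -
    have "a \<in> carrier C1" using a by (simp add: reducible_def)
    then have "\<ominus>\<^bsub>C1\<^esub> a = (\<ominus>\<^bsub>N\<^esub> \<one>\<^bsub>N\<^esub>) \<odot>\<^bsub>C1\<^esub> a" by (rule N.free_module_neg)
    then show ?thesis using reducible_smult[OF _ a, of "\<ominus>\<^bsub>N\<^esub> \<one>\<^bsub>N\<^esub>"] by simp
  qed
  show "a \<oplus>\<^bsub>C1\<^esub> b \<in> reducible t" if "a \<in> reducible t" "b \<in> reducible t" for a b
    by (rule reducible_add[OF that])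
qed

lemmas reducible_middle = C1.subgroup_middle_term[OF reducible_subgroup]

lemma reducible_minus: "p \<in> reducible t \<Longrightarrow> q \<in> reducible t \<Longrightarrow> p \<ominus>\<^bsub>C1\<^esub> q \<in> reducible t"
  using subgroup.m_closed[OF reducible_subgroup] subgroup.m_inv_closed[OF reducible_subgroup]
  by (simp add: a_minus_def a_inv_def)

text \<open>This is the subgroup that takes the place of S in
  \<open>first_l2_betti_eq_zero\<close>.\<close>

definition reducible_elements where
  "reducible_elements = {g \<in> carrier G. single N g \<one>\<^bsub>N\<^esub> \<in> reducible t}"

lemma reducible_single:
  assumes "g \<in> reducible_elements" "x \<in> carrier N"
  shows "single N g x \<in> reducible t" using reducible_smult[OF assms(2), of "single N g \<one>\<^bsub>N\<^esub>"] assms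
  by (simp add: reducible_elements_def N.smult_single)

lemma bd2_one:
  "g \<in> carrier G \<Longrightarrow> bd2 (g, h) \<one>\<^bsub>N\<^esub> = single N h (right_translation G g)
    \<ominus>\<^bsub>C1\<^esub> single N (g \<otimes> h) \<one>\<^bsub>N\<^esub> \<oplus>\<^bsub>C1\<^esub> single N g \<one>\<^bsub>N\<^esub>" by (simp add: bd2_def right_translation_mem)

lemma bd2_reducible:
  assumes "g \<in> carrier G" "h \<in> carrier G"
  shows "single N h (right_translation G g)
    \<ominus>\<^bsub>C1\<^esub> single N (g \<otimes> h) \<one>\<^bsub>N\<^esub> \<oplus>\<^bsub>C1\<^esub> single N g \<one>\<^bsub>N\<^esub> \<in> reducible t"
  using reducible_boundary[OF bd2_boundary[OF assms N.one_closed]] assms by (simp add: bd2_one)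

lemma reducible_sub: "reducible t \<subseteq> carrier C1" by (auto simp: reducible_def)

lemma reducible_elements_mult:
  assumes g: "g \<in> reducible_elements" and h: "h \<in> reducible_elements"
  shows "g \<otimes> h \<in> reducible_elements"
proof -
  have gh: "g \<in> carrier G" "h \<in> carrier G" using g h by (simp_all add: reducible_elements_def)
  have "single N (g \<otimes> h) \<one>\<^bsub>N\<^esub> \<in> reducible t"
  proof (rule reducible_middle[OF reducible_sub])
    show "single N h (right_translation G g) \<in> reducible t"
      by (rule reducible_single[OF h right_translation_mem[OF gh(1)]])
    show "single N g \<one>\<^bsub>N\<^esub> \<in> reducible t" by (rule reducible_single[OF g N.one_closed])
    show "single N (g \<otimes> h) \<one>\<^bsub>N\<^esub> \<in> carrier C1" using gh by (simp add: single_C1)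
    show "single N h (right_translation G g) \<ominus>\<^bsub>C1\<^esub> single N (g \<otimes> h) \<one>\<^bsub>N\<^esub> \<oplus>\<^bsub>C1\<^esub> single N g \<one>\<^bsub>N\<^esub> \<in> reducible t"
      by (rule bd2_reducible[OF gh])
  qed
  then show ?thesis using gh by (simp add: reducible_elements_def)
qed

text \<open>The boundary of [1|1] is [1] itself.\<close>

lemma reducible_elements_one: "\<one> \<in> reducible_elements"
proof -
  have s: "single N \<one> \<one>\<^bsub>N\<^esub> \<in> carrier C1" by (simp add: single_C1)
  then have "single N \<one> \<one>\<^bsub>N\<^esub> \<ominus>\<^bsub>C1\<^esub> single N \<one> \<one>\<^bsub>N\<^esub> \<oplus>\<^bsub>C1\<^esub> single N \<one> \<one>\<^bsub>N\<^esub> = single N \<one> \<one>\<^bsub>N\<^esub>"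
    by (simp add: C1.minus_eq C1.r_neg)
  then show ?thesis using bd2_reducible[OF one_closed one_closed]
    by (simp add: right_translation_one reducible_elements_def)
qed

text \<open>The first two terms in the boundary of [inv g|g] are multiples of [g] and of [1], hence
  reducible; the remaining term is [inv g].\<close>

lemma reducible_elements_inv:
  assumes g: "g \<in> reducible_elements"
  shows "inv g \<in> reducible_elements"
proof -
  have gc: "g \<in> carrier G" using g by (simp add: reducible_elements_def)
  define p where "p = single N g (right_translation G (inv g))"
  define q where "q = single N \<one> \<one>\<^bsub>N\<^esub>"
  define s where "s = single N (inv g) \<one>\<^bsub>N\<^esub>"
  have p: "p \<in> reducible t" unfolding p_def
    using g gc by (intro reducible_single right_translation_mem) auto
  have q: "q \<in> reducible t" unfolding q_def
    by (rule reducible_single[OF reducible_elements_one N.one_closed])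
  have pqs: "p \<ominus>\<^bsub>C1\<^esub> q \<oplus>\<^bsub>C1\<^esub> s \<in> reducible t"
    using bd2_reducible[OF inv_closed[OF gc] gc] gc by (simp add: p_def q_def s_def)
  have mem: "p \<in> carrier C1" "q \<in> carrier C1" "s \<in> carrier C1"
    using p q reducible_sub gc by (auto simp: s_def single_C1)
  have "(p \<ominus>\<^bsub>C1\<^esub> q \<oplus>\<^bsub>C1\<^esub> s) \<ominus>\<^bsub>C1\<^esub> (p \<ominus>\<^bsub>C1\<^esub> q) = s"
    using mem C1.a_comm[of "p \<ominus>\<^bsub>C1\<^esub> q" s] by (simp add: C1.minus_eq[of _ "p \<ominus>\<^bsub>C1\<^esub> q"] C1.a_assoc C1.r_neg)
  then have "s \<in> reducible t" using reducible_minus[OF pqs reducible_minus[OF p q]] by simp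
  then show ?thesis using gc by (simp add: s_def reducible_elements_def)
qed

text \<open>The boundaries of [h|g] and [g|k] share the term [hg] = [gk], which their difference
  eliminates. The factor h - 1 left in front of [g] is removed by
  \<open>reducible_saturated\<close>.\<close>

lemma reducible_elements_conj:
  assumes g: "g \<in> carrier G" and h: "h \<in> reducible_elements" and k: "k \<in> reducible_elements"
    and reg: "right_translation G h \<ominus>\<^bsub>N\<^esub> \<one>\<^bsub>N\<^esub> \<in> regular" and eq: "h \<otimes> g = g \<otimes> k"
  shows "g \<in> reducible_elements"
proof -
  have hk: "h \<in> carrier G" "k \<in> carrier G" using h k by (simp_all add: reducible_elements_def)
  define a where "a = single N g (right_translation G h)"
  define b where "b = single N (g \<otimes> k) \<one>\<^bsub>N\<^esub>"
  define c where "c = single N h \<one>\<^bsub>N\<^esub>"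
  define d where "d = single N k (right_translation G g)"
  define e where "e = single N g \<one>\<^bsub>N\<^esub>"
  have mem: "a \<in> carrier C1" "b \<in> carrier C1" "c \<in> carrier C1" "d \<in> carrier C1" "e \<in> carrier C1"
    using g hk by (simp_all add: a_def b_def c_def d_def e_def single_C1 right_translation_mem)
  have c: "c \<in> reducible t" and d: "d \<in> reducible t"
    unfolding c_def d_def using h k g by (auto intro!: reducible_single right_translation_mem)
  have 1: "a \<ominus>\<^bsub>C1\<^esub> b \<oplus>\<^bsub>C1\<^esub> c \<in> reducible t"
    using bd2_reducible[OF hk(1) g] by (simp add: a_def b_def c_def eq)
  have 2: "d \<ominus>\<^bsub>C1\<^esub> b \<oplus>\<^bsub>C1\<^esub> e \<in> reducible t"
    using bd2_reducible[OF g hk(2)] by (simp add: d_def b_def e_def)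
  have cancel: "b \<oplus>\<^bsub>C1\<^esub> (c \<oplus>\<^bsub>C1\<^esub> (\<ominus>\<^bsub>C1\<^esub> b \<oplus>\<^bsub>C1\<^esub> z)) = c \<oplus>\<^bsub>C1\<^esub> z" if "z \<in> carrier C1" for z
    using mem that C1.a_lcomm[of b c "\<ominus>\<^bsub>C1\<^esub> b \<oplus>\<^bsub>C1\<^esub> z"] by (simp add: C1.r_neg1 C1.r_neg2)
  have "(a \<ominus>\<^bsub>C1\<^esub> e) \<oplus>\<^bsub>C1\<^esub> (c \<ominus>\<^bsub>C1\<^esub> d) = (a \<ominus>\<^bsub>C1\<^esub> b \<oplus>\<^bsub>C1\<^esub> c) \<ominus>\<^bsub>C1\<^esub> (d \<ominus>\<^bsub>C1\<^esub> b \<oplus>\<^bsub>C1\<^esub> e)"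
    using mem by (simp add: C1.minus_eq C1.minus_add C1.a_ac cancel)
  then have "(a \<ominus>\<^bsub>C1\<^esub> e) \<oplus>\<^bsub>C1\<^esub> (c \<ominus>\<^bsub>C1\<^esub> d) \<in> reducible t" using reducible_minus[OF 1 2] by simp
  then have "((a \<ominus>\<^bsub>C1\<^esub> e) \<oplus>\<^bsub>C1\<^esub> (c \<ominus>\<^bsub>C1\<^esub> d)) \<ominus>\<^bsub>C1\<^esub> (c \<ominus>\<^bsub>C1\<^esub> d) \<in> reducible t"
    by (rule reducible_minus[OF _ reducible_minus[OF c d]])
  moreover have "((a \<ominus>\<^bsub>C1\<^esub> e) \<oplus>\<^bsub>C1\<^esub> (c \<ominus>\<^bsub>C1\<^esub> d)) \<ominus>\<^bsub>C1\<^esub> (c \<ominus>\<^bsub>C1\<^esub> d) = a \<ominus>\<^bsub>C1\<^esub> e"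
    using mem by (simp add: C1.minus_eq[of _ "c \<ominus>\<^bsub>C1\<^esub> d"] C1.a_assoc C1.r_neg)
  ultimately have ae: "a \<ominus>\<^bsub>C1\<^esub> e \<in> reducible t" by simp
  have "(right_translation G h \<ominus>\<^bsub>N\<^esub> \<one>\<^bsub>N\<^esub>) \<odot>\<^bsub>C1\<^esub> e = a \<ominus>\<^bsub>C1\<^esub> e"
    using mem(5) right_translation_mem[OF hk(1)]
    by (simp add: N.minus_eq C1.minus_eq N.free_module_smult_distrib N.free_module_neg)
      (simp add: e_def a_def N.smult_single)
  then show ?thesis
    using reducible_saturated[OF reg mem(5)] ae g by (simp add: reducible_elements_def e_def)
qed

lemma reducible_all:
  assumes "reducible_elements = carrier G" "c \<in> carrier C1"
  shows "c \<in> reducible t" using assms(2)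
proof (induction rule: N.free_module_induct)
  case zero
  show ?case using reducible_boundary[OF boundaries_zero] by (simp add: N.free_module_simps)
next
  case (add c g a)
  then show ?case using assms(1) by (intro reducible_add reducible_single) auto
qed

lemma cycle_torsion:
  assumes all: "reducible_elements = carrier G"
    and reg: "right_translation G t \<ominus>\<^bsub>N\<^esub> \<one>\<^bsub>N\<^esub> \<in> regular"
    and c: "c \<in> carrier C1" "bar_boundary1 G c = \<zero>\<^bsub>N\<^esub>"
  obtains r where "r \<in> regular" "r \<odot>\<^bsub>C1\<^esub> c \<in> boundaries"
proof -
  obtain r y b where r: "r \<in> regular" "y \<in> carrier N" "b \<in> boundaries"
    "r \<odot>\<^bsub>C1\<^esub> c = single N t y \<oplus>\<^bsub>C1\<^esub> b" by (rule reducibleE[OF reducible_all[OF all c(1)]])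
  have b0: "B1.extend b = \<zero>\<^bsub>N\<^esub>"
    using r(3) boundary_boundary by (auto simp: boundaries_def boundary2_eq)
  have "B1.extend (r \<odot>\<^bsub>C1\<^esub> c) = \<zero>\<^bsub>N\<^esub>"
    using c regular_closed[OF r(1)] by (simp add: B1.extend_smult boundary1_eq)
  moreover have "B1.extend (single N t y \<oplus>\<^bsub>C1\<^esub> b) = bd1 t y"
    using r(2) t boundaries_mem[OF r(3)] right_translation_mem[OF t]
    by (simp add: B1.extend_add single_C1 B1.extend_single b0 B1.f_closed)
  ultimately have "bd1 t y = \<zero>\<^bsub>N\<^esub>" using r(4) by simp
  then have "y \<otimes>\<^bsub>N\<^esub> (right_translation G t \<ominus>\<^bsub>N\<^esub> \<one>\<^bsub>N\<^esub>) = \<zero>\<^bsub>N\<^esub>" using r(2) right_translation_mem[OF t]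
    by (simp add: bd1_def N.minus_eq N.r_distr N.r_minus)
  then have "y = \<zero>\<^bsub>N\<^esub>" by (rule regular_cancel_right[OF reg r(2)])
  then have "r \<odot>\<^bsub>C1\<^esub> c = b"
    using r(4) boundaries_mem[OF r(3)] by (simp add: N.single_zero[where I = "carrier G"])
  with r show thesis by (intro that[of r]) simp_all
qed

end

section \<open>The vanishing criterion\<close>

text \<open>A finitely generated projective submodule corresponds to the row image of an idempotent
  matrix. Each row of the matrix is killed by a regular element, so its entries vanish by
  cancellation, and with the diagonal the trace vanishes.\<close>

lemma torsion_homology_betti_zero:
  assumes torsion: "\<And>c. c \<in> carrier C1 \<Longrightarrow> bar_boundary1 G c = \<zero>\<^bsub>N\<^esub> \<Longrightarrow>
    \<exists>r\<in>regular. r \<odot>\<^bsub>C1\<^esub> c \<in> boundaries"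
  shows "first_l2_betti G = 0"
proof -
  define Z where "Z = C1\<lparr>carrier := {c \<in> carrier C1. bar_boundary1 G c = \<zero>\<^bsub>N\<^esub>}\<rparr>"
  define M where "M = vN_homology1 G"
  have M_eq: "M = quotient_left_module Z boundaries"
    by (simp add: M_def vN_homology1_def Z_def bar_chains1_def bar_chains2_def boundaries_def)
  have Z_ops: "x \<oplus>\<^bsub>Z\<^esub> y = x \<oplus>\<^bsub>C1\<^esub> y" "r \<odot>\<^bsub>Z\<^esub> x = r \<odot>\<^bsub>C1\<^esub> x" for x y r by (simp_all add: Z_def)
  have coset: "boundaries +>\<^bsub>Z\<^esub> x = (\<lambda>b. b \<oplus>\<^bsub>C1\<^esub> x) ` boundaries" for x
    by (auto simp: a_r_coset_def r_coset_def Z_ops)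
  have coset_self: "boundaries +>\<^bsub>Z\<^esub> b = boundaries" if b: "b \<in> boundaries" for b unfolding coset
  proof (intro equalityI subsetI)
    fix x assume "x \<in> (\<lambda>b'. b' \<oplus>\<^bsub>C1\<^esub> b) ` boundaries"
    then show "x \<in> boundaries" using boundaries_add b by auto
  next
    fix x assume x: "x \<in> boundaries"
    have neg: "\<ominus>\<^bsub>C1\<^esub> b \<in> boundaries" using boundaries_smult[OF _ b, of "\<ominus>\<^bsub>N\<^esub> \<one>\<^bsub>N\<^esub>"] boundaries_mem[OF b]
      by (simp add: N.free_module_neg)
    have "x = (x \<oplus>\<^bsub>C1\<^esub> \<ominus>\<^bsub>C1\<^esub> b) \<oplus>\<^bsub>C1\<^esub> b" using x b by (simp add: boundaries_mem C1.a_assoc C1.l_neg)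
    then show "x \<in> (\<lambda>b'. b' \<oplus>\<^bsub>C1\<^esub> b) ` boundaries"
      by (rule image_eqI[OF _ boundaries_add[OF x neg]])
  qed
  have M_zero: "\<zero>\<^bsub>M\<^esub> = boundaries" by (simp add: M_eq quotient_left_module_def)
  \<comment> \<open>With this identity the additive map \<phi> must send the zero of the quotient to
    the zero row, without a proof that the quotient is a module.\<close>
  have M_zero_add: "\<zero>\<^bsub>M\<^esub> \<oplus>\<^bsub>M\<^esub> \<zero>\<^bsub>M\<^esub> = \<zero>\<^bsub>M\<^esub>"
  proof -
    have "\<zero>\<^bsub>M\<^esub> \<oplus>\<^bsub>M\<^esub> \<zero>\<^bsub>M\<^esub> = (\<Union>b\<in>boundaries. boundaries +>\<^bsub>Z\<^esub> b)"
      by (auto simp: M_eq quotient_left_module_def set_add_def set_mult_def coset Z_ops)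
    also have "\<dots> = boundaries" using coset_self boundaries_zero by auto
    finally show ?thesis by (simp add: M_zero)
  qed
  have killed: "\<exists>r\<in>regular. r \<odot>\<^bsub>M\<^esub> A = \<zero>\<^bsub>M\<^esub>" if A: "A \<in> carrier M" for A
  proof -
    obtain c where c: "c \<in> carrier C1" "bar_boundary1 G c = \<zero>\<^bsub>N\<^esub>" and Ac: "A = boundaries +>\<^bsub>Z\<^esub> c"
      using A by (auto simp: M_eq quotient_left_module_def A_RCOSETS_def RCOSETS_def a_r_coset_def Z_def)
    obtain r where r: "r \<in> regular" "r \<odot>\<^bsub>C1\<^esub> c \<in> boundaries" using torsion[OF c] by auto
    note rN = regular_closed[OF r(1)]
    have "r \<odot>\<^bsub>C1\<^esub> x \<in> boundaries" if xA: "x \<in> A" for x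
    proof -
      obtain b where b: "b \<in> boundaries" "x = b \<oplus>\<^bsub>C1\<^esub> c" using xA by (auto simp: Ac coset)
      have "r \<odot>\<^bsub>C1\<^esub> x = r \<odot>\<^bsub>C1\<^esub> b \<oplus>\<^bsub>C1\<^esub> r \<odot>\<^bsub>C1\<^esub> c"
        unfolding b(2) by (rule N.free_module_smult_add[OF rN boundaries_mem[OF b(1)] c(1)])
      then show ?thesis using boundaries_add[OF boundaries_smult[OF rN b(1)] r(2)] by simp
    qed
    then have "boundaries +>\<^bsub>Z\<^esub> (r \<odot>\<^bsub>Z\<^esub> x) = boundaries" if "x \<in> A" for x
      using coset_self that by (simp add: Z_ops)
    moreover have "A \<noteq> {}" using boundaries_zero by (auto simp: Ac coset)
    ultimately have "r \<odot>\<^bsub>M\<^esub> A = boundaries" by (auto simp: M_eq quotient_left_module_def)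
    then show ?thesis using r(1) M_zero by auto
  qed
  have dim0: "d = 0" if P: "submodule P N M" and d: "fg_projective_of_dim G (M\<lparr>carrier := P\<rparr>) d" for P d
  proof -
    interpret P: submodule P N M by (rule P)
    obtain n A \<phi> where A: "idempotent_matrix N n A"
      and \<phi>: "bij_betw \<phi> P (carrier (row_image N n A))"
      and \<phi>_add: "\<And>x y. x \<in> P \<Longrightarrow> y \<in> P \<Longrightarrow> \<phi> (x \<oplus>\<^bsub>M\<^esub> y) = \<phi> x \<oplus>\<^bsub>row_image N n A\<^esub> \<phi> y"
      and \<phi>_smult: "\<And>r x. r \<in> carrier N \<Longrightarrow> x \<in> P \<Longrightarrow> \<phi> (r \<odot>\<^bsub>M\<^esub> x) = r \<odot>\<^bsub>row_image N n A\<^esub> \<phi> x"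
      and d_eq: "d = Re (\<Sum>i<n. vN_trace G (A i i))"
      using d by (auto simp: fg_projective_of_dim_def left_module_iso_def)
    have row_ops: "x \<oplus>\<^bsub>row_image N n A\<^esub> y = (\<lambda>i. x i \<oplus>\<^bsub>N\<^esub> y i)"
      "r \<odot>\<^bsub>row_image N n A\<^esub> x = (\<lambda>i. r \<otimes>\<^bsub>N\<^esub> x i)" for x y r
      by (simp_all add: row_image_def free_left_module_def)
    have AN: "A i j \<in> carrier N" if "i < n" "j < n" for i j
      using A that by (simp add: idempotent_matrix_def)
    have row_closed: "x j \<in> carrier N" if "x \<in> carrier (row_image N n A)" for x j using that
      by (auto simp: row_image_def N.free_module_carrier AN intro!: N.finsum_closed)
    have zP: "\<zero>\<^bsub>M\<^esub> \<in> P" using P.one_closed by simp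
    have \<phi>P: "\<phi> x \<in> carrier (row_image N n A)" if "x \<in> P" for x
      using \<phi> that by (rule bij_betwE[THEN bspec])
    have \<phi>0: "\<phi> \<zero>\<^bsub>M\<^esub> j = \<zero>\<^bsub>N\<^esub>" for j
    proof -
      have "\<phi> \<zero>\<^bsub>M\<^esub> j = \<phi> \<zero>\<^bsub>M\<^esub> j \<oplus>\<^bsub>N\<^esub> \<phi> \<zero>\<^bsub>M\<^esub> j"
        using \<phi>_add[OF zP zP] unfolding M_zero_add row_ops by (rule fun_cong)
      then have "\<phi> \<zero>\<^bsub>M\<^esub> j \<oplus>\<^bsub>N\<^esub> \<phi> \<zero>\<^bsub>M\<^esub> j = \<phi> \<zero>\<^bsub>M\<^esub> j" by (rule sym)
      then show ?thesis
        using N.add.l_cancel_one[OF row_closed[OF \<phi>P[OF zP], of j] row_closed[OF \<phi>P[OF zP], of j]]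
        by (simp only:)
    qed
    \<comment> \<open>The i-th unit vector times A is row i of A. A regular element kills its
      preimage in P, hence also the entry in column i.\<close>
    have "A i i = \<zero>\<^bsub>N\<^esub>" if i: "i < n" for i
    proof -
      have s: "single N i \<one>\<^bsub>N\<^esub> \<in> carrier (free_left_module N {..<n})"
        using i by (intro N.single_mem) auto
      define row where "row = (\<lambda>j. if j < n
        then \<Oplus>\<^bsub>N\<^esub>k\<in>{..<n}. single N i \<one>\<^bsub>N\<^esub> k \<otimes>\<^bsub>N\<^esub> A k j else \<zero>\<^bsub>N\<^esub>)"
      have row_mem: "row \<in> carrier (row_image N n A)"
        using s by (auto simp: row_image_def row_def)
      have row_i: "row i = A i i"
      proof -
        have "row i = (\<Oplus>\<^bsub>N\<^esub>k\<in>{..<n}. if i = k then A k i else \<zero>\<^bsub>N\<^esub>)" unfolding row_def using i AN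
          by (simp, intro N.finsum_cong') (auto simp: single_def)
        also have "\<dots> = A i i" using i AN by (intro N.finsum_singleton) auto
        finally show ?thesis .
      qed
      have "row \<in> \<phi> ` P" using row_mem by (simp only: bij_betw_imp_surj_on[OF \<phi>])
      then obtain p where p: "p \<in> P" "\<phi> p = row" by auto
      have "p \<in> carrier M" using P.subset p(1) by auto
      then obtain r where r: "r \<in> regular" "r \<odot>\<^bsub>M\<^esub> p = \<zero>\<^bsub>M\<^esub>" using killed by auto
      have "r \<otimes>\<^bsub>N\<^esub> A i i = \<phi> (r \<odot>\<^bsub>M\<^esub> p) i"
        by (simp add: \<phi>_smult[OF regular_closed[OF r(1)] p(1)] row_ops p(2) row_i)
      also have "\<dots> = \<zero>\<^bsub>N\<^esub>" by (simp add: r(2) \<phi>0)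
      finally show ?thesis by (rule regular_cancel_left[OF r(1) AN[OF i i]])
    qed
    then show "d = 0" by (simp add: d_eq vN_trace_zero)
  qed
  have "first_l2_betti G = Sup {ennreal d |d P. submodule P N M \<and>
      fg_projective_of_dim G (M\<lparr>carrier := P\<rparr>) d}"
    by (simp add: first_l2_betti_def vN_dim_def M_def)
  also have "\<dots> \<le> 0"
  proof (rule Sup_least)
    fix e assume "e \<in> {ennreal d |d P. submodule P N M \<and> fg_projective_of_dim G (M\<lparr>carrier := P\<rparr>) d}"
    then obtain d P where e: "e = ennreal d" and P: "submodule P N M"
      and d: "fg_projective_of_dim G (M\<lparr>carrier := P\<rparr>) d" by auto
    show "e \<le> 0" unfolding e dim0[OF P d] by simp
  qed
  finally show ?thesis by simp
qed

text \<open>Turns the homological problem into one about subgroups. Torsion-freeness makes h - 1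
  regular for each nontrivial h, so the reducible elements satisfy the closure conditions of
  \<open>gen\<close>.\<close>

theorem first_l2_betti_eq_zero:
  assumes torsion_free: "\<And>g n::nat. g \<in> carrier G \<Longrightarrow> g \<noteq> \<one> \<Longrightarrow> 0 < n \<Longrightarrow> g [^] n \<noteq> \<one>"
    and t: "t \<in> carrier G" "t \<noteq> \<one>"
    and gen: "\<And>S. \<lbrakk>subgroup S G; t \<in> S;
      \<And>g h k. \<lbrakk>g \<in> carrier G; h \<in> S; k \<in> S; h \<noteq> \<one>; h \<otimes> g = g \<otimes> k\<rbrakk> \<Longrightarrow> g \<in> S\<rbrakk> \<Longrightarrow> carrier G \<subseteq> S"
  shows "first_l2_betti G = 0"
proof (rule torsion_homology_betti_zero)
  fix c assume c: "c \<in> carrier C1" "bar_boundary1 G c = \<zero>\<^bsub>N\<^esub>"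
  define S where "S = reducible_elements t"
  have reg: "right_translation G g \<ominus>\<^bsub>N\<^esub> \<one>\<^bsub>N\<^esub> \<in> regular" if "g \<in> carrier G" "g \<noteq> \<one>" for g
    using that torsion_free by (intro right_translation_minus_one_regular)
  have SG: "S \<subseteq> carrier G" by (auto simp: S_def reducible_elements_def[OF t(1)])
  have "subgroup S G" using SG reducible_elements_one[OF t(1)] reducible_elements_inv[OF t(1)]
      reducible_elements_mult[OF t(1)] by (intro subgroupI) (auto simp: S_def)
  moreover have "t \<in> S"
    using t reducible_base[OF t(1)] by (simp add: S_def reducible_elements_def)
  moreover have "g \<in> S" if "g \<in> carrier G" "h \<in> S" "k \<in> S" "h \<noteq> \<one>" "h \<otimes> g = g \<otimes> k" for g h k
    unfolding S_def
  proof (rule reducible_elements_conj[OF t(1) that(1)])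
    show "right_translation G h \<ominus>\<^bsub>N\<^esub> \<one>\<^bsub>N\<^esub> \<in> regular" using that SG by (intro reg) auto
  qed (use that in \<open>simp_all add: S_def\<close>)
  ultimately have "carrier G \<subseteq> S" by (rule gen)
  then have all: "reducible_elements t = carrier G" using SG by (auto simp: S_def)
  obtain r where "r \<in> regular" "r \<odot>\<^bsub>C1\<^esub> c \<in> boundaries"
    by (rule cycle_torsion[OF t(1) all reg[OF t] c])
  then show "\<exists>r\<in>regular. r \<odot>\<^bsub>C1\<^esub> c \<in> boundaries" by auto
qed

end

section \<open>Increasing homeomorphisms\<close>

lemma strict_mono_surj_continuous:
  fixes f :: "real \<Rightarrow> real"
  assumes "strict_mono f" "surj f"
  shows "continuous_on UNIV f"
  by (rule continuous_onI_mono) (simp_all add: assms(2) strict_mono_less_eq[OF assms(1)])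

lemma strict_mono_surj_inv:
  fixes f :: "real \<Rightarrow> real"
  assumes "strict_mono f" "surj f"
  shows "strict_mono (inv_into UNIV f)" "surj (inv_into UNIV f)"
proof -
  have inj: "inj f" by (rule strict_mono_imp_inj_on[OF assms(1)])
  show "surj (inv_into UNIV f)" by (rule inj_imp_surj_inv[OF inj])
  show "strict_mono (inv_into UNIV f)"
  proof (rule strict_monoI)
    fix x y :: real assume "x < y"
    then have "f (inv_into UNIV f x) < f (inv_into UNIV f y)" by (simp add: surj_f_inv_f[OF assms(2)])
    then show "inv_into UNIV f x < inv_into UNIV f y" by (simp only: strict_mono_less[OF assms(1)])
  qed
qed

text \<open>A strictly increasing surjection of the line has no jumps, and its inverse is again such
  a map, so continuity comes with the order.\<close>

lemma carrier_Homeo_plus_real: "carrier Homeo_plus_real = {f. strict_mono f \<and> surj f}"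
proof (intro equalityI subsetI)
  fix f assume "f \<in> carrier Homeo_plus_real"
  then show "f \<in> {f. strict_mono f \<and> surj f}"
    by (auto simp: Homeo_plus_real_def homeomorphism_def)
next
  fix f :: "real \<Rightarrow> real" assume "f \<in> {f. strict_mono f \<and> surj f}"
  then have f: "strict_mono f" "surj f" by auto
  note g = strict_mono_surj_inv[OF f]
  have inj: "inj f" by (rule strict_mono_imp_inj_on[OF f(1)])
  have "homeomorphism UNIV UNIV f (inv_into UNIV f)" unfolding homeomorphism_def
    using f(2) g(2) strict_mono_surj_continuous[OF f] strict_mono_surj_continuous[OF g]
    by (simp add: inv_f_f[OF inj] surj_f_inv_f[OF f(2)])
  then show "f \<in> carrier Homeo_plus_real" using f(1) by (auto simp: Homeo_plus_real_def)
qed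

lemma Homeo_plus_real_simps [simp]:
  "f \<otimes>\<^bsub>Homeo_plus_real\<^esub> g = g \<circ> f" "\<one>\<^bsub>Homeo_plus_real\<^esub> = id" by (simp_all add: Homeo_plus_real_def)

lemma group_Homeo_plus_real: "group Homeo_plus_real"
proof (rule groupI)
  fix f g h assume f: "f \<in> carrier Homeo_plus_real" and g: "g \<in> carrier Homeo_plus_real"
  then show "f \<otimes>\<^bsub>Homeo_plus_real\<^esub> g \<in> carrier Homeo_plus_real"
  proof -
    have "surj (g \<circ> f)" using f g by (intro comp_surj) (simp_all add: carrier_Homeo_plus_real)
    then show ?thesis using f g by (simp add: carrier_Homeo_plus_real strict_mono_def)
  qed
next
  show "\<one>\<^bsub>Homeo_plus_real\<^esub> \<in> carrier Homeo_plus_real"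
    by (simp add: carrier_Homeo_plus_real strict_mono_def)
next
  fix f assume "f \<in> carrier Homeo_plus_real"
  then have f: "strict_mono f" "surj f" by (auto simp: carrier_Homeo_plus_real)
  show "\<exists>g\<in>carrier Homeo_plus_real. g \<otimes>\<^bsub>Homeo_plus_real\<^esub> f = \<one>\<^bsub>Homeo_plus_real\<^esub>"
    using strict_mono_surj_inv[OF f] f(2)
    by (intro bexI[of _ "inv_into UNIV f"]) (auto simp: carrier_Homeo_plus_real surj_iff)
qed (auto simp: comp_assoc)

text \<open>The iterates of a moved point stay strictly on the side to which it was first moved.
  This yields torsion-freeness of the group.\<close>

lemma funpow_strict_mono_neq_id:
  fixes f :: "real \<Rightarrow> real"
  assumes f: "strict_mono f" "f \<noteq> id" and n: "0 < n"
  shows "f ^^ n \<noteq> id"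
proof -
  obtain x where x: "f x \<noteq> x" using f(2) by (auto simp: fun_eq_iff)
  have "if f x > x then (f ^^ Suc k) x > x else (f ^^ Suc k) x < x" for k
  proof (induction k)
    case 0
    then show ?case using x by simp
  next
    case (Suc k)
    let ?y = "(f ^^ Suc k) x"
    have eq: "(f ^^ Suc (Suc k)) x = f ?y" by simp
    show ?case
    proof (cases "f x > x")
      case True
      then have "x < ?y" using Suc by simp
      then have "f x < f ?y" by (simp only: strict_mono_less[OF f(1)])
      with True show ?thesis unfolding eq by simp
    next
      case False
      then have "?y < x" using Suc by simp
      then have "f ?y < f x" by (simp only: strict_mono_less[OF f(1)])
      with False x show ?thesis unfolding eq by simp
    qed
  qed
  from this[of "n - 1"] n have "(f ^^ n) x \<noteq> x" by (auto split: if_splits)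
  then show ?thesis by auto
qed

text \<open>An injective map preserves its own support: if f fixes f x, then it fixes x. So a point
  moved by one map is carried to a point fixed by the other.\<close>

lemma disjoint_support_commute:
  fixes f g :: "real \<Rightarrow> real"
  assumes "inj f" "inj g" "Supp f \<inter> Supp g = {}"
  shows "f \<circ> g = g \<circ> f"
proof
  fix x
  have disj: "f y = y \<or> g y = y" for y using assms(3) by (auto simp: Supp_def)
  have "f (g x) = g (f x)"
  proof (cases "g x = x")
    case True
    then show ?thesis using disj[of "f x"] injD[OF assms(1), of "f x" x] by auto
  next
    case False
    then show ?thesis using disj[of x] disj[of "g x"] injD[OF assms(2), of "g x" x] by auto
  qed
  then show "(f \<circ> g) x = (g \<circ> f) x" by simp
qed

text \<open>The orientation-preserving part of \<open>Homeo_unit\<close> in order-theoretic form, as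
  maps of the whole line.\<close>

definition unit_homeos :: "(real \<Rightarrow> real) set" where
  "unit_homeos = {f. strict_mono f \<and> surj f \<and> (\<forall>x. x \<notin> {0<..<1} \<longrightarrow> f x = x)}"

lemma unit_homeosD:
  assumes "f \<in> unit_homeos"
  shows "strict_mono f" "surj f" "x \<le> 0 \<Longrightarrow> f x = x" "1 \<le> x \<Longrightarrow> f x = x" "inj f"
  using assms strict_mono_imp_inj_on by (auto simp: unit_homeos_def)

lemma unit_homeos_less: "f \<in> unit_homeos \<Longrightarrow> f x < f y \<longleftrightarrow> x < y"
  using unit_homeosD(1) strict_mono_less by blast

lemma unit_homeos_le: "f \<in> unit_homeos \<Longrightarrow> f x \<le> f y \<longleftrightarrow> x \<le> y"
  using unit_homeosD(1) strict_mono_less_eq by blast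

lemma unit_homeos_comp:
  assumes "f \<in> unit_homeos" "g \<in> unit_homeos"
  shows "g \<circ> f \<in> unit_homeos"
proof -
  have "surj (g \<circ> f)" using assms by (intro comp_surj unit_homeosD)
  moreover have "strict_mono (g \<circ> f)" by (rule strict_monoI) (simp add: unit_homeos_less assms)
  ultimately show ?thesis using assms by (simp add: unit_homeos_def)
qed

lemma unit_homeos_range:
  assumes "f \<in> unit_homeos" "0 \<le> t" "t < 1"
  shows "0 \<le> f t" "f t < 1"
  using unit_homeos_le[OF assms(1), of 0 t] unit_homeos_less[OF assms(1), of t 1] assms
    unit_homeosD(3)[OF assms(1), of 0] unit_homeosD(4)[OF assms(1), of 1] by simp_all

lemma unit_homeos_subset_Homeo_unit: "f \<in> unit_homeos \<Longrightarrow> f \<in> carrier Homeo_unit"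
proof -
  assume f: "f \<in> unit_homeos"
  note D = unit_homeosD[OF f]
  note cont = strict_mono_surj_continuous[OF D(1,2)]
    strict_mono_surj_continuous[OF strict_mono_surj_inv[OF D(1,2)]]
  have ends: "f 0 = 0" "f 1 = 1" using D(3,4) by auto
  have iff: "f x \<in> {0..1} \<longleftrightarrow> x \<in> {0..1}" for x
    using unit_homeos_le[OF f, of 0 x] unit_homeos_le[OF f, of x 1] by (simp add: ends)
  have inv_iff: "inv_into UNIV f y \<in> {0..1} \<longleftrightarrow> y \<in> {0..1}" for y
    using iff[of "inv_into UNIV f y"] by (simp add: surj_f_inv_f[OF D(2)])
  have "f ` {0..1} = {0..1}"
  proof (intro equalityI subsetI)
    fix y assume "y \<in> f ` {0..1}"
    then obtain x where "y = f x" "x \<in> {0..1}" by (rule imageE)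
    then show "y \<in> {0..1}" using iff[of x] by simp
  next
    fix y :: real assume "y \<in> {0..1}"
    then have "inv_into UNIV f y \<in> {0..1}" using inv_iff by simp
    then have "f (inv_into UNIV f y) \<in> f ` {0..1}" by (rule imageI)
    then show "y \<in> f ` {0..1}" by (simp add: surj_f_inv_f[OF D(2)])
  qed
  moreover have "inv_into UNIV f ` {0..1} = {0..1}"
  proof (intro equalityI subsetI)
    fix y assume "y \<in> inv_into UNIV f ` {0..1}"
    then obtain x where "y = inv_into UNIV f x" "x \<in> {0..1}" by (rule imageE)
    then show "y \<in> {0..1}" using inv_iff[of x] by simp
  next
    fix y :: real assume "y \<in> {0..1}"
    then have "f y \<in> {0..1}" using iff by simp
    then have "inv_into UNIV f (f y) \<in> inv_into UNIV f ` {0..1}" by (rule imageI)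
    then show "y \<in> inv_into UNIV f ` {0..1}" by (simp add: inv_f_f[OF D(5)])
  qed
  ultimately have "homeomorphism {0..1} {0..1} f (inv_into UNIV f)" unfolding homeomorphism_def
    using continuous_on_subset[OF cont(1)] continuous_on_subset[OF cont(2)]
    by (simp add: inv_f_f[OF D(5)] surj_f_inv_f[OF D(2)])
  then show ?thesis using f by (auto simp: Homeo_unit_def unit_homeos_def)
qed

lemma Homeo_unit_simps [simp]:
  "f \<otimes>\<^bsub>Homeo_unit\<^esub> g = g \<circ> f" "\<one>\<^bsub>Homeo_unit\<^esub> = id" by (simp_all add: Homeo_unit_def)

lemma group_Homeo_unit: "group Homeo_unit"
proof (rule groupI)
  fix f g assume "f \<in> carrier Homeo_unit" "g \<in> carrier Homeo_unit"
  then obtain f' g' where f: "homeomorphism {0..1} {0..1} f f'" "\<forall>x. x \<notin> {0..1} \<longrightarrow> f x = x"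
    and g: "homeomorphism {0..1} {0..1} g g'" "\<forall>x. x \<notin> {0..1} \<longrightarrow> g x = x"
    unfolding Homeo_unit_def by auto
  from homeomorphism_compose[OF f(1) g(1)]
  show "f \<otimes>\<^bsub>Homeo_unit\<^esub> g \<in> carrier Homeo_unit" using f(2) g(2) by (auto simp: Homeo_unit_def)
next
  have "homeomorphism {0..1} {0..1} (id::real \<Rightarrow> real) id" unfolding id_def by (rule homeomorphism_ident)
  then show "\<one>\<^bsub>Homeo_unit\<^esub> \<in> carrier Homeo_unit" by (auto simp: Homeo_unit_def)
next
  fix f assume "f \<in> carrier Homeo_unit"
  then obtain g where f: "homeomorphism {0..1} {0..1} f g" "\<forall>x. x \<notin> {0..1} \<longrightarrow> f x = x"
    unfolding Homeo_unit_def by auto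
  \<comment> \<open>The inverse map given by \<open>homeomorphism\<close> is arbitrary off [0, 1]
    and is reset to the identity there.\<close>
  define g' where "g' x = (if x \<in> {0..1} then g x else x)" for x
  have "homeomorphism {0..1} {0..1} g' f"
    by (rule homeomorphism_cong[OF homeomorphism_symD[OF f(1)]]) (auto simp: g'_def)
  then have "g' \<in> carrier Homeo_unit" by (auto simp: Homeo_unit_def g'_def)
  moreover have "f (g' x) = x" for x
    using f(2) homeomorphism_apply2[OF f(1), of x] by (simp add: g'_def)
  then have "g' \<otimes>\<^bsub>Homeo_unit\<^esub> f = \<one>\<^bsub>Homeo_unit\<^esub>" by (simp add: fun_eq_iff)
  ultimately show "\<exists>g\<in>carrier Homeo_unit. g \<otimes>\<^bsub>Homeo_unit\<^esub> f = \<one>\<^bsub>Homeo_unit\<^esub>" by blast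
qed (auto simp: comp_assoc)

lemma thompson_subset_unit_homeos:
  assumes "f \<in> carrier thompson_F"
  shows "f \<in> unit_homeos"
proof -
  have mono: "strict_mono_on {0..1} f" and H: "f \<in> carrier Homeo_unit"
    using assms by (auto simp: thompson_F_def)
  obtain g where hom: "homeomorphism {0..1} {0..1} f g" and out: "\<And>x. x \<notin> {0..1} \<Longrightarrow> f x = x"
    using H by (auto simp: Homeo_unit_def)
  have img: "f ` {0..1} = {0..1}" using hom by (simp add: homeomorphism_def)
  have range: "f x \<in> {0..1}" if "x \<in> {0..1}" for x using img that by blast
  have less: "f x < f y" if "x < y" "x \<in> {0..1}" "y \<in> {0..1}" for x y
    using mono that by (simp add: strict_mono_on_def)
  have le: "f x \<le> f y" if "x \<le> y" "x \<in> {0..1}" "y \<in> {0..1}" for x y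
    using less[of x y] that by (cases "x = y") auto
  have "0 \<in> f ` {0..1}" "1 \<in> f ` {0..1}" using img by auto
  then obtain x y where "x \<in> {0..1}" "f x = 0" "y \<in> {0..1}" "f y = 1" by auto
  then have ends: "f 0 = 0" "f 1 = 1" using le[of 0 x] le[of y 1] range[of 0] range[of 1] by auto
  have "strict_mono f"
  proof (rule strict_monoI)
    fix x y :: real assume xy: "x < y"
    show "f x < f y" using less[OF xy] range[of x] range[of y] out[of x] out[of y] xy
      by (cases "x \<in> {0..1}"; cases "y \<in> {0..1}") auto
  qed
  moreover have "surj f"
  proof (rule surjI)
    fix y :: real
    show "f (if y \<in> {0..1} then g y else y) = y"
      using out[of y] homeomorphism_apply2[OF hom, of y] by simp
  qed
  moreover have "f x = x" if "x \<notin> {0<..<1}" for x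
    using out[of x] ends that by (cases "x = 0 \<or> x = 1") auto
  ultimately show ?thesis by (simp add: unit_homeos_def)
qed

section \<open>Periodic copies along the line\<close>

lemma iota0_involution: "iota0 (iota0 t) = t" by (auto simp: iota0_def)

lemma flip_comp: "flip (g \<circ> f) = flip g \<circ> flip f"
  by (simp add: flip_def fun_eq_iff iota0_involution)

lemma flip_eq:
  assumes "f \<in> unit_homeos"
  shows "flip f t = 1 - f (1 - t)"
proof (cases "t \<in> {0..1}")
  case True
  then have "1 - t \<in> {0..1}" by auto
  then have "f (1 - t) \<in> {0..1}"
    using unit_homeos_le[OF assms, of 0 "1 - t"] unit_homeos_le[OF assms, of "1 - t" 1]
      unit_homeosD(3)[OF assms, of 0] unit_homeosD(4)[OF assms, of 1] by auto
  then show ?thesis using True by (simp add: flip_def iota0_def)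
next
  case False
  then have "f t = t" "f (1 - t) = 1 - t" using unit_homeosD(3,4)[OF assms] by auto
  then show ?thesis using False by (auto simp: flip_def iota0_def)
qed

lemma flip_unit_homeos:
  assumes f: "f \<in> unit_homeos"
  shows "flip f \<in> unit_homeos"
proof -
  have "strict_mono (flip f)"
    by (rule strict_monoI) (simp add: flip_eq[OF f] unit_homeos_less[OF f])
  moreover have "surj (flip f)" by (rule surjI[of _ "\<lambda>y. 1 - inv_into UNIV f (1 - y)"])
      (simp add: flip_eq[OF f] surj_f_inv_f[OF unit_homeosD(2)[OF f]])
  moreover have "flip f x = x" if "x \<notin> {0<..<1}" for x
    using unit_homeosD(3,4)[OF f, of "1 - x"] that by (auto simp: flip_eq[OF f])
  ultimately show ?thesis by (simp add: unit_homeos_def)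
qed

definition tile :: "(int \<Rightarrow> bool) \<Rightarrow> (real \<Rightarrow> real) \<Rightarrow> int \<Rightarrow> real \<Rightarrow> real" where
  "tile \<sigma> f n = (if \<sigma> n then f else flip f)"

text \<open>Common form of \<open>zeta\<close> (a = 0) and \<open>chi\<close> (a = 1/2). Tile n is
  the interval from n - a to n + 1 - a, and \<sigma> n tells whether it carries f or its
  flip.\<close>

definition periodic_copies :: "real \<Rightarrow> (int \<Rightarrow> bool) \<Rightarrow> (real \<Rightarrow> real) \<Rightarrow> real \<Rightarrow> real" where
  "periodic_copies a \<sigma> f x = of_int \<lfloor>x + a\<rfloor> + tile \<sigma> f \<lfloor>x + a\<rfloor> (x + a - of_int \<lfloor>x + a\<rfloor>) - a"

lemma zeta_eq: "zeta \<rho> f = periodic_copies 0 (\<lambda>n. \<rho> (of_int n + 1/2) = Gen_b) f"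
  by (simp add: fun_eq_iff zeta_def periodic_copies_def tile_def Let_def)

lemma chi_eq: "chi \<rho> f = periodic_copies (1/2) (\<lambda>n. \<rho> (of_int n) = Gen_a) f"
proof
  fix x :: real
  have eq: "x + 1/2 - of_int \<lfloor>x + 1/2\<rfloor> = x - (of_int \<lfloor>x + 1/2\<rfloor> - 1/2)" by simp
  show "chi \<rho> f x = periodic_copies (1/2) (\<lambda>n. \<rho> (of_int n) = Gen_a) f x"
    unfolding chi_def periodic_copies_def tile_def Let_def eq by simp
qed

context
  fixes a :: real and \<sigma> :: "int \<Rightarrow> bool"
begin

lemma tile_unit_homeos: "f \<in> unit_homeos \<Longrightarrow> tile \<sigma> f n \<in> unit_homeos"
  by (simp add: tile_def flip_unit_homeos)

lemma copies_decomp: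
  assumes "0 \<le> t" "t < 1"
  shows "periodic_copies a \<sigma> f (of_int n + t - a) = of_int n + tile \<sigma> f n t - a"
proof -
  have "\<lfloor>of_int n + t\<rfloor> = n" using assms by (simp add: floor_unique)
  then show ?thesis by (simp add: periodic_copies_def)
qed

lemma real_decomp:
  obtains n t where "0 \<le> t" "t < 1" "x = of_int n + t - a"
  using that[of "x + a - of_int \<lfloor>x + a\<rfloor>" "\<lfloor>x + a\<rfloor>"] by (simp add: le_floor_iff) linarith

lemma copies_comp:
  assumes f: "f \<in> unit_homeos" and g: "g \<in> unit_homeos"
  shows "periodic_copies a \<sigma> (g \<circ> f) = periodic_copies a \<sigma> g \<circ> periodic_copies a \<sigma> f"
proof
  fix x
  obtain n t where t: "0 \<le> t" "t < 1" and x: "x = of_int n + t - a" by (rule real_decomp)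
  note r = unit_homeos_range[OF tile_unit_homeos[OF f, of n] t]
  have "tile \<sigma> (g \<circ> f) n = tile \<sigma> g n \<circ> tile \<sigma> f n" by (simp add: tile_def flip_comp)
  then show "periodic_copies a \<sigma> (g \<circ> f) x = (periodic_copies a \<sigma> g \<circ> periodic_copies a \<sigma> f) x"
    by (simp add: x copies_decomp[OF t] copies_decomp[OF r])
qed

lemma copies_id: "periodic_copies a \<sigma> id = id"
proof
  fix x
  obtain n t where t: "0 \<le> t" "t < 1" and x: "x = of_int n + t - a" by (rule real_decomp)
  have "tile \<sigma> id n = id" by (simp add: tile_def flip_def fun_eq_iff iota0_involution)
  then show "periodic_copies a \<sigma> id x = id x" by (simp add: x copies_decomp[OF t])
qed

lemma copies_neq_id:
  assumes f: "f \<in> unit_homeos" "f \<noteq> id"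
  shows "periodic_copies a \<sigma> f \<noteq> id"
proof
  assume Z: "periodic_copies a \<sigma> f = id"
  obtain s where s: "f s \<noteq> s" using f(2) by (auto simp: fun_eq_iff)
  have s01: "0 < s" "s < 1" using s unit_homeosD(3,4)[OF f(1), of s] by (force simp: not_le[symmetric])+
  have fixed: "tile \<sigma> f 0 t = t" if "0 \<le> t" "t < 1" for t
    using copies_decomp[OF that, of f 0] by (simp add: Z)
  \<comment> \<open>A single tile is enough: it moves s, or 1 - s if it carries the flip.\<close>
  show False
  proof (cases "\<sigma> 0")
    case True
    then show ?thesis using fixed[of s] s s01 by (simp add: tile_def)
  next
    case False
    then show ?thesis using fixed[of "1 - s"] s s01 by (simp add: tile_def flip_eq[OF f(1)])
  qed
qed

lemma copies_mem:
  assumes f: "f \<in> unit_homeos"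
  shows "periodic_copies a \<sigma> f \<in> carrier Homeo_plus_real"
proof -
  have "strict_mono (periodic_copies a \<sigma> f)"
  proof (rule strict_monoI)
    fix x y :: real assume xy: "x < y"
    obtain n t where t: "0 \<le> t" "t < 1" and x: "x = of_int n + t - a" by (rule real_decomp)
    obtain m u where u: "0 \<le> u" "u < 1" and y: "y = of_int m + u - a" by (rule real_decomp)
    note r = unit_homeos_range[OF tile_unit_homeos[OF f, of n] t]
      unit_homeos_range[OF tile_unit_homeos[OF f, of m] u]
    have "of_int n + t < of_int m + u" using xy x y by simp
    then have "of_int n < (of_int (m + 1) :: real)" using t u by simp
    then have "n < m + 1" by (simp only: of_int_less_iff)
    \<comment> \<open>Each tile is mapped to itself, so the order of two points is decided inside
      one tile or by their tile numbers.\<close>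
    then consider "n = m" | "n + 1 \<le> m" by linarith
    then show "periodic_copies a \<sigma> f x < periodic_copies a \<sigma> f y"
    proof cases
      case 1
      then have "t < u" using xy x y by simp
      then show ?thesis using 1 by (simp add: x y copies_decomp[OF t] copies_decomp[OF u]
            unit_homeos_less[OF tile_unit_homeos[OF f]])
    next
      case 2
      then have "of_int (n + 1) \<le> (of_int m :: real)" by (simp only: of_int_le_iff)
      then show ?thesis using r by (simp add: x y copies_decomp[OF t] copies_decomp[OF u])
    qed
  qed
  moreover have "surj (periodic_copies a \<sigma> f)" unfolding surj_def
  proof (rule allI)
    fix y
    obtain m u where u: "0 \<le> u" "u < 1" and y: "y = of_int m + u - a" by (rule real_decomp)
    note T = tile_unit_homeos[OF f, of m]
    obtain t where t: "u = tile \<sigma> f m t" using unit_homeosD(2)[OF T] by (rule surjE)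
    have "0 \<le> t" "t < 1" using unit_homeos_le[OF T, of 0 t] unit_homeos_less[OF T, of t 1] u t
        unit_homeosD(3)[OF T, of 0] unit_homeosD(4)[OF T, of 1] by simp_all
    then have "periodic_copies a \<sigma> f (of_int m + t - a) = y" by (simp add: copies_decomp y t)
    then show "\<exists>x. y = periodic_copies a \<sigma> f x" by (intro exI[of _ "of_int m + t - a"]) simp
  qed
  ultimately show ?thesis by (simp add: carrier_Homeo_plus_real)
qed

text \<open>The interval [3/8, 5/8] is symmetric about 1/2, so it contains the support of the flip
  as well.\<close>

lemma copies_support:
  assumes f: "f \<in> unit_homeos" "Supp f \<subseteq> {3/8..5/8}" and t: "0 \<le> t" "t < 1" "t \<notin> {3/8..5/8}"
  shows "periodic_copies a \<sigma> f (of_int n + t - a) = of_int n + t - a"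
proof -
  have "1 - t \<notin> {3/8..5/8}" using t(3) by auto
  then have "f t = t" "f (1 - t) = 1 - t" using f(2) t(3) by (auto simp: Supp_def)
  then have "tile \<sigma> f n t = t" by (simp add: tile_def flip_eq[OF f(1)])
  then show ?thesis by (simp add: copies_decomp[OF t(1,2)])
qed

end

text \<open>Shifting by 1/2 carries [3/8, 5/8] to [7/8, 9/8], which is disjoint from it modulo 1. So
  the two copies have disjoint supports.\<close>

lemma zeta_chi_commute:
  assumes f: "f \<in> unit_homeos" "Supp f \<subseteq> {3/8..5/8}"
  shows "periodic_copies 0 \<sigma> f \<circ> periodic_copies (1/2) \<tau> f = periodic_copies (1/2) \<tau> f \<circ> periodic_copies 0 \<sigma> f"
proof (rule disjoint_support_commute)
  have mono: "strict_mono (periodic_copies a \<sigma> f)" for a \<sigma>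
    using copies_mem[OF f(1), of a \<sigma>] by (simp add: carrier_Homeo_plus_real)
  show "inj (periodic_copies 0 \<sigma> f)" "inj (periodic_copies (1/2) \<tau> f)"
    by (rule strict_mono_imp_inj_on[OF mono])+
  have "periodic_copies 0 \<sigma> f x = x \<or> periodic_copies (1/2) \<tau> f x = x" for x
  proof -
    obtain n t where t: "0 \<le> t" "t < 1" and x: "x = of_int n + t - 0" by (rule real_decomp)
    show ?thesis
    proof (cases "t \<in> {3/8..5/8}")
      case False
      then show ?thesis using copies_support[OF f t False, of 0 \<sigma> n] by (simp add: x)
    next
      case True
      show ?thesis
      \<comment> \<open>For t < 1/2 the point n + t lies in shifted tile n at position t + 1/2,
        otherwise in shifted tile n + 1 at position t - 1/2.\<close>
      proof (cases "t < 1/2")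
        case lt: True
        have "periodic_copies (1/2) \<tau> f (of_int n + (t + 1/2) - 1/2) = of_int n + (t + 1/2) - 1/2"
          using True lt by (intro copies_support[OF f]) auto
        then show ?thesis by (simp add: x)
      next
        case False
        have "periodic_copies (1/2) \<tau> f (of_int (n + 1) + (t - 1/2) - 1/2) = of_int (n + 1) + (t - 1/2) - 1/2"
          using True False by (intro copies_support[OF f]) auto
        then show ?thesis by (simp add: x)
      qed
    qed
  qed
  then show "Supp (periodic_copies 0 \<sigma> f) \<inter> Supp (periodic_copies (1/2) \<tau> f) = {}"
    by (auto simp: Supp_def)
qed

section \<open>Small elements of Thompson's group\<close>

text \<open>Meant for breakpoints: at an end of an interval on which h is the identity, the
  derivative restricts to a one-sided derivative of the identity, and this is unique.\<close>

lemma real_derivative_identity_on_interval: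
  fixes h :: "real \<Rightarrow> real"
  assumes "(h has_real_derivative D) (at x within T)" "{u..v} \<subseteq> T" "u < v" "x \<in> {u..v}"
    and "\<And>t. t \<in> {u..v} \<Longrightarrow> h t = t"
  shows "D = 1"
proof -
  have "(h has_real_derivative D) (at x within {u..v})" by (rule DERIV_subset[OF assms(1,2)])
  then have "((\<lambda>t. t) has_real_derivative D) (at x within {u..v})"
    by (rule has_field_derivative_transform_within[OF _ zero_less_one assms(4)]) (rule assms(5))
  then have D: "((\<lambda>t. t) has_vector_derivative D) (at x within {u..v})"
    by (simp only: has_real_derivative_iff_has_vector_derivative)
  have "((\<lambda>t::real. t) has_vector_derivative 1) (at x within {u..v})"
    by (rule has_vector_derivative_id)
  with D show ?thesis
    using vector_derivative_unique_within_closed_interval[of u v x "\<lambda>t. t" 1 D] assms(3,4)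
    by (simp only: cbox_interval)
qed

text \<open>Keeps the breakpoints of a rescaled element dyadic.\<close>

lemma dyadic_affine:
  assumes "p \<in> dyadics" "u \<in> dyadics"
  shows "p + u / 2 ^ k \<in> (dyadics :: real set)"
proof -
  obtain m j where p: "p = of_nat m / 2 ^ j" using assms(1) by (auto simp: dyadics_def)
  obtain a b where u: "u = of_nat a / 2 ^ b" using assms(2) by (auto simp: dyadics_def)
  have "p + u / 2 ^ k = of_nat (m * 2 ^ (b + k) + a * 2 ^ j) / 2 ^ (j + b + k)"
    by (simp add: p u field_simps power_add)
  then show ?thesis unfolding dyadics_def by blast
qed

text \<open>Conjugation of c by the affine map from u to p + s u preserves slopes and, as p is
  dyadic and s a power of 1/2, keeps breakpoints dyadic. It moves the support into the interval from
  p to p + s/4.\<close>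

lemma scaled_thompson_element:
  fixes c :: "real \<Rightarrow> real" and p s :: real and k :: nat
  assumes c: "c \<in> carrier thompson_F" "Supp c = {0<..<1/4}"
    and p: "p \<in> dyadics" "0 < p" and s: "s = 1 / 2 ^ k" "p + s \<le> 1"
  defines "h \<equiv> \<lambda>x. p + s * c ((x - p) / s)"
  shows "h \<in> carrier thompson_F" "Supp h \<subseteq> {p..p + s}" "h \<noteq> id"
proof -
  have s0: "0 < s" by (simp add: s)
  have cU: "c \<in> unit_homeos" by (rule thompson_subset_unit_homeos[OF c(1)])
  have c_out: "c u = u" if "u \<le> 0 \<or> 1/4 \<le> u" for u
    using c(2) that unfolding Supp_def by (cases "c u = u") (auto dest!: equalityD1 simp: subset_iff)
  have h_out: "h x = x" if "x \<le> p \<or> p + s/4 \<le> x" for x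
  proof -
    have "(x - p) / s \<le> 0 \<or> 1/4 \<le> (x - p) / s" using that s0 by (auto simp: field_simps)
    then show ?thesis using s0 by (simp add: h_def c_out)
  qed
  have "strict_mono h"
    by (rule strict_monoI) (use s0 in \<open>simp add: h_def unit_homeos_less[OF cU] divide_strict_right_mono\<close>)
  moreover have "surj h" by (rule surjI[of _ "\<lambda>y. p + s * inv_into UNIV c ((y - p) / s)"])
      (use s0 in \<open>simp add: h_def surj_f_inv_f[OF unit_homeosD(2)[OF cU]]\<close>)
  moreover have "h x = x" if "x \<notin> {0<..<1}" for x by (rule h_out) (use that p(2) s(2) s0 in auto)
  ultimately have hU: "h \<in> unit_homeos" by (simp add: unit_homeos_def)
  show "Supp h \<subseteq> {p..p + s}"
  proof
    fix x assume "x \<in> Supp h"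
    then have "h x \<noteq> x" by (simp add: Supp_def)
    then have "\<not> (x \<le> p \<or> p + s/4 \<le> x)" using h_out by blast
    then show "x \<in> {p..p + s}" using s0 by auto
  qed
  show "h \<noteq> id"
  proof
    assume "h = id"
    then have "h (p + s * (1/8)) = p + s * (1/8)" by simp
    then have "c (1/8) = 1/8" using s0 by (simp add: h_def)
    moreover have "1/8 \<in> Supp c" unfolding c(2) by simp
    ultimately show False by (simp add: Supp_def)
  qed
  have pl: "piecewise_linear_unit h"
  proof -
    have "piecewise_linear_unit c" using c(1) by (simp add: thompson_F_def)
    then obtain S where S: "finite S" and lin: "\<forall>x\<in>{0..1}. \<forall>y\<in>{0..1}.
        x < y \<and> {x<..<y} \<inter> S = {} \<longrightarrow> (\<exists>m d. \<forall>t\<in>{x..y}. c t = m * t + d)"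
      unfolding piecewise_linear_unit_def by metis
    \<comment> \<open>The images of 0 and 1 are added to the breakpoints because linearity of c is
      given on [0, 1] only; beyond them h is the identity.\<close>
    show ?thesis unfolding piecewise_linear_unit_def
    proof (intro exI[of _ "(\<lambda>u. p + s * u) ` (S \<union> {0, 1})"] conjI ballI impI)
      show "finite ((\<lambda>u. p + s * u) ` (S \<union> {0, 1}))" using S by simp
      fix x y :: real
      assume "x \<in> {0..1}" "y \<in> {0..1}"
        and xy: "x < y \<and> {x<..<y} \<inter> (\<lambda>u. p + s * u) ` (S \<union> {0, 1}) = {}"
      define x' y' where "x' = (x - p) / s" and "y' = (y - p) / s"
      have xy': "x = p + s * x'" "y = p + s * y'" using s0 by (simp_all add: x'_def y'_def)
      have less: "x' < y'" using xy s0 by (simp add: x'_def y'_def divide_strict_right_mono)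
      have disj: "u \<notin> S \<union> {0, 1}" if "x' < u" "u < y'" for u
      proof
        assume "u \<in> S \<union> {0, 1}"
        moreover have "p + s * u \<in> {x<..<y}" using that s0 by (simp add: xy')
        ultimately show False using xy by blast
      qed
      have "\<not> (x' < 0 \<and> 0 < y')" "\<not> (x' < 1 \<and> 1 < y')" using disj[of 0] disj[of 1] by auto
      then consider "y' \<le> 0" | "1 \<le> x'" | "0 \<le> x'" "y' \<le> 1" by linarith
      then show "\<exists>m d. \<forall>t\<in>{x..y}. h t = m * t + d"
      proof cases
        case 1
        then have "y \<le> p" using s0 by (simp add: xy' mult_nonneg_nonpos)
        then have "\<forall>t\<in>{x..y}. h t = 1 * t + 0" using h_out by auto
        then show ?thesis by blast
      next
        case 2
        then have "s * 1 \<le> s * x'" using s0 by (intro mult_left_mono) auto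
        then have "p + s/4 \<le> x" using s0 by (simp add: xy')
        then have "\<forall>t\<in>{x..y}. h t = 1 * t + 0" using h_out by auto
        then show ?thesis by blast
      next
        case 3
        then have "x' \<in> {0..1}" "y' \<in> {0..1}" "x' < y' \<and> {x'<..<y'} \<inter> S = {}"
          using less disj by auto
        then have "\<exists>m d. \<forall>t\<in>{x'..y'}. c t = m * t + d" using lin by (simp only: Ball_def)
        then obtain m d where md: "\<And>t. t \<in> {x'..y'} \<Longrightarrow> c t = m * t + d" by metis
        have "h t = m * t + (p - m * p + s * d)" if "t \<in> {x..y}" for t
        proof -
          have "(t - p) / s \<in> {x'..y'}" using that s0 by (auto simp: x'_def y'_def divide_right_mono)
          then have "h t = p + s * (m * ((t - p) / s) + d)" by (simp add: h_def md)
          also have "\<dots> = m * t + (p - m * p + s * d)" using s0 by (simp add: field_simps)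
          finally show ?thesis .
        qed
        then show ?thesis by blast
      qed
    qed
  qed
  have diff: "\<exists>S. finite S \<and> S \<subseteq> dyadics \<and> (\<forall>x\<in>{0..1} - S. h differentiable (at x within {0..1}))"
  proof -
    have "\<exists>S. finite S \<and> S \<subseteq> dyadics \<and> (\<forall>x\<in>{0..1} - S. c differentiable (at x within {0..1}))"
      using c(1) by (simp add: thompson_F_def)
    then obtain S where S: "finite S" "S \<subseteq> dyadics"
      and d: "\<forall>x\<in>{0..1} - S. c differentiable (at x within {0..1})" by metis
    have "(0::real) = of_nat 0 / 2 ^ 0" "(1::real) = of_nat 1 / 2 ^ 0" by simp_all
    then have "0 \<in> (dyadics :: real set)" "1 \<in> (dyadics :: real set)"
      unfolding dyadics_def by blast+
    then have sub: "S \<union> {0, 1} \<subseteq> dyadics" using S(2) by auto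
    have dy: "(\<lambda>u. p + s * u) ` (S \<union> {0, 1}) \<subseteq> dyadics"
    proof (rule image_subsetI)
      fix u assume "u \<in> S \<union> {0, 1}"
      then have "p + u / 2 ^ k \<in> dyadics" using sub by (intro dyadic_affine[OF p(1)]) (rule subsetD)
      then show "p + s * u \<in> dyadics" by (simp add: s)
    qed
    have "h differentiable (at x within {0..1})" if x: "x \<in> {0..1} - (\<lambda>u. p + s * u) ` (S \<union> {0, 1})" for x
    proof -
      define x' where "x' = (x - p) / s"
      have xx': "x = p + s * x'" using s0 by (simp add: x'_def)
      have "x' \<notin> S \<union> {0, 1}" using x xx' by blast
      then have "x' \<noteq> 0" "x' \<noteq> 1" "x' \<notin> S" by auto
      then consider "x' < 0" | "1 < x'" | "0 < x'" "x' < 1" "x' \<notin> S" by linarith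
      then have "h differentiable (at x)"
      proof cases
        case 1
        then have xp: "x \<in> {..<p}" using s0 by (simp add: xx' mult_pos_neg)
        have "((\<lambda>t. t) has_derivative (\<lambda>t. t)) (at x)" by (rule has_derivative_ident)
        then have "(h has_derivative (\<lambda>t. t)) (at x)"
          by (rule has_derivative_transform_within_open[OF _ open_lessThan xp]) (simp add: h_out)
        then show ?thesis by (auto simp: differentiable_def)
      next
        case 2
        then have "s * 1 < s * x'" using s0 by (intro mult_strict_left_mono)
        then have xp: "x \<in> {p + s/4<..}" using s0 by (simp add: xx')
        have "((\<lambda>t. t) has_derivative (\<lambda>t. t)) (at x)" by (rule has_derivative_ident)
        then have "(h has_derivative (\<lambda>t. t)) (at x)"
          by (rule has_derivative_transform_within_open[OF _ open_greaterThan xp]) (simp add: h_out)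
        then show ?thesis by (auto simp: differentiable_def)
      next
        case 3
        then have "c differentiable (at x' within {0..1})" by (intro bspec[OF d]) auto
        moreover have "at x' within {0..1} = at x'" using 3 by (intro at_within_interior) simp
        ultimately have "c differentiable (at ((x - p) / s))" by (simp add: x'_def)
        moreover have "(\<lambda>x. (x - p) / s) differentiable (at x)" using s0 by (intro derivative_intros) auto
        ultimately have "(\<lambda>x. c ((x - p) / s)) differentiable (at x)"
          by (rule differentiable_compose)
        then show ?thesis unfolding h_def by (intro derivative_intros)
      qed
      then show ?thesis by (rule differentiable_at_withinI)
    qed
    then show ?thesis using dy S(1) by (intro exI[of _ "(\<lambda>u. p + s * u) ` (S \<union> {0, 1})"]) auto
  qed
  have pow: "\<exists>n::int. D = 2 powi n"
    if x: "x \<in> {0..1}" and D: "(h has_real_derivative D) (at x within {0..1})" for x D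
  proof -
    have p1: "p < 1" "p + s/4 < 1" using s(2) s0 by linarith+
    have one: "\<exists>n::int. D = 2 powi n" if "D = 1" using that by (intro exI[of _ 0]) simp
    \<comment> \<open>The outer cases include p and p + s/4, where h agrees with the identity on one
      side at least. In the inner case the scale factors of the chain rule cancel, and D is a slope
      of c.\<close>
    consider "x \<le> p" | "p + s/4 \<le> x" | "p < x" "x < p + s/4" by linarith
    then show ?thesis
    proof cases
      case 1
      have "D = 1"
        by (rule real_derivative_identity_on_interval[OF D, of 0 p]) (use x 1 p(2) p1 h_out in auto)
      then show ?thesis by (rule one)
    next
      case 2
      have "D = 1"
        by (rule real_derivative_identity_on_interval[OF D, of "p + s/4" 1]) (use x 2 p(2) p1 s0 h_out in auto)
      then show ?thesis by (rule one)
    next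
      case 3
      define x' where "x' = (x - p) / s"
      have xx': "x = p + s * x'" using s0 by (simp add: x'_def)
      have x'01: "0 < x'" "x' < 1" using 3 s0 by (simp_all add: x'_def field_simps)
      have "at x within {0..1} = at x" using 3 p s s0 by (intro at_within_interior) simp
      then have hD: "(h has_real_derivative D) (at (p + s * x'))" using D by (simp add: xx')
      have "((\<lambda>u. p + s * u) has_real_derivative s) (at x')" by (auto intro!: derivative_eq_intros)
      from DERIV_chain2[OF hD this]
      have "((\<lambda>u. h (p + s * u)) has_real_derivative D * s) (at x')" .
      then have "((\<lambda>u. (h (p + s * u) - p) / s) has_real_derivative D * s / s) (at x')"
        by (auto intro!: derivative_eq_intros)
      moreover have "(\<lambda>u. (h (p + s * u) - p) / s) = c" using s0 by (simp add: h_def)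
      ultimately have "(c has_real_derivative D) (at x')" using s0 by simp
      then have "(c has_real_derivative D) (at x' within {0..1})" by (rule has_field_derivative_at_within)
      then show ?thesis using c(1) x'01 by (auto simp: thompson_F_def)
    qed
  qed
  have "strict_mono_on {0..1} h"
    using unit_homeosD(1)[OF hU] by (simp add: strict_mono_on_def strict_mono_def)
  then show "h \<in> carrier thompson_F"
    using unit_homeos_subset_Homeo_unit[OF hU] pl diff pow by (simp add: thompson_F_def)
qed

section \<open>The group of a labelling\<close>

lemma G_rho_nat_pow:
  "f [^]\<^bsub>Homeo_plus_real\<lparr>carrier := H\<rparr>\<^esub> (n::nat) = f ^^ n"
proof (induction n)
  case 0
  show ?case by (simp add: nat_pow_def Homeo_plus_real_def)
next
  case (Suc n)
  have "f [^]\<^bsub>Homeo_plus_real\<lparr>carrier := H\<rparr>\<^esub> Suc n = f \<circ> f [^]\<^bsub>Homeo_plus_real\<lparr>carrier := H\<rparr>\<^esub> n"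
    by (simp add: nat_pow_def Homeo_plus_real_def)
  then show ?case by (simp add: Suc)
qed

text \<open>Since maps act on the right, \<open>h \<otimes> g = g \<otimes> k\<close> reads \<open>g \<circ> h = k \<circ> g\<close>.\<close>

locale thompson_copies =
  fixes \<Phi> :: "(real \<Rightarrow> real) set" and H S :: "(real \<Rightarrow> real) set"
    and a :: real and \<sigma> :: "int \<Rightarrow> bool" and f0 c0 :: "real \<Rightarrow> real"
  assumes F_def: "\<Phi> = thompson_F_on (1/16) (15/16)"
    and F_group: "subgroup \<Phi> Homeo_unit"
    and c0: "c0 \<in> carrier thompson_F" "Supp c0 = {0<..<1/4}"
    and S_conj: "\<And>g h k. \<lbrakk>g \<in> H; h \<in> S; k \<in> S; h \<noteq> id; g \<circ> h = k \<circ> g\<rbrakk> \<Longrightarrow> g \<in> S"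
    and f0: "f0 \<in> \<Phi>" "f0 \<noteq> id" "Supp f0 \<subseteq> {3/8..5/8}" "periodic_copies a \<sigma> f0 \<in> S"
begin

abbreviation "Z \<equiv> periodic_copies a \<sigma>"

lemma F_unit: "f \<in> \<Phi> \<Longrightarrow> f \<in> unit_homeos"
  unfolding F_def thompson_F_on_def using thompson_subset_unit_homeos by simp

text \<open>The copy of f commutes with the copy of f0, so it conjugates a nontrivial element of S
  to itself.\<close>

lemma disjoint_mem:
  assumes f: "f \<in> unit_homeos" "Z f \<in> H" "Supp f \<inter> {3/8..5/8} = {}"
  shows "Z f \<in> S"
proof (rule S_conj[OF f(2) f0(4) f0(4)])
  note f0U = F_unit[OF f0(1)]
  show "Z f0 \<noteq> id" by (rule copies_neq_id[OF f0U f0(2)])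
  have "Supp f \<inter> Supp f0 = {}" using f(3) f0(3) by auto
  then have "f \<circ> f0 = f0 \<circ> f" by (rule disjoint_support_commute[OF unit_homeosD(5)[OF f(1)] unit_homeosD(5)[OF f0U]])
  then show "Z f \<circ> Z f0 = Z f0 \<circ> Z f"
    by (simp only: copies_comp[OF f0U f(1), symmetric] copies_comp[OF f(1) f0U, symmetric])
qed

lemma F_mem:
  assumes f: "f \<in> \<Phi>" and ZH: "\<And>g. g \<in> \<Phi> \<Longrightarrow> Z g \<in> H"
  shows "Z f \<in> S"
proof -
  interpret group Homeo_unit by (rule group_Homeo_unit)
  note fU = F_unit[OF f] and fsub = subgroup.mem_carrier[OF F_group f]
  \<comment> \<open>y1 marks the points that f keeps at or left of 1/4. The point y0 separates it
    from 1/16: f fixes everything below 1/16, so y0 is at least 1/16, and y0 < y1.\<close>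
  obtain y0 y1 where y: "f y0 = 1/8" "f y1 = 1/4" using unit_homeosD(2)[OF fU] by (metis surj_def)
  have "1/16 \<le> y0"
  proof (rule ccontr)
    assume "\<not> 1/16 \<le> y0"
    moreover have "Supp f \<subseteq> {1/16..15/16}" using f by (simp add: F_def thompson_F_on_def)
    ultimately have "f y0 = y0" by (auto simp: Supp_def)
    then show False using y \<open>\<not> 1/16 \<le> y0\<close> by simp
  qed
  moreover have "y0 < y1" using unit_homeos_less[OF fU, of y0 y1] y by simp
  ultimately have y1: "1/16 < y1" by simp
  \<comment> \<open>The bound y1 - 1/16 keeps the image of the support of h left of 1/4, and the
    bound 1/8 keeps the support itself left of 3/8. A power of 1/2 is required for the
    rescaling.\<close>
  then obtain k :: nat where k: "(1/2) ^ k < min (y1 - 1/16) (1/8)"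
    using real_arch_pow_inv[of "min (y1 - 1/16) (1/8)" "1/2"] by auto
  define s :: real where "s = 1 / 2 ^ k"
  have s: "s < y1 - 1/16" "s < 1/8" using k by (simp_all add: s_def power_one_over)
  have p: "1/16 \<in> (dyadics :: real set)"
  proof -
    have "(1/16 :: real) = of_nat 1 / 2 ^ 4" by simp
    then show ?thesis unfolding dyadics_def by blast
  qed
  define h where "h = (\<lambda>x. 1/16 + s * c0 ((x - 1/16) / s))"
  have h: "h \<in> carrier thompson_F" "Supp h \<subseteq> {1/16..1/16 + s}" "h \<noteq> id" unfolding h_def
    using scaled_thompson_element[OF c0 p _ s_def] s(2) by simp_all
  have hF: "h \<in> \<Phi>" using h(1,2) s(2) by (auto simp: F_def thompson_F_on_def)
  \<comment> \<open>With maps acting on the right, j moves f z exactly when h moves z, so its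
    support is the image under f of the support of h.\<close>
  define j where "j = inv\<^bsub>Homeo_unit\<^esub> f \<otimes>\<^bsub>Homeo_unit\<^esub> h \<otimes>\<^bsub>Homeo_unit\<^esub> f"
  have jF: "j \<in> \<Phi>" unfolding j_def
    by (intro subgroup.m_closed[OF F_group] subgroup.m_inv_closed[OF F_group] f hF)
  note hsub = subgroup.mem_carrier[OF F_group hF]
  have "f \<otimes>\<^bsub>Homeo_unit\<^esub> j = h \<otimes>\<^bsub>Homeo_unit\<^esub> f"
    unfolding j_def using fsub hsub by (simp only: m_assoc[symmetric] r_inv inv_closed m_closed l_one)
  then have fj: "f \<circ> h = j \<circ> f" by simp
  have "Supp j \<subseteq> {1/16..1/4}"
  proof
    fix x assume x: "x \<in> Supp j"
    have "x \<in> {1/16..15/16}" using jF x by (auto simp: F_def thompson_F_on_def)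
    moreover obtain z where z: "x = f z" using unit_homeosD(2)[OF fU] by (rule surjE)
    have "f (h z) \<noteq> f z" using x fun_cong[OF fj, of z] by (simp add: Supp_def z)
    then have "z \<in> Supp h" by (auto simp: Supp_def)
    then have "z \<le> 1/16 + s" using h(2) by auto
    then have "z \<le> y1" using s(1) by simp
    then have "f z \<le> f y1" by (simp only: unit_homeos_le[OF fU])
    ultimately show "x \<in> {1/16..1/4}" using z y by simp
  qed
  then have jS: "Z j \<in> S" by (intro disjoint_mem F_unit jF ZH) auto
  have hS: "Z h \<in> S" using h(2) s(2) by (intro disjoint_mem F_unit hF ZH) auto
  show ?thesis
  proof (rule S_conj[OF ZH[OF f] hS jS])
    show "Z h \<noteq> id" by (rule copies_neq_id[OF F_unit[OF hF] h(3)])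
    show "Z f \<circ> Z h = Z j \<circ> Z f"
      by (simp only: copies_comp[OF F_unit[OF hF] fU, symmetric] copies_comp[OF fU F_unit[OF jF], symmetric] fj)
  qed
qed

end

text \<open>Copying is multiplicative on \<open>unit_homeos\<close>; the hypothesis
  \<open>sub\<close> keeps every word in the generators, and every inverse, inside that set.\<close>

lemma copies_generate:
  assumes sub: "\<And>f. f \<in> generate Homeo_unit B \<Longrightarrow> f \<in> unit_homeos"
    and gens: "\<And>f. f \<in> B \<Longrightarrow> periodic_copies a \<sigma> f \<in> A" and A: "A \<subseteq> carrier Homeo_plus_real"
    and B: "B \<subseteq> carrier Homeo_unit"
    and f: "f \<in> generate Homeo_unit B"
  shows "periodic_copies a \<sigma> f \<in> generate Homeo_plus_real A"
proof -
  interpret U: group Homeo_unit by (rule group_Homeo_unit)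
  interpret R: group Homeo_plus_real by (rule group_Homeo_plus_real)
  show ?thesis using f
  proof (induction rule: generate.induct)
    case one
    show ?case using generate.one[of Homeo_plus_real A]
      by (simp only: Homeo_unit_simps(2) Homeo_plus_real_simps(2) copies_id)
  next
    case (incl f)
    show ?case by (rule generate.incl[OF gens[OF incl]])
  next
    case (inv f)
    have fU: "f \<in> unit_homeos" by (rule sub[OF generate.incl[OF inv]])
    have gU: "inv\<^bsub>Homeo_unit\<^esub> f \<in> unit_homeos" by (rule sub[OF generate.inv[OF inv]])
    have "f \<in> carrier Homeo_unit" using B inv by auto
    then have "inv\<^bsub>Homeo_unit\<^esub> f \<otimes>\<^bsub>Homeo_unit\<^esub> f = \<one>\<^bsub>Homeo_unit\<^esub>" by (rule U.l_inv)
    then have "f \<circ> inv\<^bsub>Homeo_unit\<^esub> f = id" by simp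
    then have "periodic_copies a \<sigma> f \<circ> periodic_copies a \<sigma> (inv\<^bsub>Homeo_unit\<^esub> f) = id"
      by (simp only: copies_comp[OF gU fU, symmetric] copies_id)
    then have "inv\<^bsub>Homeo_plus_real\<^esub> (periodic_copies a \<sigma> f) = periodic_copies a \<sigma> (inv\<^bsub>Homeo_unit\<^esub> f)"
      using copies_mem[OF fU, of a \<sigma>] copies_mem[OF gU, of a \<sigma>] by (intro R.inv_equality) simp_all
    then show ?case using generate.inv[OF gens[OF inv], of Homeo_plus_real] by simp
  next
    case (eng f g)
    have "periodic_copies a \<sigma> (g \<circ> f) = periodic_copies a \<sigma> g \<circ> periodic_copies a \<sigma> f"
      by (rule copies_comp[OF sub[OF eng.hyps(1)] sub[OF eng.hyps(2)]])
    then show ?case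
      using generate.eng[OF eng.IH] by (simp only: Homeo_unit_simps(1) Homeo_plus_real_simps(1))
  qed
qed

theorem theorem1p4:
  fixes c0 \<nu>2 \<nu>3 :: "real \<Rightarrow> real" and \<rho> :: "real \<Rightarrow> letter"
  assumes "c0 \<in> carrier thompson_F"
    and "Supp c0 = {0<..<1/4}"
    and "\<forall>x\<in>{0<..<1/4}. c0 x > x"
    and "\<forall>t\<in>{0<..<1/16}. c0 t = 2 * t"
    and "\<nu>2 \<in> carrier Homeo_unit" and "Supp \<nu>2 \<subseteq> {1/16<..<15/16}"
    and "\<nu>3 \<in> carrier Homeo_unit" and "Supp \<nu>3 \<subseteq> {1/16<..<15/16}"
    and "generate Homeo_unit {\<nu>2, \<nu>3} = thompson_F_on (1/16) (15/16)"
    and "labelling \<rho>" and "quasi_periodic \<rho>"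
  shows "first_l2_betti (G_rho (nu1 c0) \<nu>2 \<nu>3 \<rho>) = 0"
proof -
  define \<Phi> where "\<Phi> = thompson_F_on (1/16) (15/16)"
  define A where "A = {zeta \<rho> (nu1 c0), zeta \<rho> \<nu>2, zeta \<rho> \<nu>3, chi \<rho> (nu1 c0), chi \<rho> \<nu>2, chi \<rho> \<nu>3}"
  define H where "H = generate Homeo_plus_real A"
  define \<sigma> where "\<sigma> = (\<lambda>n. \<rho> (of_int n + 1/2) = Gen_b)"
  define \<tau> where "\<tau> = (\<lambda>n. \<rho> (of_int n) = Gen_a)"
  note zeta_eq' = zeta_eq[of \<rho>, folded \<sigma>_def] and chi_eq' = chi_eq[of \<rho>, folded \<tau>_def]
  interpret U: group Homeo_unit by (rule group_Homeo_unit)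
  interpret R: group Homeo_plus_real by (rule group_Homeo_plus_real)
  have gens: "{\<nu>2, \<nu>3} \<subseteq> carrier Homeo_unit" using assms(5,7) by simp
  have \<Phi>_eq: "\<Phi> = generate Homeo_unit {\<nu>2, \<nu>3}" by (simp add: \<Phi>_def assms(9))
  have \<Phi>_sub: "subgroup \<Phi> Homeo_unit" unfolding \<Phi>_eq by (rule U.generate_is_subgroup[OF gens])
  have \<Phi>_unit: "f \<in> unit_homeos" if "f \<in> \<Phi>" for f
    using that thompson_subset_unit_homeos by (simp add: \<Phi>_def thompson_F_on_def)
  have \<nu>\<Phi>: "\<nu>2 \<in> \<Phi>" "\<nu>3 \<in> \<Phi>" unfolding \<Phi>_eq by (auto intro: generate.incl)
  have c0U: "c0 \<in> unit_homeos" by (rule thompson_subset_unit_homeos[OF assms(1)])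
  have \<nu>1_eq: "nu1 c0 = flip c0 \<circ> c0" by (simp add: nu1_def)
  have \<nu>1U: "nu1 c0 \<in> unit_homeos"
    unfolding \<nu>1_eq by (rule unit_homeos_comp[OF c0U flip_unit_homeos[OF c0U]])
  \<comment> \<open>\<open>c0\<close> moves only points of (0, 1/4) and its flip only points of
    (3/4, 1).\<close>
  have \<nu>1_supp: "Supp (nu1 c0) \<inter> {3/8..5/8} = {}"
  proof -
    have c0_id: "c0 x = x" if "1/4 \<le> x" for x
    proof (rule ccontr)
      assume "c0 x \<noteq> x"
      then have "x \<in> Supp c0" by (simp add: Supp_def)
      with that show False by (simp add: assms(2))
    qed
    have "nu1 c0 x = x" if "x \<in> {3/8..5/8}" for x
      using that by (simp add: \<nu>1_eq flip_eq[OF c0U] c0_id)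
    then show ?thesis by (auto simp: Supp_def)
  qed
  have unit: "f \<in> unit_homeos" if "f \<in> {nu1 c0, \<nu>2, \<nu>3}" for f using that \<nu>1U \<Phi>_unit \<nu>\<Phi> by auto
  have A_sub: "A \<subseteq> carrier Homeo_plus_real"
    unfolding A_def zeta_eq' chi_eq' using unit by (auto intro!: copies_mem)
  have H_sub: "subgroup H Homeo_plus_real" unfolding H_def by (rule R.generate_is_subgroup[OF A_sub])
  have \<Phi>_copies: "periodic_copies a \<kappa> f \<in> H"
    if "\<And>g. g \<in> {\<nu>2, \<nu>3} \<Longrightarrow> periodic_copies a \<kappa> g \<in> A" "f \<in> \<Phi>" for a \<kappa> f unfolding H_def
  proof (rule copies_generate[OF _ that(1) A_sub gens])
    show "g \<in> unit_homeos" if "g \<in> generate Homeo_unit {\<nu>2, \<nu>3}" for g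
      using \<Phi>_unit[of g] that by (simp only: \<Phi>_eq)
    show "f \<in> generate Homeo_unit {\<nu>2, \<nu>3}" using that(2) by (simp only: \<Phi>_eq)
  qed
  have ZH: "periodic_copies 0 \<sigma> f \<in> H" "periodic_copies (1/2) \<tau> f \<in> H" if f: "f \<in> \<Phi>" for f
    by (rule \<Phi>_copies[OF _ f], auto simp: A_def zeta_eq' chi_eq')+
  have \<nu>1H: "periodic_copies 0 \<sigma> (nu1 c0) \<in> H" "periodic_copies (1/2) \<tau> (nu1 c0) \<in> H"
    unfolding H_def by (auto intro!: generate.incl simp: A_def zeta_eq' chi_eq')
  \<comment> \<open>The rescaling of \<open>c0\<close> with p = 3/8 and s = 1/4, which places its
    support inside [3/8, 5/8].\<close>
  define f0 where "f0 = (\<lambda>x. 3/8 + (1/4) * c0 ((x - 3/8) / (1/4)))"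
  have "(3/8 :: real) = of_nat 3 / 2 ^ 3" by simp
  then have p: "3/8 \<in> (dyadics :: real set)" unfolding dyadics_def by blast
  have "(1/4 :: real) = 1 / 2 ^ 2" by simp
  note f0_raw = scaled_thompson_element[OF assms(1,2) p _ this]
  have f0: "f0 \<in> carrier thompson_F" "Supp f0 \<subseteq> {3/8..5/8}" "f0 \<noteq> id"
    using f0_raw unfolding f0_def by simp_all
  have f0\<Phi>: "f0 \<in> \<Phi>" using f0(1,2) by (auto simp: \<Phi>_def thompson_F_on_def)
  define G where "G = G_rho (nu1 c0) \<nu>2 \<nu>3 \<rho>"
  have G_eq: "G = Homeo_plus_real\<lparr>carrier := H\<rparr>" by (simp add: G_def G_rho_def H_def A_def)
  have G_simps: "carrier G = H" "f \<otimes>\<^bsub>G\<^esub> g = g \<circ> f" "\<one>\<^bsub>G\<^esub> = id" for f g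
    by (simp_all add: G_eq Homeo_plus_real_def)
  interpret G: group G unfolding G_eq by (rule subgroup.subgroup_is_group[OF H_sub group_Homeo_plus_real])
  have H_mono: "strict_mono f" if "f \<in> H" for f
    using subgroup.mem_carrier[OF H_sub that] by (simp add: carrier_Homeo_plus_real)
  define t where "t = periodic_copies 0 \<sigma> f0"
  have t: "t \<in> H" "t \<noteq> id"
    unfolding t_def by (rule ZH(1)[OF f0\<Phi>], rule copies_neq_id[OF \<Phi>_unit[OF f0\<Phi>] f0(3)])
  have "first_l2_betti G = 0"
  proof (rule G.first_l2_betti_eq_zero)
    show "g [^]\<^bsub>G\<^esub> n \<noteq> \<one>\<^bsub>G\<^esub>" if "g \<in> carrier G" "g \<noteq> \<one>\<^bsub>G\<^esub>" "0 < n" for g and n :: nat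
      using that funpow_strict_mono_neq_id[OF H_mono, of g n]
      unfolding G_simps by (simp add: G_eq G_rho_nat_pow)
    show "t \<in> carrier G" "t \<noteq> \<one>\<^bsub>G\<^esub>" using t by (simp_all add: G_simps)
    fix S assume S: "subgroup S G" and tS: "t \<in> S"
      and conj: "\<And>g h k. \<lbrakk>g \<in> carrier G; h \<in> S; k \<in> S; h \<noteq> \<one>\<^bsub>G\<^esub>; h \<otimes>\<^bsub>G\<^esub> g = g \<otimes>\<^bsub>G\<^esub> k\<rbrakk> \<Longrightarrow> g \<in> S"
    have S_conj: "g \<in> S" if "g \<in> H" "h \<in> S" "k \<in> S" "h \<noteq> id" "g \<circ> h = k \<circ> g" for g h k
      by (rule conj[of g h k]) (use that in \<open>simp_all add: G_simps\<close>)
    have copies: "thompson_copies \<Phi> H S a \<kappa> f0 c0" if "periodic_copies a \<kappa> f0 \<in> S" for a \<kappa>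
      by (rule thompson_copies.intro[OF \<Phi>_def \<Phi>_sub assms(1,2) _ f0\<Phi> f0(3,2) that])
        (rule S_conj)
    \<comment> \<open>The same argument runs on both tilings, each time started by the copy of f0.
      On the integer tiling that copy is t; on the shifted one it enters S because it commutes with
      t.\<close>
    interpret zeta: thompson_copies \<Phi> H S 0 \<sigma> f0 c0 by (rule copies) (rule tS[unfolded t_def])
    have chi_f0: "periodic_copies (1/2) \<tau> f0 \<in> S"
    proof (rule S_conj[OF ZH(2)[OF f0\<Phi>] tS tS t(2)])
      show "periodic_copies (1/2) \<tau> f0 \<circ> t = t \<circ> periodic_copies (1/2) \<tau> f0"
        unfolding t_def by (rule zeta_chi_commute[OF \<Phi>_unit[OF f0\<Phi>] f0(2), symmetric])
    qed
    interpret chi: thompson_copies \<Phi> H S "1/2" \<tau> f0 c0 by (rule copies[OF chi_f0])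
    have "A \<subseteq> S" unfolding A_def zeta_eq' chi_eq'
      using zeta.disjoint_mem[OF \<nu>1U \<nu>1H(1) \<nu>1_supp] chi.disjoint_mem[OF \<nu>1U \<nu>1H(2) \<nu>1_supp]
        zeta.F_mem[OF \<nu>\<Phi>(1) ZH(1)] zeta.F_mem[OF \<nu>\<Phi>(2) ZH(1)]
        chi.F_mem[OF \<nu>\<Phi>(1) ZH(2)] chi.F_mem[OF \<nu>\<Phi>(2) ZH(2)] by simp
    moreover have "subgroup S Homeo_plus_real" by (rule R.incl_subgroup[OF H_sub S[unfolded G_eq]])
    ultimately show "carrier G \<subseteq> S" unfolding G_simps H_def by (rule R.generate_subgroup_incl)
  qed
  then show ?thesis by (simp add: G_def)
qed

end
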